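(* Let $\mathcal A\subset L^1_{loc}(\mathbb J,X)$ or $\mathcal A\subset\mathcal D'(\mathbb J,X)$ be uniformly closed, and let $n,k\in\mathbb N_0$. Then $$(\mathcal M^{n+k}\mathcal A)\cap\mathcal M^kC_u(\mathbb J,X)=(\widetilde{\mathcal M}^{n+k}\mathcal A)\cap\mathcal M^kC_u(\mathbb J,X)\subset\mathcal M^k\mathcal A$$ (the expression with $\widetilde{\mathcal M}$ being considered only for open $\mathbb J$), and, for $\mathbb J=\mathbb R$, $$\mathcal D'_{\mathcal A}(\mathbb R,X)\cap\widetilde{\mathcal M}^kC_u(\mathbb R,X)\subset\widetilde{\mathcal M}^k\mathcal A .$$
   Context: $X$ is a Banach space over $\mathbb K=\mathbb R$ or $\mathbb C$; $\mathbb J$ is an interval of the form $\mathbb R$, $(\alpha,\infty)$ or $[\alpha,\infty)$, $\alpha\in\mathbb R$ (open whenever $\mathcal D'(\mathbb J,X)$ occurs). $C_u(\mathbb J,X)$: uniformly continuous functions. $\mathcal D(\mathbb J,\mathbb K)$: Schwartz test functions; $\mathcal D'(\mathbb J,X)$: linear continuous maps $\mathcal D(\mathbb J,\mathbb K)\to X$. Locally Bochner integrable functions that agree a.e. are identified with each other and, for open $\mathbb J$, with the distribution they define. Uniformly closed: if $(\phi_n)$ is a sequence of functions in $\mathcal A$ and $\phi_n\to\phi$ uniformly on $\mathbb J$, then $\phi\in\mathcal A$. For $h\ne0$: $M_hf(t)=\frac1h\int_0^hf(t+s)\,ds$; $\widetilde M_hT(\varphi)=T(M_{-h}\varphi)$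 with $\varphi\in\mathcal D(\mathbb J,\mathbb K)$ extended by $0$ outside $\mathbb J$. For a class $\mathcal B$: $\mathcal M\mathcal B=\{f\in L^1_{loc}(\mathbb J,X):M_hf\in\mathcal B\ \forall h>0\}$, $\mathcal M^0\mathcal B=\mathcal B\cap L^1_{loc}(\mathbb J,X)$, $\mathcal M^j\mathcal B=\mathcal M(\mathcal M^{j-1}\mathcal B)$ for $j\ge1$; $\widetilde{\mathcal M}\mathcal B=\{T\in\mathcal D'(\mathbb J,X):\widetilde M_hT\in\mathcal B\ \forall h>0\}$, $\widetilde{\mathcal M}^0\mathcal B=\mathcal B$, $\widetilde{\mathcal M}^j\mathcal B=\widetilde{\mathcal M}(\widetilde{\mathcal M}^{j-1}\mathcal B)$. $\mathcal D'_{\mathcal A}(\mathbb R,X)=\{T\in\mathcal D'(\mathbb R,X):T*\varphi\in\mathcal A\ \forall\varphi\in\mathcal D(\mathbb R,\mathbb K)\}$, where $(T*\varphi)(x)=T(y\mapsto\varphi(x-y))$. *)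

theory Defs
  imports "HOL-Analysis.Analysis"
begin

section \<open>Scalars\<close>

text \<open>
  The scalar field is a type variable of sort \<open>{real_normed_field, euclidean_space}\<close>.  Both
  \<^typ>\<open>real\<close> and \<^typ>\<open>complex\<close> have this sort, and by Frobenius' theorem every field of this sort is
  isometrically isomorphic to one of them.  The library has no class of complex Banach spaces, so
  the scalar multiplication of \<open>X\<close> is an explicit argument \<open>sc\<close>; it extends the real one, and for
  real scalars it is \<open>scaleR\<close>.
\<close>

definition banach_over ::
  "('k::{real_normed_field,euclidean_space} \<Rightarrow> 'x::banach \<Rightarrow> 'x) \<Rightarrow> bool" where
  "banach_over sc \<longleftrightarrow> vector_space sc
     \<and> (\<forall>r x. sc (of_real r) x = r *\<^sub>R x)
     \<and> (\<forall>c x. norm (sc c x) = norm c * norm x)"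


section \<open>Bochner integral in an arbitrary Banach space\<close>

text \<open>
  The library's \<open>has_bochner_integral\<close> and \<open>lebesgue_integral\<close> are restricted to second countable
  (that is, separable) spaces.  These are the same definitions without that restriction.  As the
  simple functions take finitely many values, \<open>f - s i\<close> is measurable, and the convergence in mean
  forces \<open>f\<close> to be almost everywhere separably valued.
\<close>

definition has_bochner :: "'a measure \<Rightarrow> ('a \<Rightarrow> 'x::real_normed_vector) \<Rightarrow> 'x \<Rightarrow> bool" where
  "has_bochner M f I \<longleftrightarrow> f \<in> borel_measurable M \<and>
     (\<exists>s. (\<forall>i. Bochner_Integration.simple_bochner_integrable M (s i))
        \<and> (\<lambda>i. \<integral>\<^sup>+x. norm (f x - s i x) \<partial>M) \<longlonglongrightarrow> 0
        \<and> (\<lambda>i. Bochner_Integration.simple_bochner_integral M (s i)) \<longlonglongrightarrow> I)"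

lemma has_bochner_eq_library:
  fixes f :: "'a \<Rightarrow> 'b::{real_normed_vector,second_countable_topology}"
  shows "has_bochner M f I \<longleftrightarrow> has_bochner_integral M f I"
  unfolding has_bochner_def has_bochner_integral.simps by auto

definition bochner_integral :: "'a measure \<Rightarrow> ('a \<Rightarrow> 'x::real_normed_vector) \<Rightarrow> 'x" where
  "bochner_integral M f =
     (if \<exists>I. has_bochner M f I then THE I. has_bochner M f I else 0)"


section \<open>Functions on an interval\<close>

definition admissible_interval :: "real set \<Rightarrow> bool" where
  "admissible_interval J \<longleftrightarrow> J = UNIV \<or> (\<exists>\<alpha>. J = {\<alpha><..}) \<or> (\<exists>\<alpha>. J = {\<alpha>..})"

text \<open>
  A function on \<open>J\<close> is represented by a total function whose values outside \<open>J\<close> are irrelevant.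
  Classes of functions modulo equality almost everywhere on \<open>J\<close> are represented by sets of
  functions that are closed under this equality.
\<close>

definition L1loc :: "real set \<Rightarrow> (real \<Rightarrow> 'x::real_normed_vector) set" where
  "L1loc J = {f. \<forall>S. compact S \<and> S \<subseteq> J \<longrightarrow> (\<exists>I. has_bochner (lebesgue_on S) f I)}"

definition ae_closed :: "real set \<Rightarrow> (real \<Rightarrow> 'x) set \<Rightarrow> bool" where
  "ae_closed J F \<longleftrightarrow> (\<forall>f\<in>F. \<forall>g. (AE t in lebesgue_on J. f t = g t) \<longrightarrow> g \<in> F)"

definition Cu :: "real set \<Rightarrow> (real \<Rightarrow> 'x::real_normed_vector) set" where
  "Cu J = {f. \<exists>g. uniformly_continuous_on J g \<and> (AE t in lebesgue_on J. f t = g t)}"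

text \<open>The integral from \<open>0\<close> to \<open>h\<close> is oriented: \<open>h\<close> may be negative.\<close>

definition Mean :: "real \<Rightarrow> (real \<Rightarrow> 'x::real_normed_vector) \<Rightarrow> real \<Rightarrow> 'x" where
  "Mean h f t = (1 / h) *\<^sub>R
     (if 0 \<le> h then bochner_integral (lebesgue_on {0..h}) (\<lambda>s. f (t + s))
      else - bochner_integral (lebesgue_on {h..0}) (\<lambda>s. f (t + s)))"


section \<open>Test functions and distributions\<close>

definition vderiv :: "nat \<Rightarrow> (real \<Rightarrow> 'k::real_normed_vector) \<Rightarrow> real \<Rightarrow> 'k" where
  "vderiv m \<phi> = ((\<lambda>g t. vector_derivative g (at t)) ^^ m) \<phi>"

definition support :: "(real \<Rightarrow> 'k::zero) \<Rightarrow> real set" where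
  "support \<phi> = closure {t. \<phi> t \<noteq> 0}"

text \<open>Test functions on \<open>J\<close> are already extended by \<open>0\<close> to the whole line.\<close>

definition test_functions :: "real set \<Rightarrow> (real \<Rightarrow> 'k::real_normed_vector) set" where
  "test_functions J = {\<phi>. (\<forall>m t. vderiv m \<phi> differentiable (at t))
     \<and> compact (support \<phi>) \<and> support \<phi> \<subseteq> J}"

text \<open>
  A linear map on the inductive limit of the metrizable spaces of test functions supported in a
  fixed compact set \<open>S\<close> is continuous iff it is sequentially continuous at \<open>0\<close> on each of them.
  Distributions are normalized to \<open>undefined\<close> outside the test functions, so that equality of
  distributions is equality on test functions.
\<close>

definition distributions :: "real set \<Rightarrow>
    ('k::{real_normed_field,euclidean_space} \<Rightarrow> 'x::banach \<Rightarrow> 'x) \<Rightarrow> ((real \<Rightarrow> 'k) \<Rightarrow> 'x) set" where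
  "distributions J sc = {T. T \<in> extensional (test_functions J)
     \<and> (\<forall>\<phi>\<in>test_functions J. \<forall>\<psi>\<in>test_functions J. \<forall>a b.
          T (\<lambda>t. a * \<phi> t + b * \<psi> t) = sc a (T \<phi>) + sc b (T \<psi>))
     \<and> (\<forall>S \<phi>. compact S \<and> S \<subseteq> J
          \<and> (\<forall>i::nat. \<phi> i \<in> test_functions J \<and> support (\<phi> i) \<subseteq> S)
          \<and> (\<forall>m. uniform_limit UNIV (\<lambda>i. vderiv m (\<phi> i)) (\<lambda>_. 0) sequentially)
          \<longrightarrow> (\<lambda>i. T (\<phi> i)) \<longlonglongrightarrow> 0)}"

definition regular_dist :: "real set \<Rightarrow>
    ('k::{real_normed_field,euclidean_space} \<Rightarrow> 'x::banach \<Rightarrow> 'x) \<Rightarrow>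
    (real \<Rightarrow> 'x) \<Rightarrow> (real \<Rightarrow> 'k) \<Rightarrow> 'x" where
  "regular_dist J sc f =
     restrict (\<lambda>\<phi>. bochner_integral (lebesgue_on J) (\<lambda>t. sc (\<phi> t) (f t))) (test_functions J)"

definition Mean_dist :: "real set \<Rightarrow> real \<Rightarrow>
    ((real \<Rightarrow> 'k::{real_normed_field,euclidean_space}) \<Rightarrow> 'x::banach) \<Rightarrow> (real \<Rightarrow> 'k) \<Rightarrow> 'x" where
  "Mean_dist J h T = restrict (\<lambda>\<phi>. T (Mean (- h) \<phi>)) (test_functions J)"

definition conv :: "((real \<Rightarrow> 'k) \<Rightarrow> 'x) \<Rightarrow> (real \<Rightarrow> 'k) \<Rightarrow> real \<Rightarrow> 'x" where
  "conv T \<phi> x = T (\<lambda>y. \<phi> (x - y))"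


section \<open>Classes of functions or of distributions\<close>

text \<open>
  A class is either a set of locally integrable functions or (for open \<open>J\<close>) a set of distributions.
  The identification of \<open>f\<close> with \<open>regular_dist J sc f\<close> is carried out by \<open>fun_part\<close>, the intersection
  of a class with \<open>L1loc J\<close>, and by \<open>dist_part\<close>, the class viewed as a set of distributions.
\<close>

datatype ('k, 'x) gclass =
    Funs "(real \<Rightarrow> 'x) set"
  | Dists "((real \<Rightarrow> 'k) \<Rightarrow> 'x) set"

fun is_class :: "real set \<Rightarrow> ('k::{real_normed_field,euclidean_space} \<Rightarrow> 'x::banach \<Rightarrow> 'x) \<Rightarrow>
    ('k, 'x) gclass \<Rightarrow> bool" where
  "is_class J sc (Funs F) \<longleftrightarrow> F \<subseteq> L1loc J \<and> ae_closed J F"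
| "is_class J sc (Dists D) \<longleftrightarrow> open J \<and> D \<subseteq> distributions J sc"

fun fun_part :: "real set \<Rightarrow> ('k::{real_normed_field,euclidean_space} \<Rightarrow> 'x::banach \<Rightarrow> 'x) \<Rightarrow>
    ('k, 'x) gclass \<Rightarrow> (real \<Rightarrow> 'x) set" where
  "fun_part J sc (Funs F) = F \<inter> L1loc J"
| "fun_part J sc (Dists D) = {f \<in> L1loc J. regular_dist J sc f \<in> D}"

fun dist_part :: "real set \<Rightarrow> ('k::{real_normed_field,euclidean_space} \<Rightarrow> 'x::banach \<Rightarrow> 'x) \<Rightarrow>
    ('k, 'x) gclass \<Rightarrow> ((real \<Rightarrow> 'k) \<Rightarrow> 'x) set" where
  "dist_part J sc (Funs F) = regular_dist J sc ` (F \<inter> L1loc J)"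
| "dist_part J sc (Dists D) = D"

definition uniformly_closed ::
  "real set \<Rightarrow> ('k::{real_normed_field,euclidean_space} \<Rightarrow> 'x::banach \<Rightarrow> 'x) \<Rightarrow>
    ('k, 'x) gclass \<Rightarrow> bool" where
  "uniformly_closed J sc A \<longleftrightarrow> (\<forall>\<phi> \<phi>'.
     (\<forall>i::nat. \<phi> i \<in> fun_part J sc A) \<and> uniform_limit J \<phi> \<phi>' sequentially
       \<longrightarrow> \<phi>' \<in> fun_part J sc A)"

definition M_pow ::
  "real set \<Rightarrow> ('k::{real_normed_field,euclidean_space} \<Rightarrow> 'x::banach \<Rightarrow> 'x) \<Rightarrow>
    nat \<Rightarrow> ('k, 'x) gclass \<Rightarrow> (real \<Rightarrow> 'x) set" where
  "M_pow J sc j B =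
     ((\<lambda>F. {f \<in> L1loc J. \<forall>h>0. Mean h f \<in> F}) ^^ j) (fun_part J sc B)"

definition Mt_pow ::
  "real set \<Rightarrow> ('k::{real_normed_field,euclidean_space} \<Rightarrow> 'x::banach \<Rightarrow> 'x) \<Rightarrow>
    nat \<Rightarrow> ('k, 'x) gclass \<Rightarrow> ((real \<Rightarrow> 'k) \<Rightarrow> 'x) set" where
  "Mt_pow J sc j B =
     ((\<lambda>D. {T \<in> distributions J sc. \<forall>h>0. Mean_dist J h T \<in> D}) ^^ j) (dist_part J sc B)"

definition dist_conv_class ::
  "('k::{real_normed_field,euclidean_space} \<Rightarrow> 'x::banach \<Rightarrow> 'x) \<Rightarrow>
    ('k, 'x) gclass \<Rightarrow> ((real \<Rightarrow> 'k) \<Rightarrow> 'x) set" where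
  "dist_conv_class sc A =
     {T \<in> distributions UNIV sc. \<forall>\<phi>\<in>test_functions UNIV. conv T \<phi> \<in> fun_part UNIV sc A}"

end

theory Submission
  imports Defs "HOL-Computational_Algebra.Polynomial"
begin

text \<open>
  Everything rests on two properties of the means \<open>M\<^sub>h\<close>.

  \<^item> If \<open>g\<close> is uniformly continuous, then so is \<open>M\<^sub>h g\<close>, and \<open>M\<^sub>h g \<rightarrow> g\<close> uniformly as \<open>h \<rightarrow> 0\<close>.
    Hence, if \<open>g \<in> C\<^sub>u\<close> belongs to \<open>\<M>\<^sup>n A\<close>, induction on \<open>n\<close> puts every \<open>M\<^sub>h g\<close> into \<open>A\<close>, and
    \<open>g \<in> A\<close> because \<open>A\<close> is uniformly closed (\<open>M_pow_Int_Cu_subset\<close>).  Since \<open>f \<in> \<M>\<^sup>k B\<close> only says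
    that all \<open>k\<close>-fold means of \<open>f\<close> lie in \<open>B\<close>, the inclusion for general \<open>k\<close> follows from the case
    \<open>k = 0\<close>.

  \<^item> The mean of a distribution is defined by transposition, and Fubini's theorem shows that it extends
    the mean of functions: the mean of the distribution of \<open>f\<close> is the distribution of \<open>M\<^sub>h f\<close>
    (\<open>Mean_dist_regular_dist\<close>).  A locally integrable function is determined almost everywhere by its
    distribution if \<open>J\<close> is open (\<open>regular_dist_eq_imp_AE_eq\<close>).  Therefore a locally integrable function belongs to
    \<open>\<M>\<^sup>j A\<close> iff its distribution belongs to the corresponding class of distributions, for every \<open>j\<close>
    (\<open>M_pow_iff_Mt_pow\<close>).

  For the statement about convolutions, \<open>(M\<^sub>h T) * \<phi> = T * M\<^sub>h \<phi>\<close> and \<open>M\<^sub>h \<phi>\<close> is again a test function, so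
  the hypothesis \<open>T * \<phi> \<in> A\<close> passes from \<open>T\<close> to its means.  This reduces the claim to \<open>k = 0\<close>, where
  \<open>T\<close> is the distribution of a uniformly continuous \<open>g\<close> and the convolutions of \<open>T\<close> with mollifiers converge
  uniformly to \<open>g\<close> (\<open>conv_mollifier_uniform_limit\<close>).

  The space \<open>X\<close> may be nonseparable, so the Bochner integral is developed first, for complete measures.
  Identities of integrals are proved for multiples of indicator functions, where they reduce to scalar
  integrals, and extended by density in mean (\<open>bochner_integrable_induct\<close>).
\<close>

section \<open>The Bochner integral without separability\<close>

abbreviation "simple_integrable \<equiv> Bochner_Integration.simple_bochner_integrable"
abbreviation "simple_bint \<equiv> Bochner_Integration.simple_bochner_integral"

abbreviation bochner_integrable :: "'a measure \<Rightarrow> ('a \<Rightarrow> 'x::real_normed_vector) \<Rightarrow> bool" where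
  "bochner_integrable M f \<equiv> \<exists>I. has_bochner M f I"

text \<open>
  The preimages of a Borel set under \<open>f\<close> and \<open>g\<close> differ by a subset of a null set, and such subsets are
  measurable by completeness.  The target may be nonseparable; there, sums of measurable functions can fail to
  be measurable, and measurability is obtained from approximation by simple functions instead.
\<close>

lemma (in complete_measure) borel_measurable_cong_AE:
  assumes f: "f \<in> borel_measurable M" and ae: "AE x in M. f x = g x"
  shows "g \<in> borel_measurable M"
proof (rule measurableI)
  fix A :: "'b set" assume A: "A \<in> sets borel"
  show "g -` A \<inter> space M \<in> sets M"
  proof (rule in_sets_AE)
    show "AE x in M. x \<in> f -` A \<inter> space M \<longleftrightarrow> x \<in> g -` A \<inter> space M"
      using ae by eventually_elim auto
    show "f -` A \<inter> space M \<in> sets M"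
      using f A by (rule measurable_sets)
  qed simp
qed simp

lemma (in complete_measure) borel_measurable_AE_LIMSEQ:
  fixes f :: "nat \<Rightarrow> 'a \<Rightarrow> 'b :: metric_space"
  assumes f: "\<And>i. f i \<in> borel_measurable M"
    and lim: "AE x in M. (\<lambda>i. f i x) \<longlonglongrightarrow> g x"
  shows "g \<in> borel_measurable M"
proof -
  obtain N where N: "N \<in> null_sets M" "{x\<in>space M. \<not> (\<lambda>i. f i x) \<longlonglongrightarrow> g x} \<subseteq> N"
    using lim by (auto simp: eventually_ae_filter)
  define a where "a = (undefined :: 'b)"
  have [measurable]: "N \<in> sets M" using N by auto
  note f[measurable]
  have "(\<lambda>x. if x \<in> N then a else g x) \<in> borel_measurable M"
  proof (rule borel_measurable_LIMSEQ_metric)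
    show "(\<lambda>x. if x \<in> N then a else f i x) \<in> borel_measurable M" for i
      by measurable
    show "(\<lambda>i. if x \<in> N then a else f i x) \<longlonglongrightarrow> (if x \<in> N then a else g x)" if "x \<in> space M" for x
      using N(2) that by auto
  qed
  moreover have "AE x in M. (if x \<in> N then a else g x) = g x"
    using AE_not_in[OF N(1)] by eventually_elim auto
  ultimately show ?thesis by (rule borel_measurable_cong_AE)
qed

lemma simple_bochner_integrable_imp_measurable:
  "simple_integrable M s \<Longrightarrow> s \<in> borel_measurable M"
  by (auto intro: borel_measurable_simple_function elim: Bochner_Integration.simple_bochner_integrable.cases)

lemma ennreal_norm_diff_triangle:
  fixes a b c :: "'x::real_normed_vector"
  shows "ennreal (norm (a - c)) \<le> ennreal (norm (a - b)) + ennreal (norm (b - c))"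
  using norm_triangle_ineq[of "a - b" "b - c"] by (simp flip: ennreal_plus)

text \<open>
  The difference of a measurable function and a simple one is harmless even in a nonseparable space: there
  is one measurable piece for each of the finitely many values.
\<close>

lemma borel_measurable_norm_diff_simple:
  fixes f :: "'a \<Rightarrow> 'x::real_normed_vector"
  assumes f: "f \<in> borel_measurable M" and s: "simple_function M s"
  shows "(\<lambda>x. norm (f x - s x)) \<in> borel_measurable M"
proof -
  have sm: "s \<in> measurable M (count_space (s ` space M))"
    using measurable_sets[OF measurable_simple_function[OF s]] by (intro measurableI) auto
  have "(\<lambda>x. (\<lambda>c x. norm (f x - c)) (s x) x) \<in> borel_measurable M"
  proof (rule measurable_compose_countable'[where I = "s ` space M" and f = "\<lambda>c x. norm (f x - c)" and g = s])
    show "(\<lambda>x. norm (f x - c)) \<in> borel_measurable M" for c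
      by (rule measurable_compose[OF f]) (intro borel_measurable_continuous_onI continuous_intros)
    show "countable (s ` space M)" using s by (auto simp: simple_function_def intro: countable_finite)
  qed (rule sm)
  then show ?thesis by simp
qed

lemma simple_bint_dist_le:
  fixes s t :: "'a \<Rightarrow> 'x::real_normed_vector"
  assumes s: "simple_integrable M s"
    and t: "simple_integrable M t"
  shows "ennreal (norm (simple_bint M s
      - simple_bint M t)) \<le> (\<integral>\<^sup>+x. norm (s x - t x) \<partial>M)"
proof -
  have st: "simple_integrable M (\<lambda>x. s x - t x)"
    using simple_bochner_integrable_compose2[of "(-)", OF _ s t] by simp
  have "norm (simple_bint M s - simple_bint M t)
      = norm (simple_bint M (\<lambda>x. s x - t x))"
    using s t by (subst simple_bochner_integral_diff) auto
  also have "\<dots> \<le> simple_bint M (\<lambda>x. norm (s x - t x))"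
    by (rule simple_bochner_integral_norm_bound[OF st])
  finally have "ennreal (norm (simple_bint M s - simple_bint M t))
      \<le> simple_bint M (\<lambda>x. norm (s x - t x))"
    by (rule ennreal_leI)
  also have "\<dots> = (\<integral>\<^sup>+x. norm (s x - t x) \<partial>M)"
    using simple_bochner_integrable_compose2[of "\<lambda>x y. norm (x - y)", OF _ s t]
    by (intro simple_bochner_integral_eq_nn_integral) auto
  finally show ?thesis .
qed

lemma has_bochner_simple:
  "simple_integrable M s
    \<Longrightarrow> has_bochner M s (simple_bint M s)"
  unfolding has_bochner_def
  by (auto intro: simple_bochner_integrable_imp_measurable intro!: exI[of _ "\<lambda>_. s"])

lemma has_bochner_approx_simple:
  fixes f :: "'a \<Rightarrow> 'x::real_normed_vector"
  assumes "has_bochner M f I" and e: "0 < (e::real)"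
  obtains s where "simple_integrable M s"
    "(\<lambda>x. ennreal (norm (f x - s x))) \<in> borel_measurable M"
    "(\<integral>\<^sup>+x. norm (f x - s x) \<partial>M) \<le> ennreal e"
    "norm (simple_bint M s - I) \<le> e"
proof -
  obtain s where f: "f \<in> borel_measurable M"
    and s: "\<And>i. simple_integrable M (s i)"
    and 1: "(\<lambda>i. \<integral>\<^sup>+x. norm (f x - s i x) \<partial>M) \<longlonglongrightarrow> 0"
    and 2: "(\<lambda>i. simple_bint M (s i)) \<longlonglongrightarrow> I"
    using assms unfolding has_bochner_def by auto
  have "\<forall>\<^sub>F i in sequentially. (\<integral>\<^sup>+x. norm (f x - s i x) \<partial>M) < ennreal e"
    using order_tendstoD(2)[OF 1] e by auto
  moreover have "\<forall>\<^sub>F i in sequentially. dist (simple_bint M (s i)) I < e"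
    using tendstoD[OF 2 e] .
  ultimately have "\<forall>\<^sub>F i in sequentially. (\<integral>\<^sup>+x. norm (f x - s i x) \<partial>M) < ennreal e
      \<and> dist (simple_bint M (s i)) I < e"
    by (rule eventually_conj)
  then obtain i where i: "(\<integral>\<^sup>+x. norm (f x - s i x) \<partial>M) < ennreal e"
      "dist (simple_bint M (s i)) I < e"
    unfolding eventually_sequentially by auto
  show thesis
  proof (rule that[OF s])
    show "(\<lambda>x. ennreal (norm (f x - s i x))) \<in> borel_measurable M"
      using borel_measurable_norm_diff_simple[OF f, of "s i"] s[of i]
      by (auto elim: Bochner_Integration.simple_bochner_integrable.cases)
  qed (use i in \<open>auto simp: dist_norm\<close>)
qed

text \<open>
  Measurability of \<open>f\<close> is a consequence: if the errors of the approximations are dominated by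
  functions with summable integrals, the approximations converge almost everywhere.  The
  majorants \<open>w\<close> are there because the norm of \<open>f - s\<close> is not yet known to be measurable, and
  the nonnegative integral of a nonmeasurable function is only a lower integral.
\<close>

lemma (in complete_measure) has_bochnerI_simple:
  fixes f :: "'a \<Rightarrow> 'x::real_normed_vector"
  assumes approx: "\<And>e. 0 < (e::real) \<Longrightarrow> \<exists>s w. simple_integrable M s
      \<and> w \<in> borel_measurable M \<and> (AE x in M. ennreal (norm (f x - s x)) \<le> w x)
      \<and> (\<integral>\<^sup>+x. w x \<partial>M) \<le> ennreal e
      \<and> norm (simple_bint M s - I) \<le> e"
  shows "has_bochner M f I"
proof -
  have "\<forall>i::nat. \<exists>s w. simple_integrable M s
      \<and> w \<in> borel_measurable M \<and> (AE x in M. ennreal (norm (f x - s x)) \<le> w x)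
      \<and> (\<integral>\<^sup>+x. w x \<partial>M) \<le> ennreal ((1/2)^i)
      \<and> norm (simple_bint M s - I) \<le> (1/2)^i"
    by (intro allI approx) simp
  then obtain s w where s: "\<And>i. simple_integrable M (s i)"
      and w[measurable]: "\<And>i. w i \<in> borel_measurable M"
      and fs: "\<And>i. AE x in M. ennreal (norm (f x - s i x)) \<le> w i x"
      and wint: "\<And>i. (\<integral>\<^sup>+x. w i x \<partial>M) \<le> ennreal ((1/2)^i)"
      and I: "\<And>i. norm (simple_bint M (s i) - I) \<le> (1/2)^i"
    unfolding choice_iff by blast
  have "(\<integral>\<^sup>+x. (\<Sum>i. w i x) \<partial>M) = (\<Sum>i. \<integral>\<^sup>+x. w i x \<partial>M)"
    by (intro nn_integral_suminf) auto
  also have "\<dots> \<le> (\<Sum>i. ennreal ((1/2)^i))"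
    by (intro suminf_le wint) auto
  also have "\<dots> = ennreal (\<Sum>i. (1/2)^i)"
    by (intro suminf_ennreal2) (auto intro: summable_geometric)
  also have "\<dots> < \<infinity>" by simp
  finally have "(\<integral>\<^sup>+x. (\<Sum>i. w i x) \<partial>M) \<noteq> \<infinity>" by simp
  then have fin: "AE x in M. (\<Sum>i. w i x) \<noteq> \<infinity>"
    by (intro nn_integral_noteq_infinite) auto
  \<comment> \<open>the sum of all majorants is finite almost everywhere, so they tend to \<open>0\<close> there\<close>
  have "AE x in M. \<forall>i. ennreal (norm (f x - s i x)) \<le> w i x"
    using fs by (simp add: AE_all_countable)
  with fin have "AE x in M. (\<lambda>i. s i x) \<longlonglongrightarrow> f x"
  proof eventually_elim
    case (elim x)
    have wfin: "w i x \<noteq> top" for i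
      using elim(1) ennreal_suminf_lessD[of "\<lambda>i. w i x" top i] by (auto simp: less_top)
    have "summable (\<lambda>i. enn2real (w i x))"
      by (rule summable_suminf_not_top) (use elim(1) wfin in \<open>auto simp: less_top\<close>)
    then have "(\<lambda>i. ennreal (enn2real (w i x))) \<longlonglongrightarrow> ennreal 0"
      by (intro tendsto_ennrealI summable_LIMSEQ_zero)
    then have "(\<lambda>i. w i x) \<longlonglongrightarrow> 0"
      using wfin by (simp add: less_top)
    then have "(\<lambda>i. ennreal (norm (f x - s i x))) \<longlonglongrightarrow> 0"
      by (rule tendsto_sandwich[OF _ _ tendsto_const, rotated -1])
         (use elim(2) in auto)
    then have "(\<lambda>i. norm (s i x - f x)) \<longlonglongrightarrow> 0"
      by (simp add: norm_minus_commute flip: ennreal_0)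
    then show ?case
      by (simp only: tendsto_norm_zero_iff LIM_zero_iff)
  qed
  then have "f \<in> borel_measurable M"
    by (rule borel_measurable_AE_LIMSEQ[rotated]) (rule simple_bochner_integrable_imp_measurable[OF s])
  moreover have "(\<lambda>i. \<integral>\<^sup>+x. norm (f x - s i x) \<partial>M) \<longlonglongrightarrow> 0"
  proof (rule tendsto_sandwich[OF _ _ tendsto_const])
    have "(\<lambda>i. ennreal ((1/2)^i)) \<longlonglongrightarrow> ennreal 0"
      by (intro tendsto_ennrealI LIMSEQ_realpow_zero) auto
    then show "(\<lambda>i. ennreal ((1/2)^i)) \<longlonglongrightarrow> 0" by simp
    have "(\<integral>\<^sup>+x. norm (f x - s i x) \<partial>M) \<le> ennreal ((1/2)^i)" for i
      using nn_integral_mono_AE[OF fs] wint by (rule order_trans)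
    then show "\<forall>\<^sub>F i in sequentially. (\<integral>\<^sup>+x. norm (f x - s i x) \<partial>M) \<le> ennreal ((1/2)^i)"
      by simp
  qed auto
  moreover have "(\<lambda>i. simple_bint M (s i)) \<longlonglongrightarrow> I"
  proof (rule LIM_zero_cancel, rule tendsto_norm_zero_cancel, rule tendsto_sandwich[OF _ _ tendsto_const])
    show "(\<lambda>i. (1/2)^i::real) \<longlonglongrightarrow> 0" by (intro LIMSEQ_realpow_zero) auto
  qed (use I in auto)
  ultimately show ?thesis
    unfolding has_bochner_def using s by blast
qed

lemma has_bochner_norm_finite:
  fixes f :: "'a \<Rightarrow> 'x::real_normed_vector"
  assumes "has_bochner M f I"
  shows "integrable M (\<lambda>x. norm (f x))"
proof (rule integrableI_bounded)
  have f: "f \<in> borel_measurable M" using assms by (auto simp: has_bochner_def)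
  show m: "(\<lambda>x. norm (f x)) \<in> borel_measurable M"
    by (rule measurable_compose[OF f]) measurable
  obtain s where s: "simple_integrable M s"
    and [measurable]: "(\<lambda>x. ennreal (norm (f x - s x))) \<in> borel_measurable M"
    and fs: "(\<integral>\<^sup>+x. norm (f x - s x) \<partial>M) \<le> ennreal 1"
    using has_bochner_approx_simple[OF assms, of 1] by auto
  have [measurable]: "s \<in> borel_measurable M" by (rule simple_bochner_integrable_imp_measurable[OF s])
  have sn: "simple_integrable M (\<lambda>x. norm (s x))"
    using simple_bochner_integrable_compose2[of "\<lambda>x y. norm x", OF _ s s] by simp
  have "(\<integral>\<^sup>+x. norm (norm (f x)) \<partial>M) \<le> (\<integral>\<^sup>+x. ennreal (norm (f x - s x)) + ennreal (norm (s x)) \<partial>M)"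
    by (intro nn_integral_mono) (use ennreal_norm_diff_triangle[of "f x" 0 "s x" for x] in simp)
  also have "\<dots> = (\<integral>\<^sup>+x. norm (f x - s x) \<partial>M) + (\<integral>\<^sup>+x. norm (s x) \<partial>M)"
    by (rule nn_integral_add) measurable
  also have "(\<integral>\<^sup>+x. norm (s x) \<partial>M) = simple_bint M (\<lambda>x. norm (s x))"
    by (rule simple_bochner_integral_eq_nn_integral[symmetric, OF sn]) simp
  also have "(\<integral>\<^sup>+x. norm (f x - s x) \<partial>M) + \<dots> < \<infinity>"
    using fs by (auto simp: ennreal_add_eq_top less_top[symmetric] top_unique)
  finally show "(\<integral>\<^sup>+x. norm (norm (f x)) \<partial>M) < \<infinity>" .
qed

lemma has_bochner_norm_le:
  fixes f :: "'a \<Rightarrow> 'x::real_normed_vector"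
  assumes f: "has_bochner M f I" and w: "AE x in M. ennreal (norm (f x)) \<le> w x"
  shows "ennreal (norm I) \<le> (\<integral>\<^sup>+x. w x \<partial>M)"
proof (rule ennreal_le_epsilon)
  fix e :: real assume e: "0 < e"
  have [measurable]: "(\<lambda>x. norm (f x)) \<in> borel_measurable M"
    using has_bochner_norm_finite[OF f] by auto
  obtain s where s: "simple_integrable M s"
    and [measurable]: "(\<lambda>x. ennreal (norm (f x - s x))) \<in> borel_measurable M"
    and fs: "(\<integral>\<^sup>+x. norm (f x - s x) \<partial>M) \<le> ennreal (e/2)"
    and I: "norm (simple_bint M s - I) \<le> e/2"
    using has_bochner_approx_simple[OF f, of "e/2"] e by auto
  have z: "simple_integrable M (\<lambda>x. 0)"
    by (auto intro: Bochner_Integration.simple_bochner_integrable.intros)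
  have z0: "simple_bint M (\<lambda>x. 0 :: 'x) = 0"
    unfolding simple_bochner_integral_def by (rule sum.neutral) auto
  have "ennreal (norm (simple_bint M s)) \<le> (\<integral>\<^sup>+x. norm (s x) \<partial>M)"
    using simple_bint_dist_le[OF s z] z0 by simp
  also have "\<dots> \<le> (\<integral>\<^sup>+x. ennreal (norm (f x - s x)) + ennreal (norm (f x)) \<partial>M)"
    by (intro nn_integral_mono) (use ennreal_norm_diff_triangle[of "s x" 0 "f x" for x] in \<open>simp add: norm_minus_commute\<close>)
  also have "\<dots> = (\<integral>\<^sup>+x. norm (f x - s x) \<partial>M) + (\<integral>\<^sup>+x. norm (f x) \<partial>M)"
    by (rule nn_integral_add) measurable
  also have "\<dots> \<le> ennreal (e/2) + (\<integral>\<^sup>+x. w x \<partial>M)"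
    by (intro add_mono fs nn_integral_mono_AE w)
  finally have *: "ennreal (norm (simple_bint M s)) \<le> ennreal (e/2) + (\<integral>\<^sup>+x. w x \<partial>M)" .
  have "norm I \<le> norm (simple_bint M s) + e/2"
    using I by (smt (verit) norm_minus_commute norm_triangle_sub)
  then have "ennreal (norm I) \<le> ennreal (norm (simple_bint M s)) + ennreal (e/2)"
    using e by (simp flip: ennreal_plus)
  also have "\<dots> \<le> (ennreal (e/2) + (\<integral>\<^sup>+x. w x \<partial>M)) + ennreal (e/2)"
    by (intro add_right_mono *)
  also have "\<dots> = (\<integral>\<^sup>+x. w x \<partial>M) + (ennreal (e/2) + ennreal (e/2))"
    by (simp add: ac_simps)
  also have "ennreal (e/2) + ennreal (e/2) = ennreal e"
    using e by (simp flip: ennreal_plus)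
  finally show "ennreal (norm I) \<le> (\<integral>\<^sup>+x. w x \<partial>M) + ennreal e" .
qed

lemma (in complete_measure) has_bochner_add:
  fixes f g :: "'a \<Rightarrow> 'x::real_normed_vector"
  assumes f: "has_bochner M f I" and g: "has_bochner M g I'"
  shows "has_bochner M (\<lambda>x. f x + g x) (I + I')"
proof (rule has_bochnerI_simple)
  fix e :: real assume e: "0 < e"
  obtain s where s: "simple_integrable M s"
    and [measurable]: "(\<lambda>x. ennreal (norm (f x - s x))) \<in> borel_measurable M"
    and fs: "(\<integral>\<^sup>+x. norm (f x - s x) \<partial>M) \<le> ennreal (e/2)"
    and I: "norm (simple_bint M s - I) \<le> e/2"
    using has_bochner_approx_simple[OF f, of "e/2"] e by auto
  obtain t where t: "simple_integrable M t"
    and [measurable]: "(\<lambda>x. ennreal (norm (g x - t x))) \<in> borel_measurable M"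
    and gt: "(\<integral>\<^sup>+x. norm (g x - t x) \<partial>M) \<le> ennreal (e/2)"
    and I': "norm (simple_bint M t - I') \<le> e/2"
    using has_bochner_approx_simple[OF g, of "e/2"] e by auto
  let ?w = "\<lambda>x. ennreal (norm (f x - s x)) + ennreal (norm (g x - t x))"
  have "simple_integrable M (\<lambda>x. s x + t x)"
    using simple_bochner_integrable_compose2[of "(+)", OF _ s t] by simp
  moreover have "AE x in M. ennreal (norm (f x + g x - (s x + t x))) \<le> ?w x"
    by (simp flip: ennreal_plus, simp add: norm_diff_triangle_ineq)
  moreover have "(\<integral>\<^sup>+x. ?w x \<partial>M) \<le> ennreal e"
  proof -
    have "(\<integral>\<^sup>+x. ?w x \<partial>M) \<le> ennreal (e/2) + ennreal (e/2)"
      by (subst nn_integral_add) (measurable, intro add_mono fs gt)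
    then show ?thesis using e by (simp flip: ennreal_plus)
  qed
  moreover have "norm (simple_bint M (\<lambda>x. s x + t x) - (I + I')) \<le> e"
    using norm_diff_triangle_ineq[of "simple_bint M s" "simple_bint M t" I I'] I I'
    by (simp add: simple_bochner_integral_add[OF s t])
  moreover have "?w \<in> borel_measurable M" by measurable
  ultimately show "\<exists>s w. simple_integrable M s
      \<and> w \<in> borel_measurable M \<and> (AE x in M. ennreal (norm (f x + g x - s x)) \<le> w x)
      \<and> (\<integral>\<^sup>+x. w x \<partial>M) \<le> ennreal e
      \<and> norm (simple_bint M s - (I + I')) \<le> e"
    by (intro exI[of _ "\<lambda>x. s x + t x"] exI[of _ ?w]) auto
qed

lemma has_bochner_bounded_linear:
  fixes f :: "'a \<Rightarrow> 'x::real_normed_vector" and L :: "'x \<Rightarrow> 'y::real_normed_vector"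
  assumes L: "bounded_linear L" and f: "has_bochner M f I"
  shows "has_bochner M (\<lambda>x. L (f x)) (L I)"
proof -
  interpret L: bounded_linear L by fact
  obtain s where fm: "f \<in> borel_measurable M"
    and s: "\<And>i. simple_integrable M (s i)"
    and 1: "(\<lambda>i. \<integral>\<^sup>+x. norm (f x - s i x) \<partial>M) \<longlonglongrightarrow> 0"
    and 2: "(\<lambda>i. simple_bint M (s i)) \<longlonglongrightarrow> I"
    using f unfolding has_bochner_def by auto
  obtain K where K: "0 < K" "\<And>x. norm (L x) \<le> norm x * K"
    using L.pos_bounded by auto
  have Lcont: "L \<in> borel_measurable borel"
    by (intro borel_measurable_continuous_onI L.continuous_on continuous_on_id)
  have "(\<lambda>x. L (f x)) \<in> borel_measurable M"
    by (rule measurable_compose[OF fm Lcont])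
  moreover have "simple_integrable M (\<lambda>x. L (s i x))" for i
    using simple_bochner_integrable_compose2[of "\<lambda>x y. L x", OF _ s s] by (simp add: L.zero)
  moreover have "(\<lambda>i. \<integral>\<^sup>+x. norm (L (f x) - L (s i x)) \<partial>M) \<longlonglongrightarrow> 0"
  proof (rule tendsto_sandwich[OF _ _ tendsto_const])
    have "(\<integral>\<^sup>+x. norm (L (f x) - L (s i x)) \<partial>M) \<le> ennreal K * (\<integral>\<^sup>+x. norm (f x - s i x) \<partial>M)" for i
    proof -
      have [measurable]: "(\<lambda>x. norm (f x - s i x)) \<in> borel_measurable M"
        using borel_measurable_norm_diff_simple[OF fm, of "s i"] s[of i]
        by (auto elim: Bochner_Integration.simple_bochner_integrable.cases)
      have "(\<integral>\<^sup>+x. norm (L (f x) - L (s i x)) \<partial>M) \<le> (\<integral>\<^sup>+x. ennreal K * norm (f x - s i x) \<partial>M)"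
        using K by (intro nn_integral_mono)
          (simp add: L.diff[symmetric] mult.commute flip: ennreal_mult)
      then show ?thesis by (simp add: nn_integral_cmult)
    qed
    then show "\<forall>\<^sub>F i in sequentially. (\<integral>\<^sup>+x. norm (L (f x) - L (s i x)) \<partial>M)
        \<le> ennreal K * (\<integral>\<^sup>+x. norm (f x - s i x) \<partial>M)" by simp
    show "(\<lambda>i. ennreal K * (\<integral>\<^sup>+x. norm (f x - s i x) \<partial>M)) \<longlonglongrightarrow> 0"
      using ennreal_tendsto_cmult[OF _ 1, of "ennreal K"] by simp
  qed auto
  moreover have "(\<lambda>i. simple_bint M (\<lambda>x. L (s i x))) \<longlonglongrightarrow> L I"
    using L.tendsto[OF 2]
    by (simp add: simple_bochner_integral_linear[OF L.linear_axioms s])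
  ultimately show ?thesis unfolding has_bochner_def by (intro conjI exI[of _ "\<lambda>i x. L (s i x)"]) auto
qed

text \<open>
  The link to the separable theory: a function whose values are images of vectors of a second countable
  space under one bounded linear map.  The main instance is a scalar function times a fixed vector.
\<close>

lemma has_bochner_linear_image:
  fixes g :: "'a \<Rightarrow> 'b::{banach,second_countable_topology}"
  assumes "bounded_linear L" and "integrable M g"
  shows "has_bochner M (\<lambda>x. L (g x)) (L (\<integral>x. g x \<partial>M))"
  by (rule has_bochner_bounded_linear[OF assms(1)])
    (simp add: has_bochner_eq_library has_bochner_integral_integrable[OF assms(2)])

lemma bochner_integral_eq_library:
  fixes f :: "'a \<Rightarrow> 'b::{banach,second_countable_topology}"
  shows "bochner_integral M f = integral\<^sup>L M f"
proof (cases "integrable M f")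
  case True
  then have "has_bochner_integral M f (integral\<^sup>L M f)" by (rule has_bochner_integral_integrable)
  then show ?thesis
    unfolding bochner_integral_def has_bochner_eq_library
    by (auto intro!: the_equality dest: has_bochner_integral_eq)
next
  case False
  then have "\<nexists>I. has_bochner_integral M f I" by (auto simp: integrable.simps)
  then show ?thesis using False
    by (simp add: bochner_integral_def has_bochner_eq_library not_integrable_integral_eq)
qed

lemma (in complete_measure) has_bochner_diff:
  fixes f g :: "'a \<Rightarrow> 'x::real_normed_vector"
  assumes f: "has_bochner M f I" and g: "has_bochner M g I'"
  shows "has_bochner M (\<lambda>x. f x - g x) (I - I')"
  using has_bochner_add[OF f has_bochner_bounded_linear[OF bounded_linear_minus[OF bounded_linear_ident] g]]
  by simp

lemma (in complete_measure) has_bochner_unique: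
  fixes f :: "'a \<Rightarrow> 'x::real_normed_vector"
  assumes "has_bochner M f I" "has_bochner M f I'"
  shows "I = I'"
proof -
  have "ennreal (norm (I - I')) \<le> (\<integral>\<^sup>+x. 0 \<partial>M)"
    using has_bochner_norm_le[OF has_bochner_diff[OF assms], of "\<lambda>_. 0"] by simp
  then show ?thesis by simp
qed

lemma (in complete_measure) bochner_integral_eq:
  "has_bochner M f I \<Longrightarrow> bochner_integral M f = I"
  unfolding bochner_integral_def by (auto intro: has_bochner_unique the_equality)

lemma (in complete_measure) has_bochner_bochner_integral:
  "bochner_integrable M f \<Longrightarrow> has_bochner M f (bochner_integral M f)"
  using bochner_integral_eq by auto

lemma (in complete_measure) has_bochner_cong_AE:
  fixes f g :: "'a \<Rightarrow> 'x::real_normed_vector"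
  assumes f: "has_bochner M f I" and ae: "AE x in M. f x = g x"
  shows "has_bochner M g I"
proof (rule has_bochnerI_simple)
  fix e :: real assume e: "0 < e"
  obtain s where s: "simple_integrable M s"
    "(\<lambda>x. ennreal (norm (f x - s x))) \<in> borel_measurable M"
    "(\<integral>\<^sup>+x. norm (f x - s x) \<partial>M) \<le> ennreal e"
    "norm (simple_bint M s - I) \<le> e"
    using has_bochner_approx_simple[OF f e] by auto
  moreover have "AE x in M. ennreal (norm (g x - s x)) \<le> ennreal (norm (f x - s x))"
    using ae by eventually_elim auto
  ultimately show "\<exists>s w. simple_integrable M s
      \<and> w \<in> borel_measurable M \<and> (AE x in M. ennreal (norm (g x - s x)) \<le> w x)
      \<and> (\<integral>\<^sup>+x. w x \<partial>M) \<le> ennreal e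
      \<and> norm (simple_bint M s - I) \<le> e"
    by (intro exI[of _ s] exI[of _ "\<lambda>x. ennreal (norm (f x - s x))"]) auto
qed

lemma (in complete_measure) bochner_integrable_cong_AE:
  fixes f g :: "'a \<Rightarrow> 'x::real_normed_vector"
  assumes "bochner_integrable M f" and "AE x in M. f x = g x"
  shows "bochner_integrable M g"
  using assms has_bochner_cong_AE by blast

lemma (in complete_measure) bochner_integral_cong_AE:
  fixes f g :: "'a \<Rightarrow> 'x::real_normed_vector"
  assumes "AE x in M. f x = g x"
  shows "bochner_integral M f = bochner_integral M g"
proof -
  have "has_bochner M f = has_bochner M g"
    by (intro ext iffI; erule has_bochner_cong_AE) (use assms in \<open>auto simp: eq_commute\<close>)
  then show ?thesis unfolding bochner_integral_def by presburger
qed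

text \<open>
  The integrable functions are closed under limits in mean.  Choosing simple functions with
  errors \<open>(1/2)\<^sup>i\<close>, their integrals form a Cauchy sequence, whose limit is the integral.
\<close>

lemma (in complete_measure) bochner_integrable_limit:
  fixes f :: "'a \<Rightarrow> 'x::banach"
  assumes approx: "\<And>e. 0 < (e::real) \<Longrightarrow> \<exists>g w. bochner_integrable M g
      \<and> w \<in> borel_measurable M \<and> (AE x in M. ennreal (norm (f x - g x)) \<le> w x)
      \<and> (\<integral>\<^sup>+x. w x \<partial>M) \<le> ennreal e"
  shows "bochner_integrable M f"
proof -
  have "\<exists>s w. simple_integrable M s
      \<and> w \<in> borel_measurable M \<and> (AE x in M. ennreal (norm (f x - s x)) \<le> w x)
      \<and> (\<integral>\<^sup>+x. w x \<partial>M) \<le> ennreal e" if e: "0 < e" for e :: real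
  proof -
    obtain g I w where g: "has_bochner M g I" and [measurable]: "w \<in> borel_measurable M"
      and fg: "AE x in M. ennreal (norm (f x - g x)) \<le> w x" and w: "(\<integral>\<^sup>+x. w x \<partial>M) \<le> ennreal (e/2)"
      using approx[of "e/2"] e by auto
    obtain s where s: "simple_integrable M s"
      and [measurable]: "(\<lambda>x. ennreal (norm (g x - s x))) \<in> borel_measurable M"
      and gs: "(\<integral>\<^sup>+x. norm (g x - s x) \<partial>M) \<le> ennreal (e/2)"
      using has_bochner_approx_simple[OF g, of "e/2"] e by auto
    have "AE x in M. ennreal (norm (f x - s x)) \<le> w x + ennreal (norm (g x - s x))"
      using fg
    proof eventually_elim
      case (elim x)
      have "ennreal (norm (f x - s x)) \<le> ennreal (norm (f x - g x)) + ennreal (norm (g x - s x))"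
        by (rule ennreal_norm_diff_triangle)
      then show ?case using elim by (meson add_right_mono order_trans)
    qed
    moreover have "(\<integral>\<^sup>+x. w x + ennreal (norm (g x - s x)) \<partial>M) \<le> ennreal e"
    proof -
      have "(\<integral>\<^sup>+x. w x + ennreal (norm (g x - s x)) \<partial>M) \<le> ennreal (e/2) + ennreal (e/2)"
        by (subst nn_integral_add) (measurable, intro add_mono w gs)
      then show ?thesis using e by (simp flip: ennreal_plus)
    qed
    ultimately show ?thesis using s
      by (intro exI[of _ s] exI[of _ "\<lambda>x. w x + ennreal (norm (g x - s x))"]) auto
  qed
  note simple = this
  have "\<forall>i::nat. \<exists>s w. simple_integrable M s
      \<and> w \<in> borel_measurable M \<and> (AE x in M. ennreal (norm (f x - s x)) \<le> w x)
      \<and> (\<integral>\<^sup>+x. w x \<partial>M) \<le> ennreal ((1/2)^i)"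
    by (intro allI simple) simp
  then obtain s w where s: "\<And>i. simple_integrable M (s i)"
      and w[measurable]: "\<And>i. w i \<in> borel_measurable M"
      and fs: "\<And>i. AE x in M. ennreal (norm (f x - s i x)) \<le> w i x"
      and wint: "\<And>i. (\<integral>\<^sup>+x. w i x \<partial>M) \<le> ennreal ((1/2)^i)"
    unfolding choice_iff by blast
  define K where "K i = simple_bint M (s i)" for i
  have dist: "dist (K i) (K j) \<le> (1/2)^i + (1/2)^j" for i j
  proof -
    have "ennreal (norm (K i - K j)) \<le> (\<integral>\<^sup>+x. norm (s i x - s j x) \<partial>M)"
      unfolding K_def by (rule simple_bint_dist_le[OF s s])
    also have "\<dots> \<le> (\<integral>\<^sup>+x. w i x + w j x \<partial>M)"
    proof (rule nn_integral_mono_AE)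
      show "AE x in M. ennreal (norm (s i x - s j x)) \<le> w i x + w j x"
        using fs[of i] fs[of j]
      proof eventually_elim
        case (elim x)
        have "ennreal (norm (s i x - s j x)) \<le> ennreal (norm (f x - s i x)) + ennreal (norm (f x - s j x))"
          using ennreal_norm_diff_triangle[of "s i x" "s j x" "f x"] by (simp add: norm_minus_commute)
        then show ?case using elim by (meson add_mono order_trans)
      qed
    qed
    also have "\<dots> \<le> ennreal ((1/2)^i) + ennreal ((1/2)^j)"
      by (subst nn_integral_add) (measurable, intro add_mono wint)
    also have "\<dots> = ennreal ((1/2)^i + (1/2)^j)"
      by (simp add: ennreal_plus)
    finally show ?thesis by (simp add: dist_norm del: ennreal_plus)
  qed
  have half: "(\<lambda>i. (1/2)^i::real) \<longlonglongrightarrow> 0" by (intro LIMSEQ_realpow_zero) auto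
  have "Cauchy K"
  proof (rule metric_CauchyI)
    fix e :: real assume "0 < e"
    then have "\<forall>\<^sub>F i in sequentially. (1/2)^i < e/2"
      using order_tendstoD(2)[OF half, of "e/2"] by simp
    then obtain N where N: "\<And>i. i \<ge> N \<Longrightarrow> (1/2)^i < e/2" by (auto simp: eventually_sequentially)
    have "dist (K m) (K n) < e" if "m \<ge> N" "n \<ge> N" for m n
      using dist[of m n] N[OF that(1)] N[OF that(2)] by linarith
    then show "\<exists>N. \<forall>m\<ge>N. \<forall>n\<ge>N. dist (K m) (K n) < e" by auto
  qed
  then obtain I where I: "K \<longlonglongrightarrow> I" by (auto simp: Cauchy_convergent_iff convergent_def)
  have KI: "dist (K i) I \<le> (1/2)^i" for i
  proof (rule tendsto_le[OF trivial_limit_sequentially])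
    show "(\<lambda>j. dist (K i) (K j)) \<longlonglongrightarrow> dist (K i) I" by (intro tendsto_intros I)
    show "(\<lambda>j. (1/2)^i + (1/2)^j :: real) \<longlonglongrightarrow> (1/2)^i" using tendsto_add[OF tendsto_const half] by simp
  qed (simp add: dist)
  have "has_bochner M f I"
  proof (rule has_bochnerI_simple)
    fix e :: real assume "0 < e"
    then have "\<forall>\<^sub>F i in sequentially. (1/2)^i < e"
      using order_tendstoD(2)[OF half] by simp
    then obtain i where i: "(1/2)^i < e" by (auto simp: eventually_sequentially)
    show "\<exists>s w. simple_integrable M s
      \<and> w \<in> borel_measurable M \<and> (AE x in M. ennreal (norm (f x - s x)) \<le> w x)
      \<and> (\<integral>\<^sup>+x. w x \<partial>M) \<le> ennreal e
      \<and> norm (simple_bint M s - I) \<le> e"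
      using s[of i] fs[of i] order_trans[OF wint[of i], of "ennreal e"] KI[of i] i
      by (intro exI[of _ "s i"] exI[of _ "w i"]) (auto simp: K_def dist_norm ennreal_leI)
  qed
  then show ?thesis by blast
qed

text \<open>
  Density of the simple functions as an induction principle.  A limit step needs only approximations of \<open>f\<close>
  in mean, so a property that is an identity between two functionals continuous in mean has to be
  verified only for one indicator function at a time.
\<close>

lemma (in complete_measure) bochner_integrable_induct [consumes 1, case_names indicator add lim]:
  fixes f :: "'a \<Rightarrow> 'x::real_normed_vector"
  assumes f: "bochner_integrable M f"
    and ind: "\<And>E c. E \<in> sets M \<Longrightarrow> emeasure M E < \<infinity> \<Longrightarrow> P (\<lambda>x. indicator E x *\<^sub>R c)"
    and add: "\<And>f g. bochner_integrable M f \<Longrightarrow> bochner_integrable M g \<Longrightarrow> P f \<Longrightarrow> P g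
        \<Longrightarrow> P (\<lambda>x. f x + g x)"
    and lim: "\<And>f. bochner_integrable M f \<Longrightarrow>
        (\<And>e. 0 < (e::real) \<Longrightarrow> \<exists>g. bochner_integrable M g \<and> P g \<and> (\<integral>\<^sup>+x. norm (f x - g x) \<partial>M) \<le> ennreal e)
        \<Longrightarrow> P f"
  shows "P f"
proof (rule lim[OF f])
  fix e :: real assume e: "0 < e"
  obtain s where s: "simple_integrable M s"
    and fs: "(\<integral>\<^sup>+x. norm (f x - s x) \<partial>M) \<le> ennreal e"
    using f has_bochner_approx_simple[OF _ e, of M f] by blast
  have sf: "simple_function M s" and sfin: "emeasure M {x\<in>space M. s x \<noteq> 0} \<noteq> \<infinity>"
    using s by (auto elim: Bochner_Integration.simple_bochner_integrable.cases)
  define E where "E y = {x\<in>space M. s x = y}" for y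
  have E: "E y \<in> sets M" for y
    using simple_functionD(2)[OF sf, of "{y}"] unfolding E_def by (simp add: vimage_def Int_def conj_commute)
  have Efin: "emeasure M (E y) < \<infinity>" if "y \<noteq> 0" for y
  proof -
    have "emeasure M (E y) \<le> emeasure M {x\<in>space M. s x \<noteq> 0}"
      using that measurable_sets[OF measurable_simple_function[OF sf], of "- {0}"]
      by (intro emeasure_mono) (auto simp: E_def vimage_def Int_def conj_commute)
    then show ?thesis using sfin by (simp add: less_top[symmetric] top_unique) (metis top.extremum_unique)
  qed
  have base: "bochner_integrable M (\<lambda>x. indicator (E y) x *\<^sub>R y)" if "y \<noteq> 0" for y
    using has_bochner_linear_image[OF bounded_linear_scaleR_left, of M "indicator (E y)" y]
      E[of y] Efin[OF that] by auto
  define g where "g F x = (\<Sum>y\<in>F. indicator (E y) x *\<^sub>R y)" for F x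
  have "bochner_integrable M (g F) \<and> P (g F)" if "finite F" "0 \<notin> F" for F
    using that
  proof (induction F rule: finite_induct)
    case empty
    have "bochner_integrable M (\<lambda>x. indicator {} x *\<^sub>R 0 :: 'x)"
      using has_bochner_linear_image[OF bounded_linear_scaleR_left, of M "\<lambda>_. 0::real" "0::'x"] by auto
    then show ?case using ind[of "{}" 0] by (simp add: g_def[abs_def])
  next
    case (insert y F)
    then have *: "g (insert y F) = (\<lambda>x. indicator (E y) x *\<^sub>R y + g F x)"
      unfolding g_def by (intro ext sum.insert)
    from insert have y: "y \<noteq> 0" and F: "bochner_integrable M (g F)" "P (g F)" by auto
    have "bochner_integrable M (\<lambda>x. indicator (E y) x *\<^sub>R y + g F x)"
      using base[OF y] F has_bochner_add by blast
    moreover have "P (\<lambda>x. indicator (E y) x *\<^sub>R y + g F x)"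
      by (rule add[OF base[OF y] F(1) ind[OF E Efin[OF y]] F(2)])
    ultimately show ?case unfolding * by simp
  qed
  moreover have "finite (s ` space M - {0})" using sf by (auto simp: simple_function_def)
  ultimately have g: "bochner_integrable M (g (s ` space M - {0}))" "P (g (s ` space M - {0}))"
    by auto
  have "g (s ` space M - {0}) x = s x" if x: "x \<in> space M" for x
  proof -
    have "g (s ` space M - {0}) x = (\<Sum>y\<in>s ` space M - {0}. if y = s x then s x else 0)"
      unfolding g_def using x by (intro sum.cong) (auto simp: E_def)
    then show ?thesis using x sf by (auto simp: simple_function_def)
  qed
  then have "(\<integral>\<^sup>+x. norm (f x - g (s ` space M - {0}) x) \<partial>M) = (\<integral>\<^sup>+x. norm (f x - s x) \<partial>M)"
    by (intro nn_integral_cong) auto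
  with g fs show "\<exists>g. bochner_integrable M g \<and> P g \<and> (\<integral>\<^sup>+x. norm (f x - g x) \<partial>M) \<le> ennreal e"
    by (intro exI[of _ "g (s ` space M - {0})"]) auto
qed

text \<open>
  From right to left, simple functions approximating the extension by zero need not vanish outside \<open>S\<close>.
  Cutting them off changes their integrals by at most the approximation error, because the extension does
  vanish there.
\<close>

lemma has_bochner_restrict_space:
  fixes f :: "'a \<Rightarrow> 'x::real_normed_vector"
  assumes S[measurable]: "S \<inter> space M \<in> sets M"
  shows "has_bochner (restrict_space M S) f I \<longleftrightarrow> has_bochner M (\<lambda>x. indicator S x *\<^sub>R f x) I"
proof
  assume "has_bochner (restrict_space M S) f I"
  then obtain s where f: "f \<in> borel_measurable (restrict_space M S)"
    and s: "\<And>i. simple_integrable (restrict_space M S) (s i)"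
    and 1: "(\<lambda>i. \<integral>\<^sup>+x. norm (f x - s i x) \<partial>restrict_space M S) \<longlonglongrightarrow> 0"
    and 2: "(\<lambda>i. simple_bint (restrict_space M S) (s i)) \<longlonglongrightarrow> I"
    unfolding has_bochner_def by auto
  have "(\<integral>\<^sup>+x. norm (f x - s i x) \<partial>restrict_space M S)
      = (\<integral>\<^sup>+x. norm (indicator S x *\<^sub>R f x - indicator S x *\<^sub>R s i x) \<partial>M)" for i
    by (subst nn_integral_restrict_space[OF S]) (auto intro!: nn_integral_cong split: split_indicator)
  with 1 2 f s show "has_bochner M (\<lambda>x. indicator S x *\<^sub>R f x) I"
    unfolding has_bochner_def
    by (auto simp: borel_measurable_restrict_space_iff[OF S] simple_bochner_integrable_restrict_space[OF S]
      simple_bochner_integral_restrict_space[OF S s] intro!: exI[of _ "\<lambda>i x. indicator S x *\<^sub>R s i x"])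
next
  assume "has_bochner M (\<lambda>x. indicator S x *\<^sub>R f x) I"
  then obtain s where f: "(\<lambda>x. indicator S x *\<^sub>R f x) \<in> borel_measurable M"
    and s: "\<And>i. simple_integrable M (s i)"
    and 1: "(\<lambda>i. \<integral>\<^sup>+x. norm (indicator S x *\<^sub>R f x - s i x) \<partial>M) \<longlonglongrightarrow> 0"
    and 2: "(\<lambda>i. simple_bint M (s i)) \<longlonglongrightarrow> I"
    unfolding has_bochner_def by auto
  have sS: "simple_integrable M (\<lambda>x. indicator S x *\<^sub>R s i x)" for i
  proof
    have sf: "simple_function M (s i)" using s[of i] by (auto elim: Bochner_Integration.simple_bochner_integrable.cases)
    have "simple_function M (\<lambda>x. (if x \<in> S then s i x else 0))"
      by (rule simple_function_If_set[OF sf]) (auto simp: S)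
    then show "simple_function M (\<lambda>x. indicator S x *\<^sub>R s i x)"
      by (rule simple_function_cong[THEN iffD1, rotated]) (auto split: split_indicator)
    have "emeasure M {y \<in> space M. indicator S y *\<^sub>R s i y \<noteq> 0} \<le> emeasure M {y \<in> space M. s i y \<noteq> 0}"
      using measurable_sets[OF measurable_simple_function[OF sf], of "- {0}"]
      by (intro emeasure_mono) (auto simp: vimage_def Int_def conj_commute)
    then show "emeasure M {y \<in> space M. indicator S y *\<^sub>R s i y \<noteq> 0} \<noteq> \<infinity>"
      using s[of i] by (auto elim!: Bochner_Integration.simple_bochner_integrable.cases simp: top_unique)
  qed
  have sr: "simple_integrable (restrict_space M S) (s i)" for i
    using sS by (simp add: simple_bochner_integrable_restrict_space[OF S])
  have nn: "(\<integral>\<^sup>+x. norm (f x - s i x) \<partial>restrict_space M S) \<le> (\<integral>\<^sup>+x. norm (indicator S x *\<^sub>R f x - s i x) \<partial>M)" for i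
    by (subst nn_integral_restrict_space[OF S]) (auto intro!: nn_integral_mono split: split_indicator)
  have lim0: "(\<lambda>i. \<integral>\<^sup>+x. norm (f x - s i x) \<partial>restrict_space M S) \<longlonglongrightarrow> 0"
    by (rule tendsto_sandwich[OF _ _ tendsto_const 1]) (use nn in auto)
  have "(\<lambda>i. simple_bint (restrict_space M S) (s i)) \<longlonglongrightarrow> I"
  proof -
    have "norm (simple_bint (restrict_space M S) (s i) - simple_bint M (s i))
        \<le> enn2real (\<integral>\<^sup>+x. norm (indicator S x *\<^sub>R f x - s i x) \<partial>M)"
      if fin: "(\<integral>\<^sup>+x. norm (indicator S x *\<^sub>R f x - s i x) \<partial>M) < top" for i
    proof -
      have "ennreal (norm (simple_bint (restrict_space M S) (s i) - simple_bint M (s i)))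
        = ennreal (norm (simple_bint M (\<lambda>x. indicator S x *\<^sub>R s i x) - simple_bint M (s i)))"
        by (simp add: simple_bochner_integral_restrict_space[OF S sr])
      also have "\<dots> \<le> (\<integral>\<^sup>+x. norm (indicator S x *\<^sub>R s i x - s i x) \<partial>M)"
        by (rule simple_bint_dist_le[OF sS s])
      also have "\<dots> \<le> (\<integral>\<^sup>+x. norm (indicator S x *\<^sub>R f x - s i x) \<partial>M)"
        by (auto intro!: nn_integral_mono split: split_indicator)
      finally show ?thesis using fin by (metis enn2real_ennreal enn2real_mono norm_ge_zero)
    qed
    moreover have "\<forall>\<^sub>F i in sequentially. (\<integral>\<^sup>+x. norm (indicator S x *\<^sub>R f x - s i x) \<partial>M) < top"
      using order_tendstoD(2)[OF 1, of top] by simp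
    ultimately have ev: "\<forall>\<^sub>F i in sequentially. norm (simple_bint (restrict_space M S) (s i) - simple_bint M (s i))
        \<le> enn2real (\<integral>\<^sup>+x. norm (indicator S x *\<^sub>R f x - s i x) \<partial>M)"
      by (auto elim: eventually_mono)
    have "(\<lambda>i. simple_bint (restrict_space M S) (s i) - simple_bint M (s i)) \<longlonglongrightarrow> 0"
    proof (rule Lim_null_comparison[OF ev])
      show "(\<lambda>i. enn2real (\<integral>\<^sup>+x. norm (indicator S x *\<^sub>R f x - s i x) \<partial>M)) \<longlonglongrightarrow> 0"
        using tendsto_enn2real[OF _ order.refl] 1 by simp
    qed
    from tendsto_add[OF this 2] show ?thesis by simp
  qed
  then show "has_bochner (restrict_space M S) f I"
    using f sr lim0 unfolding has_bochner_def by (auto simp: borel_measurable_restrict_space_iff[OF S])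
qed

lemma has_bochner_norm_le_integral:
  fixes f :: "'a \<Rightarrow> 'x::real_normed_vector"
  assumes f: "has_bochner M f I" and w: "integrable M w" and le: "AE x in M. norm (f x) \<le> w x"
  shows "norm I \<le> (\<integral>x. w x \<partial>M)"
proof -
  have nn: "AE x in M. 0 \<le> w x" using le by eventually_elim (metis norm_ge_zero order_trans)
  have "ennreal (norm I) \<le> (\<integral>\<^sup>+x. ennreal (w x) \<partial>M)"
    by (rule has_bochner_norm_le[OF f]) (use le in \<open>auto intro: ennreal_leI\<close>)
  also have "\<dots> = ennreal (\<integral>x. w x \<partial>M)" by (rule nn_integral_eq_integral[OF w nn])
  finally show ?thesis using integral_nonneg_AE[OF nn] by simp
qed

lemma (in complete_measure) bochner_integral_dist_le:
  fixes f g :: "'a \<Rightarrow> 'x::real_normed_vector"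
  assumes f: "bochner_integrable M f" and g: "bochner_integrable M g"
    and w: "integrable M w" "AE x in M. norm (f x - g x) \<le> w x"
  shows "norm (bochner_integral M f - bochner_integral M g) \<le> (\<integral>x. w x \<partial>M)"
  by (rule has_bochner_norm_le_integral[OF has_bochner_diff w])
    (intro has_bochner_bochner_integral f g)+

lemma (in complete_measure) bochner_integrable_limit_real:
  fixes f :: "'a \<Rightarrow> 'x::banach"
  assumes approx: "\<And>e. 0 < (e::real) \<Longrightarrow> \<exists>g w. bochner_integrable M g
      \<and> integrable M w \<and> (AE x in M. norm (f x - g x) \<le> w x) \<and> (\<integral>x. w x \<partial>M) \<le> e"
  shows "bochner_integrable M f"
proof (rule bochner_integrable_limit)
  fix e :: real assume "0 < e"
  from approx[OF this] obtain g w where g: "bochner_integrable M g" and w: "integrable M w"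
    and le: "AE x in M. norm (f x - g x) \<le> w x" and e: "(\<integral>x. w x \<partial>M) \<le> e" by blast
  have nn: "AE x in M. 0 \<le> w x" using le by eventually_elim (metis norm_ge_zero order_trans)
  have "(\<integral>\<^sup>+x. ennreal (w x) \<partial>M) \<le> ennreal e"
    using e by (simp add: nn_integral_eq_integral[OF w nn] ennreal_leI)
  moreover have "AE x in M. ennreal (norm (f x - g x)) \<le> ennreal (w x)"
    using le by eventually_elim (rule ennreal_leI)
  moreover have "(\<lambda>x. ennreal (w x)) \<in> borel_measurable M" using w by measurable
  ultimately show "\<exists>g w. bochner_integrable M g \<and> w \<in> borel_measurable M
      \<and> (AE x in M. ennreal (norm (f x - g x)) \<le> w x) \<and> (\<integral>\<^sup>+x. w x \<partial>M) \<le> ennreal e"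
    using g by (intro exI[of _ g] exI[of _ "\<lambda>x. ennreal (w x)"]) auto
qed

lemma (in complete_measure) bochner_integrable_add:
  fixes f g :: "'a \<Rightarrow> 'x::real_normed_vector"
  shows "bochner_integrable M f \<Longrightarrow> bochner_integrable M g \<Longrightarrow> bochner_integrable M (\<lambda>x. f x + g x)"
  using has_bochner_add by blast

lemma (in complete_measure) integrable_norm_diff:
  fixes f g :: "'a \<Rightarrow> 'x::real_normed_vector"
  assumes "bochner_integrable M f" "bochner_integrable M g"
  shows "integrable M (\<lambda>x. norm (f x - g x))"
  using assms has_bochner_diff has_bochner_norm_finite by blast

lemma (in complete_measure) bochner_integrable_induct_real [consumes 1, case_names indicator add lim]:
  fixes f :: "'a \<Rightarrow> 'x::real_normed_vector"
  assumes f: "bochner_integrable M f"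
    and ind: "\<And>E c. E \<in> sets M \<Longrightarrow> emeasure M E < \<infinity> \<Longrightarrow> P (\<lambda>x. indicator E x *\<^sub>R c)"
    and add: "\<And>f g. bochner_integrable M f \<Longrightarrow> bochner_integrable M g \<Longrightarrow> P f \<Longrightarrow> P g
        \<Longrightarrow> P (\<lambda>x. f x + g x)"
    and lim: "\<And>f. bochner_integrable M f \<Longrightarrow>
        (\<And>e. 0 < (e::real) \<Longrightarrow> \<exists>g. bochner_integrable M g \<and> P g \<and> (\<integral>x. norm (f x - g x) \<partial>M) \<le> e)
        \<Longrightarrow> P f"
  shows "P f"
  using f
proof (induction rule: bochner_integrable_induct)
  case (lim f)
  show ?case
  proof (rule assms(4)[OF lim(1)])
    fix e :: real assume e: "0 < e"
    obtain g where g: "bochner_integrable M g" "P g" "(\<integral>\<^sup>+x. norm (f x - g x) \<partial>M) \<le> ennreal e"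
      using lim(2)[OF e] by blast
    have "(\<integral>x. norm (f x - g x) \<partial>M) \<le> e"
      using g(3) e nn_integral_eq_integral[OF integrable_norm_diff[OF lim(1) g(1)]] by simp
    with g show "\<exists>g. bochner_integrable M g \<and> P g \<and> (\<integral>x. norm (f x - g x) \<partial>M) \<le> e" by blast
  qed
qed (fact ind, fact add)

section \<open>Products and bounded convergence\<close>

text \<open>
  A bounded measurable factor acts continuously in mean, which leaves indicator functions: for
  \<open>f = 1\<^sub>E c\<close> the product is the image of the separably valued function \<open>1\<^sub>E g\<close> under \<open>a \<mapsto> B a c\<close>.
\<close>

lemma (in complete_measure) bochner_integrable_bilinear:
  fixes f :: "'a \<Rightarrow> 'x::banach" and g :: "'a \<Rightarrow> 'b::{banach,second_countable_topology}"
    and B :: "'b \<Rightarrow> 'x \<Rightarrow> 'y::banach"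
  assumes B: "bounded_bilinear B" and g[measurable]: "g \<in> borel_measurable M"
    and C: "\<And>x. norm (g x) \<le> C" and f: "bochner_integrable M f"
  shows "bochner_integrable M (\<lambda>x. B (g x) (f x))"
proof -
  interpret B: bounded_bilinear B by fact
  obtain K where K: "0 < K" "\<And>a b. norm (B a b) \<le> norm a * norm b * K" using B.pos_bounded by auto
  have C0: "0 \<le> C" using C norm_ge_zero order_trans by blast
  show ?thesis using f
  proof (induction rule: bochner_integrable_induct_real)
    case (indicator E c)
    have "integrable M (\<lambda>x. indicator E x *\<^sub>R g x)"
    proof (rule Bochner_Integration.integrable_bound)
      show "integrable M (\<lambda>x. C * indicator E x :: real)" using indicator by simp
      show "AE x in M. norm (indicator E x *\<^sub>R g x) \<le> norm (C * indicator E x :: real)"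
        using C C0 by (auto split: split_indicator)
    qed (use indicator in measurable)
    from has_bochner_linear_image[OF B.bounded_linear_left[of c] this]
    show ?case by (auto simp: B.scaleR_left B.scaleR_right)
  next
    case (add f1 f2)
    then show ?case by (auto simp: B.add_right intro: has_bochner_add)
  next
    case (lim f)
    show ?case
    proof (rule bochner_integrable_limit_real)
      fix e :: real assume e: "0 < e"
      have CK: "0 < C * K + 1" using C0 K by (simp add: add_nonneg_pos)
      then have "0 < e / (C * K + 1)" using e by simp
      from lim(2)[OF this] obtain h where h: "bochner_integrable M h"
        "bochner_integrable M (\<lambda>x. B (g x) (h x))" "(\<integral>x. norm (f x - h x) \<partial>M) \<le> e / (C * K + 1)" by blast
      have i: "integrable M (\<lambda>x. norm (f x - h x))" by (rule integrable_norm_diff[OF lim(1) h(1)])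
      have "norm (B (g x) (f x) - B (g x) (h x)) \<le> C * K * norm (f x - h x)" for x
      proof -
        have "norm (B (g x) (f x) - B (g x) (h x)) \<le> norm (g x) * norm (f x - h x) * K"
          using K(2)[of "g x" "f x - h x"] by (simp add: B.diff_right)
        also have "\<dots> \<le> C * norm (f x - h x) * K"
          by (intro mult_right_mono C) (use K in auto)
        finally show ?thesis by (simp add: ac_simps)
      qed
      moreover have "(\<integral>x. C * K * norm (f x - h x) \<partial>M) \<le> e"
      proof -
        have "(\<integral>x. C * K * norm (f x - h x) \<partial>M) = C * K * (\<integral>x. norm (f x - h x) \<partial>M)" by simp
        also have "\<dots> \<le> C * K * (e / (C * K + 1))" using h(3) C0 K by (intro mult_left_mono) auto
        also have "\<dots> \<le> e" using CK e by (simp add: field_simps)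
        finally show ?thesis .
      qed
      ultimately show "\<exists>ga w. bochner_integrable M ga \<and> integrable M w
          \<and> (AE x in M. norm (B (g x) (f x) - ga x) \<le> w x) \<and> (\<integral>x. w x \<partial>M) \<le> e"
        using h(2) i by (intro exI[of _ "\<lambda>x. B (g x) (h x)"] exI[of _ "\<lambda>x. C * K * norm (f x - h x)"]) auto
    qed
  qed
qed

text \<open>
  The integrals differ by at most a constant times the integral of
  \<open>\<parallel>g\<^sub>i - g'\<parallel> \<parallel>f\<parallel>\<close>, to which scalar dominated convergence applies.
\<close>

lemma (in complete_measure) bochner_bounded_convergence:
  fixes f :: "'a \<Rightarrow> 'x::banach" and g :: "nat \<Rightarrow> 'a \<Rightarrow> 'b::{banach,second_countable_topology}"
    and B :: "'b \<Rightarrow> 'x \<Rightarrow> 'y::banach"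
  assumes B: "bounded_bilinear B" and g[measurable]: "\<And>i. g i \<in> borel_measurable M" "g' \<in> borel_measurable M"
    and C: "\<And>i x. norm (g i x) \<le> C" "\<And>x. norm (g' x) \<le> C"
    and lim: "AE x in M. (\<lambda>i. g i x) \<longlonglongrightarrow> g' x" and f: "bochner_integrable M f"
  shows "(\<lambda>i. bochner_integral M (\<lambda>x. B (g i x) (f x))) \<longlonglongrightarrow> bochner_integral M (\<lambda>x. B (g' x) (f x))"
proof -
  interpret B: bounded_bilinear B by fact
  obtain K where K: "0 < K" "\<And>a b. norm (B a b) \<le> norm a * norm b * K" using B.pos_bounded by auto
  have nf: "integrable M (\<lambda>x. norm (f x))" using f has_bochner_norm_finite by blast
  note nf[THEN borel_measurable_integrable, measurable]
  have C': "norm (g i x - g' x) \<le> 2 * C" for i x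
    using norm_triangle_ineq4[of "g i x" "g' x"] C(1)[of i x] C(2)[of x] by linarith
  have bound: "norm (norm (g i x - g' x) * norm (f x) * K) \<le> 2 * C * K * norm (f x)" for i x
  proof -
    have "norm (g i x - g' x) * norm (f x) * K \<le> (2 * C) * norm (f x) * K"
      using K by (intro mult_right_mono C') auto
    then show ?thesis using K by (simp add: ac_simps)
  qed
  have int: "integrable M (\<lambda>x. norm (g i x - g' x) * norm (f x) * K)" for i
    by (rule Bochner_Integration.integrable_bound[where f="\<lambda>x. 2 * C * K * norm (f x)"])
      (use nf in simp, measurable, use bound in \<open>auto intro: order_trans[OF _ abs_ge_self]\<close>)
  have "(\<lambda>i. \<integral>x. norm (g i x - g' x) * norm (f x) * K \<partial>M) \<longlonglongrightarrow> (\<integral>x. 0 \<partial>M)"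
  proof (rule integral_dominated_convergence)
    show "integrable M (\<lambda>x. 2 * C * K * norm (f x))" using nf by simp
    show "AE x in M. (\<lambda>i. norm (g i x - g' x) * norm (f x) * K) \<longlonglongrightarrow> 0"
      using lim
    proof eventually_elim
      case (elim x)
      then have "(\<lambda>i. norm (g i x - g' x)) \<longlonglongrightarrow> 0" by (simp add: LIM_zero tendsto_norm_zero)
      then show ?case by (intro tendsto_mult_left_zero)
    qed
  qed (use bound in auto)
  then have lim0: "(\<lambda>i. \<integral>x. norm (g i x - g' x) * norm (f x) * K \<partial>M) \<longlonglongrightarrow> 0" by simp
  have "norm (bochner_integral M (\<lambda>x. B (g i x) (f x)) - bochner_integral M (\<lambda>x. B (g' x) (f x)))
      \<le> (\<integral>x. norm (g i x - g' x) * norm (f x) * K \<partial>M)" for i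
    by (intro bochner_integral_dist_le bochner_integrable_bilinear[OF B _ C(1) f]
        bochner_integrable_bilinear[OF B _ C(2) f] g int AE_I2) (metis K(2) B.diff_left)
  then show ?thesis
    by (intro LIM_zero_cancel[OF Lim_null_comparison[OF _ lim0]]) auto
qed

section \<open>Bochner integrals on the real line\<close>

text \<open>
  Translations and the reflection preserve Lebesgue measure; this gives the case of indicator functions, and
  both sides are continuous in mean.
\<close>

lemma has_bochner_real_isometry:
  fixes f :: "real \<Rightarrow> 'x::banach" and t c :: real
  assumes c: "\<bar>c\<bar> = 1" and f: "bochner_integrable lebesgue f"
  shows "has_bochner lebesgue (\<lambda>x. f (t + c * x)) (bochner_integral lebesgue f)"
proof -
  have c0: "c \<noteq> 0" using c by auto
  show ?thesis using f
  proof (induction rule: completion.bochner_integrable_induct_real)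
    case (indicator E a)
    have "has_bochner_integral lebesgue (indicator E) (measure lebesgue E)"
      using indicator by (rule has_bochner_integral_real_indicator)
    then have "has_bochner_integral lebesgue (\<lambda>x. indicator E (t + c * x) :: real) (measure lebesgue E)"
      by (subst (asm) has_bochner_integral_lebesgue_real_affine_iff[OF c0, of _ _ t]) (simp add: c)
    then have "has_bochner lebesgue (\<lambda>x. indicator E (t + c * x) *\<^sub>R a) (measure lebesgue E *\<^sub>R a)"
      using has_bochner_linear_image[OF bounded_linear_scaleR_left, of lebesgue "\<lambda>x. indicator E (t + c * x)" a]
      by (simp add: has_bochner_integral_iff)
    moreover have "bochner_integral lebesgue (\<lambda>x. indicator E x *\<^sub>R a) = measure lebesgue E *\<^sub>R a"
      using has_bochner_linear_image[OF bounded_linear_scaleR_left[of a], of lebesgue "indicator E"] indicator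
      by (intro completion.bochner_integral_eq) simp
    ultimately show ?case by simp
  next
    case (add f g)
    have "bochner_integral lebesgue (\<lambda>x. f x + g x) = bochner_integral lebesgue f + bochner_integral lebesgue g"
      by (intro completion.bochner_integral_eq completion.has_bochner_add completion.has_bochner_bochner_integral add)
    then show ?case using completion.has_bochner_add[OF add(3,4)] by simp
  next
    case (lim f)
    have ex: "\<exists>g. bochner_integrable lebesgue g \<and> bochner_integral lebesgue g = bochner_integral lebesgue (\<lambda>x. g (t + c * x))
        \<and> bochner_integrable lebesgue (\<lambda>x. g (t + c * x))
        \<and> (\<integral>x. norm (f x - g x) \<partial>lebesgue) \<le> e
        \<and> integrable lebesgue (\<lambda>x. norm (f (t + c * x) - g (t + c * x)))
        \<and> (\<integral>x. norm (f (t + c * x) - g (t + c * x)) \<partial>lebesgue) \<le> e" if e: "0 < e" for e :: real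
    proof -
      obtain g where g: "bochner_integrable lebesgue g"
        "has_bochner lebesgue (\<lambda>x. g (t + c * x)) (bochner_integral lebesgue g)"
        "(\<integral>x. norm (f x - g x) \<partial>lebesgue) \<le> e" using lim(2)[OF e] by blast
      have "integrable lebesgue (\<lambda>x. norm (f x - g x))"
        by (rule completion.integrable_norm_diff[OF lim(1) g(1)])
      then have "has_bochner_integral lebesgue (\<lambda>x. norm (f x - g x)) (\<integral>x. norm (f x - g x) \<partial>lebesgue)"
        by (rule has_bochner_integral_integrable)
      then have "has_bochner_integral lebesgue (\<lambda>x. norm (f (t + c * x) - g (t + c * x))) (\<integral>x. norm (f x - g x) \<partial>lebesgue)"
        by (subst (asm) has_bochner_integral_lebesgue_real_affine_iff[OF c0, of _ _ t]) (simp add: c)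
      then show ?thesis using g completion.bochner_integral_eq[OF g(2)]
        by (intro exI[of _ g]) (auto simp: has_bochner_integral_iff)
    qed
    have i: "bochner_integrable lebesgue (\<lambda>x. f (t + c * x))"
    proof (rule completion.bochner_integrable_limit_real)
      fix e :: real assume "0 < e"
      from ex[OF this] obtain g where "bochner_integrable lebesgue (\<lambda>x. g (t + c * x))"
        "integrable lebesgue (\<lambda>x. norm (f (t + c * x) - g (t + c * x)))"
        "(\<integral>x. norm (f (t + c * x) - g (t + c * x)) \<partial>lebesgue) \<le> e" by blast
      then show "\<exists>g w. bochner_integrable lebesgue g \<and> integrable lebesgue w
          \<and> (AE x in lebesgue. norm (f (t + c * x) - g x) \<le> w x) \<and> (\<integral>x. w x \<partial>lebesgue) \<le> e"
        by (intro exI[of _ "\<lambda>x. g (t + c * x)"] exI[of _ "\<lambda>x. norm (f (t + c * x) - g (t + c * x))"]) auto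
    qed
    have "dist (bochner_integral lebesgue (\<lambda>x. f (t + c * x))) (bochner_integral lebesgue f) \<le> e" if "0 < e" for e
    proof -
      obtain g where g: "bochner_integrable lebesgue g" "bochner_integral lebesgue g = bochner_integral lebesgue (\<lambda>x. g (t + c * x))"
        "bochner_integrable lebesgue (\<lambda>x. g (t + c * x))"
        "(\<integral>x. norm (f x - g x) \<partial>lebesgue) \<le> e/2"
        "integrable lebesgue (\<lambda>x. norm (f (t + c * x) - g (t + c * x)))"
        "(\<integral>x. norm (f (t + c * x) - g (t + c * x)) \<partial>lebesgue) \<le> e/2"
        using ex[of "e/2"] \<open>0 < e\<close> by auto
      have "norm (bochner_integral lebesgue f - bochner_integral lebesgue g) \<le> e/2"
        using completion.bochner_integral_dist_le[OF lim(1) g(1) completion.integrable_norm_diff[OF lim(1) g(1)]] g(4) by force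
      moreover have "norm (bochner_integral lebesgue (\<lambda>x. f (t + c * x)) - bochner_integral lebesgue (\<lambda>x. g (t + c * x))) \<le> e/2"
        using completion.bochner_integral_dist_le[OF i g(3) g(5)] g(6) by force
      ultimately show ?thesis
        unfolding g(2) using dist_triangle_half_r[of _ _ e] dist_triangle3[of "bochner_integral lebesgue (\<lambda>x. f (t + c * x))" "bochner_integral lebesgue f" "bochner_integral lebesgue (\<lambda>x. g (t + c * x))"]
        by (simp add: dist_norm norm_minus_commute)
    qed
    then have "dist (bochner_integral lebesgue (\<lambda>x. f (t + c * x))) (bochner_integral lebesgue f) \<le> 0"
      by (rule field_le_epsilon[of _ 0, simplified])
    then show ?case using completion.has_bochner_bochner_integral[OF i] by simp
  qed
qed

text \<open>
  The image of \<open>S\<close> is compact, hence covered by finitely many small balls.  Making the balls disjoint and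
  replacing each value by the centre of its ball gives a uniformly close simple function.
\<close>

lemma bochner_integrable_continuous_compact:
  fixes f :: "real \<Rightarrow> 'x::banach"
  assumes S: "compact S" and f: "continuous_on S f"
  shows "bochner_integrable lebesgue (\<lambda>x. indicator S x *\<^sub>R f x)"
proof (rule completion.bochner_integrable_limit_real)
  fix e :: real assume e: "0 < e"
  have Sm: "S \<in> lmeasurable" using S by (rule lmeasurable_compact)
  define d where "d = e / (measure lebesgue S + 1)"
  have d: "0 < d" using e unfolding d_def by (simp add: add_nonneg_pos)
  have "compact (f ` S)" using compact_continuous_image[OF f S] .
  then obtain C where C: "finite C" "f ` S \<subseteq> (\<Union>c\<in>C. ball c d)"
    by (auto elim: compactE_image[where C = "f ` S" and f = "\<lambda>c. ball c d"] dest!: spec[of _ d] simp: d compact_eq_totally_bounded)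
  obtain c :: "nat \<Rightarrow> 'x" and m where c: "C = c ` {..<m}"
    using finite_imp_nat_seg_image_inj_on[OF C(1)] by (auto simp: lessThan_def)
  define A where "A j = {x\<in>S. f x \<in> disjointed (\<lambda>j. if j < m then ball (c j) d else {}) j}" for j
  have A: "A j \<in> sets lebesgue" for j
  proof -
    have "disjointed (\<lambda>j. if j < m then ball (c j) d else {}) j \<in> sets borel"
    proof -
      have "range (disjointed (\<lambda>j. if j < m then ball (c j) d else {})) \<subseteq> sets borel"
        by (rule sets.range_disjointed_sets) auto
      then show ?thesis by blast
    qed
    then have "f -` disjointed (\<lambda>j. if j < m then ball (c j) d else {}) j \<inter> space (restrict_space borel S) \<in> sets (restrict_space borel S)"
      using borel_measurable_continuous_on_restrict[OF f] by (rule measurable_sets[rotated])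
    then have "A j \<in> sets (restrict_space borel S)"
      by (simp add: A_def vimage_def Int_def conj_commute space_restrict_space)
    then have "A j \<in> sets borel"
      using S by (subst (asm) sets_restrict_space_iff) (auto intro: borel_compact)
    then show ?thesis by simp
  qed
  have Afin: "emeasure lebesgue (A j) < \<infinity>" for j
  proof -
    have "A j \<in> lmeasurable"
      by (rule fmeasurableI2[OF Sm _ A]) (auto simp: A_def)
    then show ?thesis using fmeasurableD2 by (metis infinity_ennreal_def less_top)
  qed
  define g where "g x = (\<Sum>j<m. indicator (A j) x *\<^sub>R c j)" for x
  have "bochner_integrable lebesgue (\<lambda>x. \<Sum>j<n. indicator (A j) x *\<^sub>R c j)" for n
  proof (induction n)
    case 0
    show ?case using has_bochner_linear_image[OF bounded_linear_scaleR_left, of lebesgue "\<lambda>_. 0::real" "0::'x"] by auto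
  next
    case (Suc n)
    moreover have "bochner_integrable lebesgue (\<lambda>x. indicator (A n) x *\<^sub>R c n)"
      using has_bochner_linear_image[OF bounded_linear_scaleR_left, of lebesgue "indicator (A n)" "c n"]
      A[of n] Afin[of n] by auto
    ultimately have "bochner_integrable lebesgue (\<lambda>x. (\<Sum>j<n. indicator (A j) x *\<^sub>R c j) + indicator (A n) x *\<^sub>R c n)"
      by (rule completion.bochner_integrable_add)
    then show ?case by simp
  qed
  from this[of m] have "bochner_integrable lebesgue g" by (simp only: g_def[abs_def])
  moreover have "norm (indicator S x *\<^sub>R f x - g x) \<le> d * indicator S x" for x
  proof (cases "x \<in> S")
    case False
    then have "g x = 0" unfolding g_def by (intro sum.neutral) (auto simp: A_def)
    with False show ?thesis by simp
  next
    case True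
    then obtain i where "i < m" "f x \<in> ball (c i) d" using C(2) c by blast
    then have "f x \<in> (\<Union>j. if j < m then ball (c j) d else {})" by (intro UN_I[of i]) simp_all
    then have "f x \<in> (\<Union>j. disjointed (\<lambda>j. if j < m then ball (c j) d else {}) j)"
      by (simp only: UN_disjointed_eq)
    then obtain j where j: "f x \<in> disjointed (\<lambda>j. if j < m then ball (c j) d else {}) j" by blast
    have jb: "f x \<in> (if j < m then ball (c j) d else {})" using j disjointed_subset by fastforce
    then have jm: "j < m" by (auto split: if_splits)
    have uniq: "x \<in> A i \<longleftrightarrow> i = j" for i
      using j True disjoint_family_disjointed[of "\<lambda>j. if j < m then ball (c j) d else {}"]
      unfolding disjoint_family_on_def A_def by blast
    have "g x = (\<Sum>i<m. if i = j then c j else 0)"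
      unfolding g_def by (intro sum.cong) (auto simp: uniq)
    then have "g x = c j" using jm by simp
    with True jb jm show ?thesis by (simp add: dist_norm norm_minus_commute less_imp_le)
  qed
  moreover have "integrable lebesgue (\<lambda>x. d * indicator S x :: real)"
    using Sm unfolding lmeasurable_iff_integrable by (rule integrable_mult_right)
  moreover have "(\<integral>x. d * indicator S x \<partial>lebesgue) \<le> e"
  proof -
    have "0 < 1 + measure lebesgue S" by (simp add: add_pos_nonneg)
    then show ?thesis using e unfolding d_def by (simp add: pos_divide_le_eq algebra_simps)
  qed
  ultimately show "\<exists>g w. bochner_integrable lebesgue g \<and> integrable lebesgue w
      \<and> (AE x in lebesgue. norm (indicator S x *\<^sub>R f x - g x) \<le> w x) \<and> (\<integral>x. w x \<partial>lebesgue) \<le> e"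
    by (intro exI[of _ g] exI[of _ "\<lambda>x. d * indicator S x"]) auto
qed

section \<open>Smooth functions and bumps\<close>

definition smooth :: "(real \<Rightarrow> 'k::real_normed_vector) \<Rightarrow> bool" where
  "smooth f \<longleftrightarrow> (\<forall>m t. vderiv m f differentiable (at t))"

text \<open>
  A class of functions that is closed under differentiation consists of smooth functions.  The closure
  properties of smoothness below follow by naming such a class, without formulas for higher derivatives.
\<close>

lemma smooth_coinduct:
  assumes f: "Q f" and step: "\<And>f. Q f \<Longrightarrow> \<exists>f'. Q f' \<and> (\<forall>t. (f has_vector_derivative f' t) (at t))"
  shows "smooth f"
proof -
  have Q: "Q (vderiv m f)" for m
  proof (induction m)
    case 0
    then show ?case using f by (simp add: vderiv_def)
  next
    case (Suc m)
    from step[OF this] obtain f' where f': "Q f'" "\<And>t. (vderiv m f has_vector_derivative f' t) (at t)" by blast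
    have "vderiv (Suc m) f = (\<lambda>t. vector_derivative (vderiv m f) (at t))"
      by (simp add: vderiv_def)
    also have "\<dots> = f'" using vector_derivative_at[OF f'(2)] by auto
    finally show ?case using f'(1) by simp
  qed
  show ?thesis unfolding smooth_def
  proof (intro allI)
    fix m t
    from step[OF Q[of m]] obtain f' where "\<And>t. (vderiv m f has_vector_derivative f' t) (at t)" by blast
    then show "vderiv m f differentiable (at t)" by (rule differentiableI_vector)
  qed
qed

lemma smooth_step:
  assumes "smooth f"
  shows "\<exists>f'. smooth f' \<and> (\<forall>t. (f has_vector_derivative f' t) (at t))"
proof (intro exI conjI allI)
  have "vderiv m (\<lambda>t. vector_derivative f (at t)) = vderiv (Suc m) f" for m
    unfolding vderiv_def funpow_Suc_right o_apply ..
  then show "smooth (\<lambda>t. vector_derivative f (at t))"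
    using assms by (simp add: smooth_def)
  have "vderiv 0 f differentiable (at t)" for t using assms by (simp only: smooth_def)
  then show "(f has_vector_derivative vector_derivative f (at t)) (at t)" for t
    by (simp add: vderiv_def vector_derivative_works)
qed

lemma smooth_continuous:
  assumes "smooth f"
  shows "continuous_on S f"
  using smooth_step[OF assms] by (meson continuous_at_imp_continuous_on has_vector_derivative_continuous)

lemma smooth_affine:
  assumes "smooth f"
  shows "smooth (\<lambda>t. r *\<^sub>R f (a + c * t))"
proof (rule smooth_coinduct[where Q = "\<lambda>g. \<exists>f r. smooth f \<and> g = (\<lambda>t. r *\<^sub>R f (a + c * t))"])
  fix g assume "\<exists>f r. smooth f \<and> g = (\<lambda>t. r *\<^sub>R f (a + c * t))"
  then obtain f r where f: "smooth f" and g: "g = (\<lambda>t. r *\<^sub>R f (a + c * t))" by blast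
  obtain f' where f': "smooth f'" "\<And>t. (f has_vector_derivative f' t) (at t)" using smooth_step[OF f] by blast
  have "(g has_vector_derivative (r * c) *\<^sub>R f' (a + c * t)) (at t)" for t
  proof -
    have "((\<lambda>t. a + c * t) has_vector_derivative c) (at t)"
      by (auto intro!: derivative_eq_intros simp: has_real_derivative_iff_has_vector_derivative[symmetric])
    from vector_diff_chain_at[OF this f'(2)] have "((\<lambda>t. f (a + c * t)) has_vector_derivative c *\<^sub>R f' (a + c * t)) (at t)"
      by (simp add: o_def)
    from bounded_linear.has_vector_derivative[OF bounded_linear_scaleR_right this, of r]
    show ?thesis unfolding g by simp
  qed
  then show "\<exists>g'. (\<exists>f r. smooth f \<and> g' = (\<lambda>t. r *\<^sub>R f (a + c * t))) \<and> (\<forall>t. (g has_vector_derivative g' t) (at t))"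
    using f'(1) by (intro exI[of _ "\<lambda>t. (r * c) *\<^sub>R f' (a + c * t)"]) auto
qed (use assms in blast)

lemma smooth_linear_combination:
  fixes f g :: "real \<Rightarrow> 'k::real_normed_field"
  assumes "smooth f" "smooth g"
  shows "smooth (\<lambda>t. a * f t + b * g t)"
proof (rule smooth_coinduct[where Q = "\<lambda>h. \<exists>f g. smooth f \<and> smooth g \<and> h = (\<lambda>t. a * f t + b * g t)"])
  fix h assume "\<exists>f g. smooth f \<and> smooth g \<and> h = (\<lambda>t. a * f t + b * g t)"
  then obtain f g where f: "smooth f" and g: "smooth g" and h: "h = (\<lambda>t. a * f t + b * g t)" by blast
  obtain f' where f': "smooth f'" "\<And>t. (f has_vector_derivative f' t) (at t)" using smooth_step[OF f] by blast
  obtain g' where g': "smooth g'" "\<And>t. (g has_vector_derivative g' t) (at t)" using smooth_step[OF g] by blast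
  have "(h has_vector_derivative a * f' t + b * g' t) (at t)" for t
    unfolding h by (intro has_vector_derivative_add has_vector_derivative_mult_right f' g')
  then show "\<exists>h'. (\<exists>f g. smooth f \<and> smooth g \<and> h' = (\<lambda>t. a * f t + b * g t)) \<and> (\<forall>t. (h has_vector_derivative h' t) (at t))"
    using f'(1) g'(1) by (intro exI[of _ "\<lambda>t. a * f' t + b * g' t"]) auto
qed (use assms in blast)

lemma smooth_of_real:
  assumes "smooth f"
  shows "smooth (\<lambda>t. of_real (f t) :: 'k::real_normed_field)"
proof (rule smooth_coinduct[where Q = "\<lambda>h. \<exists>f. smooth f \<and> h = (\<lambda>t. of_real (f t))"])
  fix h :: "real \<Rightarrow> 'k" assume "\<exists>f. smooth f \<and> h = (\<lambda>t. of_real (f t))"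
  then obtain f where f: "smooth f" and h: "h = (\<lambda>t. of_real (f t))" by blast
  obtain f' where f': "smooth f'" "\<And>t. (f has_vector_derivative f' t) (at t)" using smooth_step[OF f] by blast
  have "(h has_vector_derivative of_real (f' t)) (at t)" for t
    unfolding h using f'(2)
    by (intro has_vector_derivative_of_real) (simp add: has_real_derivative_iff_has_vector_derivative)
  then show "\<exists>h'. (\<exists>f. smooth f \<and> h' = (\<lambda>t. of_real (f t))) \<and> (\<forall>t. (h has_vector_derivative h' t) (at t))"
    using f'(1) by (intro exI[of _ "\<lambda>t. of_real (f' t)"]) auto
qed (use assms in blast)

text \<open>
  The products themselves are not closed under differentiation, but their finite sums are.
\<close>

inductive sum_of_smooth_products :: "(real \<Rightarrow> real) \<Rightarrow> bool" where
  mult: "smooth f \<Longrightarrow> smooth g \<Longrightarrow> sum_of_smooth_products (\<lambda>t. f t * g t)"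
| add: "sum_of_smooth_products f \<Longrightarrow> sum_of_smooth_products g \<Longrightarrow> sum_of_smooth_products (\<lambda>t. f t + g t)"

lemma smooth_mult:
  fixes f g :: "real \<Rightarrow> real"
  assumes "smooth f" "smooth g"
  shows "smooth (\<lambda>t. f t * g t)"
proof (rule smooth_coinduct[where Q = sum_of_smooth_products])
  show "sum_of_smooth_products (\<lambda>t. f t * g t)" using assms by (rule mult)
  show "\<exists>h'. sum_of_smooth_products h' \<and> (\<forall>t. (h has_vector_derivative h' t) (at t))"
    if "sum_of_smooth_products h" for h
    using that
  proof induction
    case (mult f g)
    obtain f' where f': "smooth f'" "\<And>t. (f has_vector_derivative f' t) (at t)" using smooth_step[OF mult(1)] by blast
    obtain g' where g': "smooth g'" "\<And>t. (g has_vector_derivative g' t) (at t)" using smooth_step[OF mult(2)] by blast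
    have "sum_of_smooth_products (\<lambda>t. f t * g' t + f' t * g t)"
      by (intro sum_of_smooth_products.intros mult f'(1) g'(1))
    moreover have "((\<lambda>t. f t * g t) has_vector_derivative f t * g' t + f' t * g t) (at t)" for t
      by (rule has_vector_derivative_mult[OF f'(2) g'(2)])
    ultimately show ?case by blast
  next
    case (add f g)
    then obtain f' g' where "sum_of_smooth_products f'" "\<And>t. (f has_vector_derivative f' t) (at t)"
      "sum_of_smooth_products g'" "\<And>t. (g has_vector_derivative g' t) (at t)" by blast
    then show ?case
      by (intro exI[of _ "\<lambda>t. f' t + g' t"] conjI allI sum_of_smooth_products.add has_vector_derivative_add)
  qed
qed

text \<open>
  The classical smooth function that vanishes to infinite order at \<open>0\<close>.
\<close>

definition flat :: "real \<Rightarrow> real" where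
  "flat x = (if x \<le> 0 then 0 else exp (- 1 / x))"

lemma poly_exp_inverse_tendsto_0:
  fixes p :: "real poly"
  shows "((\<lambda>x. poly p (1 / x) * exp (- 1 / x)) \<longlongrightarrow> 0) (at_right 0)"
proof -
  have "((\<lambda>z. poly p z * exp (- z)) \<longlongrightarrow> (\<Sum>i\<le>degree p. coeff p i * 0)) at_top"
  proof -
    have "(\<lambda>z. poly p z * exp (- z)) = (\<lambda>z. \<Sum>i\<le>degree p. coeff p i * (z ^ i / exp z))"
      unfolding poly_altdef sum_distrib_right by (simp add: exp_minus divide_inverse mult.assoc)
    moreover have "((\<lambda>z. \<Sum>i\<le>degree p. coeff p i * (z ^ i / exp z)) \<longlongrightarrow> (\<Sum>i\<le>degree p. coeff p i * 0)) at_top"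
      by (intro tendsto_sum tendsto_mult tendsto_const tendsto_power_div_exp_0)
    ultimately show ?thesis by simp
  qed
  then have "((\<lambda>z. poly p z * exp (- z)) \<longlongrightarrow> 0) at_top" by simp
  from filterlim_compose[OF this filterlim_inverse_at_top_right] show ?thesis
    by (simp add: divide_inverse)
qed

text \<open>
  Each derivative is again \<open>p(1/x) exp(-1/x)\<close> for \<open>x > 0\<close> and \<open>0\<close> otherwise, with a polynomial \<open>p\<close>; the
  next polynomial is \<open>x\<^sup>2 (p - p')\<close>.  At \<open>0\<close> the difference quotient has the same form, with
  \<open>x p\<close> in place of \<open>p\<close>, and tends to \<open>0\<close>.
\<close>

lemma smooth_flat: "smooth flat"
proof (rule smooth_coinduct[where Q = "\<lambda>f. \<exists>p::real poly. f = (\<lambda>x. if x \<le> 0 then 0 else poly p (1 / x) * exp (- 1 / x))"])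
  show "\<exists>p::real poly. flat = (\<lambda>x. if x \<le> 0 then 0 else poly p (1 / x) * exp (- 1 / x))"
    by (intro exI[of _ 1]) (auto simp: flat_def)
next
  fix f assume "\<exists>p::real poly. f = (\<lambda>x. if x \<le> 0 then 0 else poly p (1 / x) * exp (- 1 / x))"
  then obtain p :: "real poly" where f: "f = (\<lambda>x. if x \<le> 0 then 0 else poly p (1 / x) * exp (- 1 / x))" by blast
  \<comment> \<open>\<open>[:0, 0, 1:]\<close> is \<open>x\<^sup>2\<close>, the factor coming from the derivative of \<open>1/x\<close>\<close>
  define q where "q = [:0, 0, 1:] * (p - pderiv p)"
  define f' where "f' = (\<lambda>x::real. if x \<le> 0 then 0 else poly q (1 / x) * exp (- 1 / x))"
  have "(f has_field_derivative f' t) (at t)" for t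
  proof (cases t "0::real" rule: linorder_cases)
    case less
    have "\<forall>\<^sub>F x in nhds t. x < 0" using less eventually_nhds_in_open[of "{..<0}" t] by simp
    then have "\<forall>\<^sub>F x in nhds t. f x = 0" by eventually_elim (simp add: f)
    then have "(f has_field_derivative 0) (at t) \<longleftrightarrow> ((\<lambda>_. 0) has_field_derivative 0) (at t)"
      by (intro DERIV_cong_ev) auto
    then show ?thesis using less by (simp add: f'_def)
  next
    case greater
    have "\<forall>\<^sub>F x in nhds t. 0 < x" using greater eventually_nhds_in_open[of "{0<..}" t] by simp
    then have "\<forall>\<^sub>F x in nhds t. f x = poly p (1 / x) * exp (- 1 / x)" by eventually_elim (simp add: f)
    then have "(f has_field_derivative f' t) (at t) \<longleftrightarrow> ((\<lambda>x. poly p (1 / x) * exp (- 1 / x)) has_field_derivative f' t) (at t)"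
      by (intro DERIV_cong_ev) auto
    moreover have "((\<lambda>x. poly p (1 / x) * exp (- 1 / x)) has_field_derivative f' t) (at t)"
    proof -
      have i: "((\<lambda>x. 1 / x) has_field_derivative - (1 / t\<^sup>2)) (at t)"
        using greater by (auto intro!: derivative_eq_intros simp: power2_eq_square)
      have e: "((\<lambda>x. exp (- 1 / x)) has_field_derivative exp (- 1 / t) * (1 / t\<^sup>2)) (at t)"
        using greater by (auto intro!: derivative_eq_intros simp: power2_eq_square)
      have "((\<lambda>x. poly p (1 / x)) has_field_derivative poly (pderiv p) (1 / t) * - (1 / t\<^sup>2)) (at t)"
        by (rule DERIV_chain2[OF poly_DERIV i])
      from DERIV_mult[OF this e] show ?thesis
        using greater by (simp add: f'_def q_def power2_eq_square algebra_simps)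
    qed
    ultimately show ?thesis by simp
  next
    case equal
    have "((\<lambda>y. (f y - f 0) / (y - 0)) \<longlongrightarrow> 0) (at 0)"
    proof (rule filterlim_split_at)
      show "((\<lambda>y. (f y - f 0) / (y - 0)) \<longlongrightarrow> 0) (at_left 0)"
        by (rule tendsto_eventually) (auto simp: f eventually_at_filter)
      have "\<forall>\<^sub>F y in at_right 0. poly ([:0, 1:] * p) (1 / y) * exp (- 1 / y) = (f y - f 0) / (y - 0)"
        by (auto simp: f eventually_at_filter)
      from tendsto_cong[OF this] show "((\<lambda>y. (f y - f 0) / (y - 0)) \<longlongrightarrow> 0) (at_right 0)"
        using poly_exp_inverse_tendsto_0[of "[:0, 1:] * p"] by blast
    qed
    then show ?thesis using equal by (simp add: has_field_derivative_iff f'_def)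
  qed
  then show "\<exists>f'. (\<exists>p::real poly. f' = (\<lambda>x. if x \<le> 0 then 0 else poly p (1 / x) * exp (- 1 / x)))
      \<and> (\<forall>t. (f has_vector_derivative f' t) (at t))"
    by (intro exI[of _ f']) (auto simp: f'_def has_real_derivative_iff_has_vector_derivative)
qed

lemma flat_bounds: "0 \<le> flat x" "flat x \<le> 1"
  by (auto simp: flat_def)

lemma flat_dilation_tendsto:
  "(\<lambda>n. flat (real n * x)) \<longlonglongrightarrow> (if x > 0 then 1 else 0)"
proof (cases "x > 0")
  case True
  have "filterlim (\<lambda>n. x * real n) at_top sequentially"
    by (rule filterlim_tendsto_pos_mult_at_top[OF tendsto_const True filterlim_real_sequentially])
  then have "(\<lambda>n. - 1 / (x * real n)) \<longlonglongrightarrow> 0"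
    by (intro tendsto_divide_0[OF tendsto_const] filterlim_at_top_imp_at_infinity)
  then have "(\<lambda>n. exp (- 1 / (x * real n))) \<longlonglongrightarrow> 1" using tendsto_exp by fastforce
  moreover have "\<forall>\<^sub>F n in sequentially. exp (- 1 / (x * real n)) = flat (real n * x)"
    using eventually_gt_at_top[of 0]
  proof eventually_elim
    case (elim n)
    then have "0 < real n * x" using True by simp
    then show ?case by (simp add: flat_def mult.commute not_le)
  qed
  ultimately have "(\<lambda>n. flat (real n * x)) \<longlonglongrightarrow> 1" by (rule Lim_transform_eventually)
  then show ?thesis using True by simp
next
  case False
  then have "flat (real n * x) = 0" for n by (simp add: flat_def mult_le_0_iff not_less)
  then show ?thesis using False by simp
qed

text \<open>
  The parameter \<open>r\<close> makes the flanks steeper without enlarging the support: as \<open>r \<rightarrow> \<infinity>\<close> the bumps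
  increase to the indicator function of the open interval.
\<close>

definition bump :: "real \<Rightarrow> real \<Rightarrow> real \<Rightarrow> real \<Rightarrow> real" where
  "bump r a b t = flat (r * (t - a)) * flat (r * (b - t))"

lemma smooth_bump: "smooth (bump r a b)"
proof -
  have "smooth (\<lambda>t. (1 *\<^sub>R flat (- r * a + r * t)) * (1 *\<^sub>R flat (r * b + (- r) * t)))"
    by (intro smooth_mult smooth_affine smooth_flat)
  moreover have "(\<lambda>t. (1 *\<^sub>R flat (- r * a + r * t)) * (1 *\<^sub>R flat (r * b + (- r) * t))) = bump r a b"
    by (intro ext) (simp add: bump_def right_diff_distrib)
  ultimately show ?thesis by simp
qed

lemma bump_bounds: "0 \<le> bump r a b t" "bump r a b t \<le> 1"
  using flat_bounds by (auto simp: bump_def intro: mult_le_one)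

lemma bump_eq_0: "0 \<le> r \<Longrightarrow> t \<notin> {a<..<b} \<Longrightarrow> bump r a b t = 0"
  by (auto simp: bump_def flat_def mult_le_0_iff zero_le_mult_iff not_less)

lemma bump_pos: "0 < r \<Longrightarrow> t \<in> {a<..<b} \<Longrightarrow> 0 < bump r a b t"
  by (auto simp: bump_def flat_def mult_le_0_iff not_less)

lemma bump_tendsto_indicator:
  "(\<lambda>n. bump (real n) a b t) \<longlonglongrightarrow> indicator {a<..<b} t"
proof -
  have "(\<lambda>n. bump (real n) a b t) \<longlonglongrightarrow> (if t - a > 0 then 1 else 0) * (if b - t > 0 then 1 else 0)"
    unfolding bump_def by (intro tendsto_mult flat_dilation_tendsto)
  then show ?thesis by (simp add: indicator_def split: if_splits)
qed

section \<open>Test functions\<close>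

lemma test_functionsI:
  assumes s: "smooth \<phi>" and z: "\<And>t. t \<notin> {a..b} \<Longrightarrow> \<phi> t = 0" and J: "{a..b} \<subseteq> J"
  shows "\<phi> \<in> test_functions J"
proof -
  have "{t. \<phi> t \<noteq> 0} \<subseteq> {a..b}" using z by blast
  then have "support \<phi> \<subseteq> {a..b}" unfolding support_def by (intro closure_minimal) auto
  moreover from this have "compact (support \<phi>)"
    unfolding support_def by (meson bounded_closed_interval bounded_subset closed_closure compact_eq_bounded_closed)
  ultimately show ?thesis using s J by (auto simp: test_functions_def smooth_def)
qed

lemma compact_subset_interval:
  assumes J: "admissible_interval J" and S: "compact S" "S \<subseteq> J"
  obtains a b where "a \<le> b" "S \<subseteq> {a..b}" "{a..b} \<subseteq> J"
proof (cases "S = {}")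
  case True
  from J have "J \<noteq> {}" unfolding admissible_interval_def
    by (metis UNIV_not_empty atLeast_iff empty_iff greaterThan_iff gt_ex order_refl)
  then obtain x where "x \<in> J" by blast
  then show ?thesis using True that[of x x] by auto
next
  case False
  obtain a where a: "a \<in> S" "\<And>x. x \<in> S \<Longrightarrow> a \<le> x" using compact_attains_inf[OF S(1) False] by blast
  obtain b where b: "b \<in> S" "\<And>x. x \<in> S \<Longrightarrow> x \<le> b" using compact_attains_sup[OF S(1) False] by blast
  have "{a..b} \<subseteq> J" using J a b S unfolding admissible_interval_def by (auto simp: subset_iff)
  then show ?thesis by (intro that[of a b]) (use a b in auto)
qed

lemma admissible_upward: "admissible_interval J \<Longrightarrow> a \<in> J \<Longrightarrow> a \<le> t \<Longrightarrow> t \<in> J"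
  unfolding admissible_interval_def by auto

lemma admissible_Icc_subset: "admissible_interval J \<Longrightarrow> a \<in> J \<Longrightarrow> {a..b} \<subseteq> J"
  using admissible_upward by fastforce

lemma test_functionsD:
  assumes J: "admissible_interval J" and \<phi>: "\<phi> \<in> test_functions J"
  obtains a b where "a \<le> b" "{a..b} \<subseteq> J" "\<And>t. t \<notin> {a..b} \<Longrightarrow> \<phi> t = 0" "smooth \<phi>"
proof -
  have "compact (support \<phi>)" "support \<phi> \<subseteq> J" "smooth \<phi>" using \<phi> by (auto simp: test_functions_def smooth_def)
  then obtain a b where "a \<le> b" "support \<phi> \<subseteq> {a..b}" "{a..b} \<subseteq> J" using compact_subset_interval[OF J] by metis
  moreover have "\<phi> t = 0" if "t \<notin> {a..b}" for t
    using that calculation closure_subset[of "{t. \<phi> t \<noteq> 0}"] by (auto simp: support_def)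
  ultimately show ?thesis using \<open>smooth \<phi>\<close> that by blast
qed

lemma bump_test_function:
  assumes "0 \<le> r" "{a..b} \<subseteq> J"
  shows "(\<lambda>t. of_real (bump r a b t) :: 'k::real_normed_field) \<in> test_functions J"
  by (rule test_functionsI[OF smooth_of_real[OF smooth_bump] _ assms(2)])
    (use bump_eq_0[OF assms(1)] in auto)

section \<open>Integrals over intervals and means\<close>

lemma has_bochner_lebesgue_on:
  fixes f :: "real \<Rightarrow> 'x::real_normed_vector"
  assumes "S \<in> sets lebesgue"
  shows "has_bochner (lebesgue_on S) f I \<longleftrightarrow> has_bochner lebesgue (\<lambda>x. indicator S x *\<^sub>R f x) I"
  using assms by (intro has_bochner_restrict_space) simp

lemma bochner_integral_lebesgue_on:
  fixes f :: "real \<Rightarrow> 'x::real_normed_vector"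
  assumes "S \<in> sets lebesgue"
  shows "bochner_integral (lebesgue_on S) f = bochner_integral lebesgue (\<lambda>x. indicator S x *\<^sub>R f x)"
  unfolding bochner_integral_def has_bochner_lebesgue_on[OF assms] ..

lemma admissible_sets: "admissible_interval J \<Longrightarrow> J \<in> sets lebesgue"
  unfolding admissible_interval_def by auto

lemma AE_lebesgue_on_iff:
  "S \<in> sets lebesgue \<Longrightarrow> (AE t in lebesgue_on S. P t) \<longleftrightarrow> (AE t in lebesgue. t \<in> S \<longrightarrow> P t)"
  by (subst AE_restrict_space_iff) auto

lemma bochner_integrable_indicator:
  fixes f :: "real \<Rightarrow> 'x::banach"
  assumes "S \<in> sets lebesgue" "bochner_integrable lebesgue f"
  shows "bochner_integrable lebesgue (\<lambda>x. indicator S x *\<^sub>R f x)"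
  by (rule completion.bochner_integrable_bilinear[OF bounded_bilinear_scaleR, where C=1])
    (use assms in \<open>auto split: split_indicator\<close>)

lemma L1loc_iff:
  fixes f :: "real \<Rightarrow> 'x::banach"
  assumes J: "admissible_interval J"
  shows "f \<in> L1loc J \<longleftrightarrow> (\<forall>a b. {a..b} \<subseteq> J \<longrightarrow> bochner_integrable lebesgue (\<lambda>x. indicator {a..b} x *\<^sub>R f x))"
proof
  assume "f \<in> L1loc J"
  then show "\<forall>a b. {a..b} \<subseteq> J \<longrightarrow> bochner_integrable lebesgue (\<lambda>x. indicator {a..b} x *\<^sub>R f x)"
    by (auto simp: L1loc_def simp flip: has_bochner_lebesgue_on)
next
  assume *: "\<forall>a b. {a..b} \<subseteq> J \<longrightarrow> bochner_integrable lebesgue (\<lambda>x. indicator {a..b} x *\<^sub>R f x)"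
  show "f \<in> L1loc J"
    unfolding L1loc_def
  proof (intro CollectI allI impI)
    fix S assume S: "compact S \<and> S \<subseteq> J"
    then obtain a b where ab: "S \<subseteq> {a..b}" "{a..b} \<subseteq> J" using compact_subset_interval[OF J, of S] by metis
    have Sm: "S \<in> sets lebesgue" using S by (simp add: borel_compact)
    have "bochner_integrable lebesgue (\<lambda>x. indicator S x *\<^sub>R (indicator {a..b} x *\<^sub>R f x))"
      by (rule bochner_integrable_indicator[OF Sm]) (use * ab in blast)
    moreover have "(\<lambda>x. indicator S x *\<^sub>R (indicator {a..b} x *\<^sub>R f x)) = (\<lambda>x. indicator S x *\<^sub>R f x)"
      using ab by (intro ext) (auto split: split_indicator)
    ultimately show "bochner_integrable (lebesgue_on S) f" by (simp add: has_bochner_lebesgue_on[OF Sm])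
  qed
qed

lemma L1locD:
  fixes f :: "real \<Rightarrow> 'x::banach"
  assumes "admissible_interval J" "f \<in> L1loc J" "{a..b} \<subseteq> J"
  shows "bochner_integrable lebesgue (\<lambda>x. indicator {a..b} x *\<^sub>R f x)"
  using assms L1loc_iff by blast

lemma L1loc_cong_AE:
  fixes f g :: "real \<Rightarrow> 'x::banach"
  assumes J: "admissible_interval J" and f: "f \<in> L1loc J" and ae: "AE t in lebesgue_on J. f t = g t"
  shows "g \<in> L1loc J"
  unfolding L1loc_iff[OF J]
proof (intro allI impI)
  fix a b assume ab: "{a..b} \<subseteq> J"
  have "AE t in lebesgue. indicator {a..b} t *\<^sub>R f t = indicator {a..b} t *\<^sub>R g t"
    using ae[unfolded AE_lebesgue_on_iff[OF admissible_sets[OF J]]]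
    by eventually_elim (use ab in \<open>auto split: split_indicator\<close>)
  then show "bochner_integrable lebesgue (\<lambda>x. indicator {a..b} x *\<^sub>R g x)"
    by (rule completion.bochner_integrable_cong_AE[OF L1locD[OF J f ab]])
qed

lemma continuous_on_L1loc:
  fixes f :: "real \<Rightarrow> 'x::banach"
  assumes J: "admissible_interval J" and "continuous_on J f"
  shows "f \<in> L1loc J"
  unfolding L1loc_iff[OF J]
  using assms by (auto intro!: bochner_integrable_continuous_compact intro: continuous_on_subset)

text \<open>
  This holds for nonintegrable \<open>f\<close> as well, both integrals being \<open>0\<close> by convention; so formulas for means
  can be derived for all functions.
\<close>

lemma bochner_integral_real_isometry:
  fixes f :: "real \<Rightarrow> 'x::banach" and t c :: real
  assumes c: "\<bar>c\<bar> = 1"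
  shows "bochner_integral lebesgue (\<lambda>x. f (t + c * x)) = bochner_integral lebesgue f"
proof (cases "bochner_integrable lebesgue f")
  case True
  then show ?thesis by (intro completion.bochner_integral_eq has_bochner_real_isometry c)
next
  case False
  have cc: "c * c = 1" using c by (metis abs_mult_self_eq mult_1)
  have "\<not> bochner_integrable lebesgue (\<lambda>x. f (t + c * x))"
  proof
    assume "bochner_integrable lebesgue (\<lambda>x. f (t + c * x))"
    from has_bochner_real_isometry[OF c this, of "- c * t"]
    have "bochner_integrable lebesgue (\<lambda>x. f (t + c * (- c * t + c * x)))" by blast
    moreover have "t + c * (- c * t + c * x) = x" for x
      using cc by (simp add: right_diff_distrib mult.assoc[symmetric])
    ultimately show False using False by simp
  qed
  then show ?thesis using False by (auto simp: bochner_integral_def)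
qed

lemma Mean_eq_integral_0:
  fixes f :: "real \<Rightarrow> 'x::banach"
  assumes "0 < h"
  shows "Mean h f t = (1 / h) *\<^sub>R bochner_integral lebesgue (\<lambda>s. indicator {0..h} s *\<^sub>R f (t + s))"
  using assms by (simp add: Mean_def bochner_integral_lebesgue_on)

lemma Mean_eq_integral:
  fixes f :: "real \<Rightarrow> 'x::banach"
  assumes "0 < h"
  shows "Mean h f t = (1 / h) *\<^sub>R bochner_integral lebesgue (\<lambda>x. indicator {t..t+h} x *\<^sub>R f x)"
proof -
  have "(\<lambda>s. indicator {0..h} s *\<^sub>R f (t + s)) = (\<lambda>s. indicator {t..t+h} (t + 1 * s) *\<^sub>R f (t + 1 * s))"
    by (intro ext) (auto split: split_indicator)
  then show ?thesis
    using bochner_integral_real_isometry[of 1 "\<lambda>x. indicator {t..t+h} x *\<^sub>R f x" t]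
    by (simp add: Mean_eq_integral_0[OF assms])
qed

lemma Mean_minus:
  fixes f :: "real \<Rightarrow> 'x::banach"
  assumes "0 < h"
  shows "Mean (- h) f t = Mean h f (t - h)"
proof -
  have "Mean (- h) f t = (1 / h) *\<^sub>R bochner_integral lebesgue (\<lambda>s. indicator {- h..0} s *\<^sub>R f (t + s))"
    using assms by (simp add: Mean_def bochner_integral_lebesgue_on)
  also have "(\<lambda>s. indicator {- h..0} s *\<^sub>R f (t + s)) = (\<lambda>s. indicator {t - h..t - h + h} (t + 1 * s) *\<^sub>R f (t + 1 * s))"
    by (intro ext) (auto split: split_indicator)
  also have "bochner_integral lebesgue \<dots> = bochner_integral lebesgue (\<lambda>x. indicator {t - h..t - h + h} x *\<^sub>R f x)"
    by (rule bochner_integral_real_isometry[where f = "\<lambda>x. indicator {t - h..t - h + h} x *\<^sub>R f x"]) simp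
  finally show ?thesis by (simp add: Mean_eq_integral[OF assms])
qed

lemma Mean_cong_AE:
  fixes f g :: "real \<Rightarrow> 'x::banach"
  assumes J: "admissible_interval J" and ae: "AE t in lebesgue_on J. f t = g t" and t: "t \<in> J" and h: "0 < h"
  shows "Mean h f t = Mean h g t"
proof -
  have "AE x in lebesgue. indicator {t..t+h} x *\<^sub>R f x = indicator {t..t+h} x *\<^sub>R g x"
    using ae[unfolded AE_lebesgue_on_iff[OF admissible_sets[OF J]]]
    by eventually_elim (use admissible_upward[OF J t] in \<open>auto split: split_indicator\<close>)
  then show ?thesis unfolding Mean_eq_integral[OF h]
    by (simp only: completion.bochner_integral_cong_AE)
qed

text \<open>
  The indicator functions of the moving interval converge except at its two end points, so bounded
  convergence applies on one compact interval that contains all of the moving ones.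
\<close>

lemma Mean_continuous_on:
  fixes f :: "real \<Rightarrow> 'x::banach"
  assumes J: "admissible_interval J" and f: "f \<in> L1loc J" and h: "0 < h"
  shows "continuous_on J (Mean h f)"
  unfolding continuous_on_sequentially
proof (intro allI ballI impI, elim conjE)
  fix x a assume a: "a \<in> J" and x: "\<forall>n. x n \<in> J" and lim: "x \<longlonglongrightarrow> a"
  have "compact (insert a (range x))" using lim by (rule compact_sequence_with_limit)
  then obtain c d where cd: "insert a (range x) \<subseteq> {c..d}" "{c..d} \<subseteq> J"
    using compact_subset_interval[OF J, of "insert a (range x)"] a x by auto
  have "{c..d+h} \<subseteq> J" using cd by (intro admissible_Icc_subset[OF J]) auto
  note int = L1locD[OF J f this]
  define F where "F x = indicator {c..d+h} x *\<^sub>R f x" for x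
  have eq: "(\<lambda>t. indicator {y..y+h} t *\<^sub>R f t) = (\<lambda>t. (indicator {y..y+h} t :: real) *\<^sub>R F t)" if "y \<in> insert a (range x)" for y
    using that cd h unfolding F_def by (intro ext) (force split: split_indicator)
  have "(\<lambda>n. bochner_integral lebesgue (\<lambda>t. (indicator {x n..x n+h} t :: real) *\<^sub>R F t))
     \<longlonglongrightarrow> bochner_integral lebesgue (\<lambda>t. (indicator {a..a+h} t :: real) *\<^sub>R F t)"
  proof (rule completion.bochner_bounded_convergence[OF bounded_bilinear_scaleR, where C=1])
    show "bochner_integrable lebesgue F" using int unfolding F_def .
    have "AE t in lebesgue. t \<noteq> a \<and> t \<noteq> a + h"
      by (intro AE_conjI AE_completion AE_lborel_singleton)
    then show "AE t in lebesgue. (\<lambda>n. indicator {x n..x n+h} t :: real) \<longlonglongrightarrow> indicator {a..a+h} t"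
    proof eventually_elim
      case (elim t)
      then consider "t < a" | "a < t" "t < a + h" | "a + h < t" by linarith
      then have "\<forall>\<^sub>F n in sequentially. (indicator {x n..x n+h} t :: real) = indicator {a..a+h} t"
      proof cases
        case 1
        then have "\<forall>\<^sub>F n in sequentially. t < x n" using order_tendstoD(1)[OF lim] by blast
        then show ?thesis by eventually_elim (use 1 in auto)
      next
        case 2
        then have "\<forall>\<^sub>F n in sequentially. x n < t" "\<forall>\<^sub>F n in sequentially. t - h < x n"
          using order_tendstoD(2)[OF lim, of t] order_tendstoD(1)[OF lim, of "t - h"] by auto
        then show ?thesis by eventually_elim (use 2 in auto)
      next
        case 3
        then have "\<forall>\<^sub>F n in sequentially. x n < t - h" using order_tendstoD(2)[OF lim, of "t - h"] by auto
        then show ?thesis by eventually_elim (use 3 h in auto)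
      qed
      then show ?case by (rule tendsto_eventually)
    qed
  qed (auto split: split_indicator intro!: borel_measurable_indicator)
  then have "(\<lambda>n. (1/h) *\<^sub>R bochner_integral lebesgue (\<lambda>t. indicator {x n..x n+h} t *\<^sub>R f t))
     \<longlonglongrightarrow> (1/h) *\<^sub>R bochner_integral lebesgue (\<lambda>t. indicator {a..a+h} t *\<^sub>R f t)"
    by (intro tendsto_scaleR tendsto_const) (simp add: eq)
  then show "(Mean h f \<circ> x) \<longlonglongrightarrow> Mean h f a"
    by (simp add: Mean_eq_integral[OF h] o_def)
qed

lemma Mean_L1loc:
  fixes f :: "real \<Rightarrow> 'x::banach"
  assumes J: "admissible_interval J" and f: "f \<in> L1loc J" and h: "0 < h"
  shows "Mean h f \<in> L1loc J"
  by (intro continuous_on_L1loc[OF J] Mean_continuous_on[OF J f h])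

lemma integrable_indicator_Icc: "integrable lebesgue (indicator {a..b::real} :: real \<Rightarrow> real)"
  using lmeasurable_iff_integrable[of "{a..b}"] by simp

lemma Mean_const:
  assumes "0 < h"
  shows "Mean h (\<lambda>_. c :: 'x::banach) t = c"
proof -
  have "has_bochner lebesgue (\<lambda>x. indicator {t..t+h} x *\<^sub>R c) (measure lebesgue {t..t+h} *\<^sub>R c)"
    using has_bochner_linear_image[OF bounded_linear_scaleR_left integrable_indicator_Icc, of t "t+h" c]
    by (simp del: measure_completion)
  then show ?thesis using assms by (simp add: Mean_eq_integral completion.bochner_integral_eq)
qed

text \<open>
  The mean over \<open>[0, h]\<close> averages the difference of two functions.  Applied to two translates of \<open>g\<close> it
  bounds the modulus of continuity of \<open>M\<^sub>h g\<close>; applied to a translate and a constant it bounds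
  \<open>M\<^sub>h g - g\<close>.
\<close>

lemma Mean_dist_le:
  fixes f g :: "real \<Rightarrow> 'x::banach"
  assumes h: "0 < h"
    and f: "bochner_integrable lebesgue (\<lambda>s. indicator {0..h} s *\<^sub>R f (t + s))"
    and g: "bochner_integrable lebesgue (\<lambda>s. indicator {0..h} s *\<^sub>R g (u + s))"
    and e: "\<And>s. 0 \<le> s \<Longrightarrow> s \<le> h \<Longrightarrow> norm (f (t + s) - g (u + s)) \<le> e"
  shows "norm (Mean h f t - Mean h g u) \<le> e"
proof -
  have int: "integrable lebesgue (\<lambda>s. e * indicator {0..h} s :: real)"
    by (intro integrable_mult_right integrable_indicator_Icc)
  have "norm (bochner_integral lebesgue (\<lambda>s. indicator {0..h} s *\<^sub>R f (t + s))
      - bochner_integral lebesgue (\<lambda>s. indicator {0..h} s *\<^sub>R g (u + s))) \<le> (\<integral>s. e * indicator {0..h} s \<partial>lebesgue)"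
    by (rule completion.bochner_integral_dist_le[OF f g int])
      (use e in \<open>auto split: split_indicator\<close>)
  also have "\<dots> = e * h" using h by simp
  finally show ?thesis unfolding Mean_eq_integral_0[OF h] scaleR_diff_right[symmetric] norm_scaleR
    using h by (simp add: divide_le_eq)
qed

lemma L1loc_shift_integrable:
  fixes f :: "real \<Rightarrow> 'x::banach"
  assumes J: "admissible_interval J" and f: "f \<in> L1loc J" and t: "t \<in> J"
  shows "bochner_integrable lebesgue (\<lambda>s. indicator {0..h} s *\<^sub>R f (t + s))"
proof -
  have "bochner_integrable lebesgue (\<lambda>s. indicator {t..t+h} (t + 1 * s) *\<^sub>R f (t + 1 * s))"
    using has_bochner_real_isometry[of 1 "\<lambda>x. indicator {t..t+h} x *\<^sub>R f x" t]
      L1locD[OF J f admissible_Icc_subset[OF J t]] by auto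
  moreover have "(\<lambda>s. indicator {t..t+h} (t + 1 * s) *\<^sub>R f (t + 1 * s)) = (\<lambda>s. indicator {0..h} s *\<^sub>R f (t + s))"
    by (intro ext) (auto split: split_indicator)
  ultimately show ?thesis by simp
qed

lemma Mean_uniformly_continuous_on:
  fixes g :: "real \<Rightarrow> 'x::banach"
  assumes J: "admissible_interval J" and g: "uniformly_continuous_on J g" and h: "0 < h"
  shows "uniformly_continuous_on J (Mean h g)"
  unfolding uniformly_continuous_on_def
proof (intro allI impI)
  fix e :: real assume e: "0 < e"
  obtain d where d: "0 < d" "\<And>x y. x \<in> J \<Longrightarrow> y \<in> J \<Longrightarrow> dist y x < d \<Longrightarrow> dist (g y) (g x) < e / 2"
    using g e unfolding uniformly_continuous_on_def by (meson half_gt_zero)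
  have gl: "g \<in> L1loc J" by (intro continuous_on_L1loc J uniformly_continuous_imp_continuous g)
  have half: "dist (Mean h g y) (Mean h g x) \<le> e / 2" if xy: "x \<in> J" "y \<in> J" "dist y x < d" for x y
    unfolding dist_norm
  proof (rule Mean_dist_le[OF h L1loc_shift_integrable[OF J gl xy(2)] L1loc_shift_integrable[OF J gl xy(1)]])
    fix s :: real assume "0 \<le> s"
    then have "x + s \<in> J" "y + s \<in> J" using xy admissible_upward[OF J] by auto
    from d(2)[OF this] xy show "norm (g (y + s) - g (x + s)) \<le> e / 2" by (simp add: dist_norm)
  qed
  have "dist (Mean h g y) (Mean h g x) < e" if "x \<in> J" "y \<in> J" "dist y x < d" for x y
    using half[OF that] e by linarith
  with d(1) show "\<exists>d>0. \<forall>x\<in>J. \<forall>y\<in>J. dist y x < d \<longrightarrow> dist (Mean h g y) (Mean h g x) < e" by blast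
qed

lemma Mean_uniform_limit:
  fixes g :: "real \<Rightarrow> 'x::banach"
  assumes J: "admissible_interval J" and g: "uniformly_continuous_on J g"
  shows "uniform_limit J (\<lambda>i. Mean (1 / real (Suc i)) g) g sequentially"
proof (rule uniform_limitI)
  fix e :: real assume e: "0 < e"
  obtain d where d: "0 < d" "\<And>x y. x \<in> J \<Longrightarrow> y \<in> J \<Longrightarrow> dist y x < d \<Longrightarrow> dist (g y) (g x) < e / 2"
    using g e unfolding uniformly_continuous_on_def by (meson half_gt_zero)
  have gl: "g \<in> L1loc J" by (intro continuous_on_L1loc J uniformly_continuous_imp_continuous g)
  have "\<forall>\<^sub>F i in sequentially. 1 / real (Suc i) < d"
    using order_tendstoD(2)[OF LIMSEQ_Suc[OF lim_1_over_n] d(1)] by simp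
  then show "\<forall>\<^sub>F i in sequentially. \<forall>x\<in>J. dist (Mean (1 / real (Suc i)) g x) (g x) < e"
  proof eventually_elim
    case (elim i)
    define h where "h = 1 / real (Suc i)"
    have h: "0 < h" "h < d" using elim by (auto simp: h_def)
    have half: "dist (Mean h g x) (g x) \<le> e / 2" if x: "x \<in> J" for x
    proof -
      have "norm (Mean h g x - Mean h (\<lambda>_. g x) 0) \<le> e / 2"
      proof (rule Mean_dist_le[OF h(1) L1loc_shift_integrable[OF J gl x]])
        show "bochner_integrable lebesgue (\<lambda>s. indicator {0..h} s *\<^sub>R g x)"
          by (rule bochner_integrable_continuous_compact) auto
        fix s assume "0 \<le> s" "s \<le> h"
        then show "norm (g (x + s) - g x) \<le> e / 2"
          using d(2)[of x "x + s"] admissible_upward[OF J x, of "x + s"] x h by (simp add: dist_norm)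
      qed
      then show ?thesis by (simp add: Mean_const[OF h(1)] dist_norm)
    qed
    have "dist (Mean h g x) (g x) < e" if "x \<in> J" for x
      using half[OF that] e by linarith
    then show ?case unfolding h_def by blast
  qed
qed

lemma Mean_Cu:
  fixes f :: "real \<Rightarrow> 'x::banach"
  assumes J: "admissible_interval J" and f: "f \<in> Cu J" and h: "0 < h"
  shows "Mean h f \<in> Cu J"
proof -
  obtain g where g: "uniformly_continuous_on J g" "AE t in lebesgue_on J. f t = g t"
    using f by (auto simp: Cu_def)
  have "AE t in lebesgue_on J. Mean h f t = Mean h g t"
    by (rule AE_I2) (use Mean_cong_AE[OF J g(2) _ h] in \<open>simp add: space_restrict_space\<close>)
  then show ?thesis using Mean_uniformly_continuous_on[OF J g(1) h] by (auto simp: Cu_def)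
qed

section \<open>Function classes\<close>

lemma regular_dist_cong_AE:
  fixes sc :: "'k::{real_normed_field,euclidean_space} \<Rightarrow> 'x::banach \<Rightarrow> 'x"
  assumes J: "admissible_interval J" and ae: "AE t in lebesgue_on J. f t = g t"
  shows "regular_dist J sc f = regular_dist J sc g"
proof -
  have "bochner_integral (lebesgue_on J) (\<lambda>t. sc (\<phi> t) (f t)) = bochner_integral (lebesgue_on J) (\<lambda>t. sc (\<phi> t) (g t))" for \<phi>
    unfolding bochner_integral_lebesgue_on[OF admissible_sets[OF J]]
  proof (rule completion.bochner_integral_cong_AE)
    show "AE x in lebesgue. indicator J x *\<^sub>R sc (\<phi> x) (f x) = indicator J x *\<^sub>R sc (\<phi> x) (g x)"
      using ae[unfolded AE_lebesgue_on_iff[OF admissible_sets[OF J]]]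
      by eventually_elim (auto split: split_indicator)
  qed
  then show ?thesis unfolding regular_dist_def by simp
qed

lemma fun_part_subset_L1loc: "fun_part J sc A \<subseteq> L1loc J"
  by (cases A) auto

lemma fun_part_cong_AE:
  assumes J: "admissible_interval J" and A: "is_class J sc A"
    and f: "f \<in> fun_part J sc A" and ae: "AE t in lebesgue_on J. f t = g t"
  shows "g \<in> fun_part J sc A"
proof -
  have "g \<in> L1loc J" using L1loc_cong_AE[OF J _ ae] f fun_part_subset_L1loc by blast
  then show ?thesis
    using A f ae regular_dist_cong_AE[OF J ae, of sc] by (cases A) (auto simp: ae_closed_def)
qed

lemma M_pow_0: "M_pow J sc 0 B = fun_part J sc B"
  by (simp add: M_pow_def)

lemma M_pow_Suc: "M_pow J sc (Suc j) B = {f \<in> L1loc J. \<forall>h>0. Mean h f \<in> M_pow J sc j B}"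
  by (simp add: M_pow_def)

text \<open>
  If \<open>f\<close> is almost everywhere equal to the uniformly continuous \<open>g\<close>, its means are means of \<open>g\<close>, belong to
  \<open>A\<close> by induction, and converge uniformly to \<open>g\<close>.
\<close>

lemma M_pow_Int_Cu_subset:
  assumes J: "admissible_interval J" and A: "is_class J sc A" and uc: "uniformly_closed J sc A"
  shows "M_pow J sc n A \<inter> Cu J \<subseteq> fun_part J sc A"
proof (induction n)
  case 0
  then show ?case by (simp add: M_pow_0)
next
  case (Suc n)
  show ?case
  proof
    fix f assume f: "f \<in> M_pow J sc (Suc n) A \<inter> Cu J"
    obtain g where g: "uniformly_continuous_on J g" "AE t in lebesgue_on J. f t = g t"
      using f by (auto simp: Cu_def)
    have "Mean h f \<in> fun_part J sc A" if "0 < h" for h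
      using Suc f Mean_Cu[OF J _ that] that by (auto simp: M_pow_Suc)
    then have "Mean (1 / real (Suc i)) f \<in> fun_part J sc A" for i by simp
    moreover have "uniform_limit J (\<lambda>i. Mean (1 / real (Suc i)) f) g sequentially"
      using Mean_uniform_limit[OF J g(1)]
      by (rule uniform_limit_cong'[THEN iffD1, rotated 2])
        (auto simp: Mean_cong_AE[OF J g(2)])
    ultimately have "g \<in> fun_part J sc A"
      using uc[unfolded uniformly_closed_def, rule_format, of "\<lambda>i. Mean (1 / real (Suc i)) f" g] by blast
    moreover have "AE t in lebesgue_on J. g t = f t" using g(2) by eventually_elim simp
    ultimately show "f \<in> fun_part J sc A" by (rule fun_part_cong_AE[OF J A])
  qed
qed

lemma M_pow_Int_M_pow_Cu_subset:
  fixes sc :: "'k::{real_normed_field,euclidean_space} \<Rightarrow> 'x::banach \<Rightarrow> 'x"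
  assumes J: "admissible_interval J" and A: "is_class J sc A" and uc: "uniformly_closed J sc A"
  shows "M_pow J sc (n + k) A \<inter> M_pow J sc k (Funs (Cu J)) \<subseteq> M_pow J sc k A"
proof (induction k)
  case 0
  then show ?case using M_pow_Int_Cu_subset[OF J A uc, of n] by (auto simp: M_pow_0)
next
  case (Suc k)
  then show ?case by (auto simp: M_pow_Suc)
qed

section \<open>Means of test functions\<close>

lemma test_function_bounded_integrable:
  fixes \<phi> :: "real \<Rightarrow> 'k::euclidean_space"
  assumes c: "continuous_on UNIV \<phi>" and z: "\<And>t. t \<notin> {a..b} \<Longrightarrow> \<phi> t = 0"
  shows "\<phi> \<in> borel_measurable borel" "\<exists>C. \<forall>t. norm (\<phi> t) \<le> C" "integrable lebesgue \<phi>"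
proof -
  show m: "\<phi> \<in> borel_measurable borel" using c by (rule borel_measurable_continuous_onI)
  have "bounded (\<phi> ` {a..b})"
    by (intro compact_imp_bounded compact_continuous_image continuous_on_subset[OF c]) auto
  then obtain C where C: "\<And>t. t \<in> {a..b} \<Longrightarrow> norm (\<phi> t) \<le> C" unfolding bounded_iff by blast
  have "norm (\<phi> t) \<le> max C 0" for t
    using C[of t] z[of t] by (cases "t \<in> {a..b}") auto
  then show "\<exists>C. \<forall>t. norm (\<phi> t) \<le> C" by blast
  have "integrable (lebesgue_on {a..b}) \<phi>"
    by (intro continuous_imp_integrable_real continuous_on_subset[OF c]) auto
  then have "integrable lebesgue (\<lambda>x. indicator {a..b} x *\<^sub>R \<phi> x)"
    by (subst (asm) integrable_restrict_space) auto
  moreover have "(\<lambda>x. indicator {a..b} x *\<^sub>R \<phi> x) = \<phi>"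
    using z by (intro ext) (auto split: split_indicator)
  ultimately show "integrable lebesgue \<phi>" by simp
qed

lemma Mean_eq_HK_integral:
  fixes \<phi> :: "real \<Rightarrow> 'k::euclidean_space"
  assumes h: "0 < h" and c: "continuous_on UNIV \<phi>"
  shows "Mean h \<phi> t = (1 / h) *\<^sub>R integral {0..h} (\<lambda>s. \<phi> (t + s))"
proof -
  have "continuous_on {0..h} (\<lambda>s. \<phi> (t + s))"
    by (intro continuous_on_compose2[OF c] continuous_intros) auto
  then have "integrable (lebesgue_on {0..h}) (\<lambda>s. \<phi> (t + s))"
    by (rule continuous_imp_integrable_real)
  then have "bochner_integral (lebesgue_on {0..h}) (\<lambda>s. \<phi> (t + s)) = integral {0..h} (\<lambda>s. \<phi> (t + s))"
    unfolding bochner_integral_eq_library by (rule lebesgue_integral_eq_integral) simp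
  then show ?thesis using h by (simp add: Mean_def)
qed

text \<open>
  Differentiation under the integral sign gives \<open>(M\<^sub>h \<phi>)' = M\<^sub>h \<phi>'\<close>.
\<close>

lemma smooth_Mean:
  fixes \<phi> :: "real \<Rightarrow> 'k::{real_normed_field,euclidean_space}"
  assumes h: "0 < h" and \<phi>: "smooth \<phi>"
  shows "smooth (Mean h \<phi>)"
proof (rule smooth_coinduct[where Q = "\<lambda>g. \<exists>\<phi>. smooth \<phi> \<and> g = Mean h \<phi>"])
  fix g :: "real \<Rightarrow> 'k" assume "\<exists>\<phi>. smooth \<phi> \<and> g = Mean h \<phi>"
  then obtain \<phi> where \<phi>: "smooth \<phi>" and g: "g = Mean h \<phi>" by blast
  obtain \<phi>' where \<phi>': "smooth \<phi>'" "\<And>t. (\<phi> has_vector_derivative \<phi>' t) (at t)" using smooth_step[OF \<phi>] by blast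
  note c = smooth_continuous[OF \<phi>, of UNIV] and c' = smooth_continuous[OF \<phi>'(1), of UNIV]
  have "(g has_vector_derivative Mean h \<phi>' t) (at t)" for t
  proof -
    have "((\<lambda>t. integral (cbox 0 h) (\<lambda>s. \<phi> (t + s))) has_vector_derivative integral (cbox 0 h) (\<lambda>s. \<phi>' (t + s))) (at t within UNIV)"
    proof (rule leibniz_rule_vector_derivative)
      show "((\<lambda>t. \<phi> (t + s)) has_vector_derivative \<phi>' (t + s)) (at t within UNIV)" for t s
      proof -
        have "((\<lambda>t. t + s) has_vector_derivative 1) (at t)"
          by (auto intro!: derivative_eq_intros simp: has_real_derivative_iff_has_vector_derivative[symmetric])
        from vector_diff_chain_at[OF this \<phi>'(2)] show ?thesis by (simp add: o_def)
      qed
      show "(\<lambda>s. \<phi> (t + s)) integrable_on cbox 0 h" for t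
        by (intro integrable_continuous continuous_on_compose2[OF c] continuous_intros) auto
      show "continuous_on (UNIV \<times> cbox 0 h) (\<lambda>(t, s). \<phi>' (t + s))"
        unfolding split_beta by (intro continuous_on_compose2[OF c'] continuous_intros) auto
    qed auto
    from bounded_linear.has_vector_derivative[OF bounded_linear_scaleR_right this, of "1/h"]
    show ?thesis
      unfolding g by (simp add: Mean_eq_HK_integral[OF h c, abs_def] Mean_eq_HK_integral[OF h c'])
  qed
  then show "\<exists>g'. (\<exists>\<phi>. smooth \<phi> \<and> g' = Mean h \<phi>) \<and> (\<forall>t. (g has_vector_derivative g' t) (at t))"
    using \<phi>'(1) by blast
qed (use \<phi> in blast)

lemma Mean_eq_0:
  fixes \<phi> :: "real \<Rightarrow> 'x::banach"
  assumes h: "0 < h" and z: "\<And>s. s \<in> {t..t+h} \<Longrightarrow> \<phi> s = 0"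
  shows "Mean h \<phi> t = 0"
proof -
  have "(\<lambda>x. indicator {t..t+h} x *\<^sub>R \<phi> x) = (\<lambda>x. indicator {t..t+h} x *\<^sub>R 0)"
    using z by (intro ext) (auto split: split_indicator)
  then have "Mean h \<phi> t = Mean h (\<lambda>_. 0) t" by (simp only: Mean_eq_integral[OF h])
  then show ?thesis by (simp add: Mean_const[OF h])
qed

lemma smooth_translate: "smooth f \<Longrightarrow> smooth (\<lambda>t. f (t - h))"
  using smooth_affine[of f 1 "- h" 1] by simp

lemma smooth_reflect: "smooth f \<Longrightarrow> smooth (\<lambda>t. f (x - t))"
  using smooth_affine[of f 1 x "- 1"] by simp

lemma Mean_minus_smooth_support:
  fixes \<phi> :: "real \<Rightarrow> 'k::{real_normed_field,euclidean_space}"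
  assumes h: "0 < h" and \<phi>: "smooth \<phi>" and z: "\<And>t. t \<notin> {a..b} \<Longrightarrow> \<phi> t = 0"
  shows "smooth (Mean (- h) \<phi>)" and "\<And>t. t \<notin> {a..b+h} \<Longrightarrow> Mean (- h) \<phi> t = 0"
proof -
  show "smooth (Mean (- h) \<phi>)"
    using smooth_translate[OF smooth_Mean[OF h \<phi>], of h] by (simp add: Mean_minus[OF h, abs_def])
  show "Mean (- h) \<phi> t = 0" if "t \<notin> {a..b+h}" for t
    unfolding Mean_minus[OF h] by (rule Mean_eq_0[OF h], rule z) (use that h in auto)
qed

text \<open>
  The support is enlarged only to the right, and \<open>J\<close> is unbounded to the right.
\<close>

lemma Mean_minus_test_function:
  fixes \<phi> :: "real \<Rightarrow> 'k::{real_normed_field,euclidean_space}"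
  assumes J: "admissible_interval J" and h: "0 < h" and \<phi>: "\<phi> \<in> test_functions J"
  shows "Mean (- h) \<phi> \<in> test_functions J"
proof -
  obtain a b where ab: "a \<le> b" "{a..b} \<subseteq> J" "\<And>t. t \<notin> {a..b} \<Longrightarrow> \<phi> t = 0" "smooth \<phi>"
    using test_functionsD[OF J \<phi>] by metis
  have "{a..b+h} \<subseteq> J" using ab by (intro admissible_Icc_subset[OF J]) auto
  then show ?thesis
    by (intro test_functionsI[of _ a "b+h"] Mean_minus_smooth_support[OF h ab(4,3)]) auto
qed

section \<open>Regular distributions\<close>

lemma bounded_bilinear_banach_over:
  fixes sc :: "'k::{real_normed_field,euclidean_space} \<Rightarrow> 'x::banach \<Rightarrow> 'x"
  assumes "banach_over sc"
  shows "bounded_bilinear sc"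
proof -
  have vs: "vector_space sc" and re: "\<And>r x. sc (of_real r) x = r *\<^sub>R x"
    and nm: "\<And>c x. norm (sc c x) = norm c * norm x"
    using assms by (auto simp: banach_over_def)
  interpret vector_space sc by fact
  have [simp]: "sc (r *\<^sub>R a) b = r *\<^sub>R sc a b" for r a b
    by (simp add: scaleR_conv_of_real re[symmetric])
  have [simp]: "sc a (r *\<^sub>R b) = r *\<^sub>R sc a b" for r a b
    by (simp add: re[symmetric] mult.commute)
  show ?thesis
    by (rule bounded_bilinear.intro)
      (auto simp: scale_left_distrib scale_right_distrib nm intro!: exI[of _ 1])
qed

text \<open>
  On the support of a test function, \<open>f\<close> may be cut off to an integrable function.
\<close>

lemma regular_dist_eq:
  fixes sc :: "'k::{real_normed_field,euclidean_space} \<Rightarrow> 'x::banach \<Rightarrow> 'x"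
  assumes sc: "banach_over sc" and J: "admissible_interval J" and \<phi>: "\<phi> \<in> test_functions J"
    and ab: "{a..b} \<subseteq> J" and z: "\<And>t. t \<notin> {a..b} \<Longrightarrow> \<phi> t = 0"
  shows "regular_dist J sc f \<phi> = bochner_integral lebesgue (\<lambda>t. sc (\<phi> t) (indicator {a..b} t *\<^sub>R f t))"
proof -
  interpret sc: bounded_bilinear sc by (rule bounded_bilinear_banach_over[OF sc])
  have "(\<lambda>t. indicator J t *\<^sub>R sc (\<phi> t) (f t)) = (\<lambda>t. sc (\<phi> t) (indicator {a..b} t *\<^sub>R f t))"
    using z ab by (intro ext) (auto split: split_indicator simp: sc.zero_left sc.zero_right)
  then show ?thesis
    using \<phi> by (simp add: regular_dist_def bochner_integral_lebesgue_on[OF admissible_sets[OF J]])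
qed

lemma test_function_integrable:
  fixes sc :: "'k::{real_normed_field,euclidean_space} \<Rightarrow> 'x::banach \<Rightarrow> 'x"
  assumes sc: "banach_over sc" and \<phi>: "smooth \<phi>" "\<And>t. t \<notin> {a..b} \<Longrightarrow> \<phi> t = 0"
    and F: "bochner_integrable lebesgue F"
  shows "bochner_integrable lebesgue (\<lambda>t. sc (\<phi> t) (F t))"
proof -
  note t = test_function_bounded_integrable[OF smooth_continuous[OF \<phi>(1)] \<phi>(2)]
  obtain C where "\<forall>t. norm (\<phi> t) \<le> C" using t(2) by blast
  then show ?thesis
    using t(1) by (intro completion.bochner_integrable_bilinear[OF bounded_bilinear_banach_over[OF sc] _ _ F, of \<phi> C])
      (auto intro: borel_measurable_subalgebra)
qed

lemma regular_dist_in_distributions: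
  fixes sc :: "'k::{real_normed_field,euclidean_space} \<Rightarrow> 'x::banach \<Rightarrow> 'x"
  assumes sc: "banach_over sc" and J: "admissible_interval J" and f: "f \<in> L1loc J"
  shows "regular_dist J sc f \<in> distributions J sc"
  unfolding distributions_def
proof (intro CollectI conjI ballI allI impI)
  interpret sc: bounded_bilinear sc by (rule bounded_bilinear_banach_over[OF sc])
  interpret vs: vector_space sc using sc by (simp add: banach_over_def)
  show "regular_dist J sc f \<in> extensional (test_functions J)" by (simp add: regular_dist_def)
  show "regular_dist J sc f (\<lambda>t. \<alpha> * \<phi> t + \<beta> * \<psi> t) = sc \<alpha> (regular_dist J sc f \<phi>) + sc \<beta> (regular_dist J sc f \<psi>)"
    if \<phi>: "\<phi> \<in> test_functions J" and \<psi>: "\<psi> \<in> test_functions J" for \<phi> \<psi> \<alpha> \<beta>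
  proof -
    obtain a b where ab: "a \<le> b" "{a..b} \<subseteq> J" "\<And>t. t \<notin> {a..b} \<Longrightarrow> \<phi> t = 0" "smooth \<phi>"
      using test_functionsD[OF J \<phi>] by metis
    obtain c d where cd: "c \<le> d" "{c..d} \<subseteq> J" "\<And>t. t \<notin> {c..d} \<Longrightarrow> \<psi> t = 0" "smooth \<psi>"
      using test_functionsD[OF J \<psi>] by metis
    define l r where "l = min a c" and "r = max b d"
    have "l \<in> J" using ab(1,2) cd(1,2) by (auto simp: l_def min_def)
    then have lr: "{l..r} \<subseteq> J" by (rule admissible_Icc_subset[OF J])
    have z: "\<phi> t = 0" "\<psi> t = 0" if "t \<notin> {l..r}" for t
      using that by (auto intro!: ab(3) cd(3) simp: l_def r_def)
    have comb: "(\<lambda>t. \<alpha> * \<phi> t + \<beta> * \<psi> t) \<in> test_functions J"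
      by (rule test_functionsI[OF smooth_linear_combination[OF ab(4) cd(4)] _ lr]) (simp add: z)
    define F where "F t = indicator {l..r} t *\<^sub>R f t" for t
    have F: "bochner_integrable lebesgue F" unfolding F_def by (rule L1locD[OF J f lr])
    note i\<phi> = completion.has_bochner_bochner_integral[OF test_function_integrable[OF sc ab(4) z(1) F]]
    note i\<psi> = completion.has_bochner_bochner_integral[OF test_function_integrable[OF sc cd(4) z(2) F]]
    have "has_bochner lebesgue (\<lambda>t. sc \<alpha> (sc (\<phi> t) (F t)) + sc \<beta> (sc (\<psi> t) (F t)))
      (sc \<alpha> (bochner_integral lebesgue (\<lambda>t. sc (\<phi> t) (F t))) + sc \<beta> (bochner_integral lebesgue (\<lambda>t. sc (\<psi> t) (F t))))"
      by (intro completion.has_bochner_add has_bochner_bounded_linear[OF sc.bounded_linear_right] i\<phi> i\<psi>)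
    moreover have "(\<lambda>t. sc \<alpha> (sc (\<phi> t) (F t)) + sc \<beta> (sc (\<psi> t) (F t))) = (\<lambda>t. sc (\<alpha> * \<phi> t + \<beta> * \<psi> t) (F t))"
      by (simp add: vs.scale_left_distrib)
    ultimately show ?thesis
      using regular_dist_eq[OF sc J \<phi> lr z(1), of f] regular_dist_eq[OF sc J \<psi> lr z(2), of f]
        regular_dist_eq[OF sc J comb lr, of f] z
      by (simp add: F_def[symmetric] completion.bochner_integral_eq)
  qed
  show "(\<lambda>i. regular_dist J sc f (\<phi> i)) \<longlonglongrightarrow> 0"
    if "compact S \<and> S \<subseteq> J \<and> (\<forall>i::nat. \<phi> i \<in> test_functions J \<and> support (\<phi> i) \<subseteq> S)
      \<and> (\<forall>m. uniform_limit UNIV (\<lambda>i. vderiv m (\<phi> i)) (\<lambda>_. 0) sequentially)" for S \<phi>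
  proof -
    have S: "compact S" "S \<subseteq> J" using that by auto
    obtain a b where "a \<le> b" and ab: "S \<subseteq> {a..b}" "{a..b} \<subseteq> J" by (rule compact_subset_interval[OF J S])
    have \<phi>: "\<phi> i \<in> test_functions J" for i using that by blast
    then have sm: "smooth (\<phi> i)" for i by (auto simp: test_functions_def smooth_def)
    have sup: "support (\<phi> i) \<subseteq> S" for i using that by blast
    have z: "\<phi> i t = 0" if t: "t \<notin> {a..b}" for i t
      using sup t ab(1) closure_subset[of "{t. \<phi> i t \<noteq> 0}"] unfolding support_def by blast
    define F where "F t = indicator {a..b} t *\<^sub>R f t" for t
    have F: "bochner_integrable lebesgue F" unfolding F_def by (rule L1locD[OF J f ab(2)])
    have nF: "integrable lebesgue (\<lambda>t. norm (F t))" using F has_bochner_norm_finite by blast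
    define K where "K = (\<integral>t. norm (F t) \<partial>lebesgue)"
    have K: "0 \<le> K" unfolding K_def by simp
    have "uniform_limit UNIV \<phi> (\<lambda>_. 0) sequentially"
      using that[THEN conjunct2, THEN conjunct2, THEN conjunct2, rule_format, of 0] by (simp add: vderiv_def)
    show ?thesis
    proof (rule tendstoI)
      fix e :: real assume e: "0 < e"
      define d where "d = e / (K + 1)"
      have d: "0 < d" "d * K < e" using e K by (auto simp: d_def field_simps)
      have "\<forall>\<^sub>F i in sequentially. \<forall>t\<in>UNIV. dist (\<phi> i t) 0 < d"
        using uniform_limitD[OF \<open>uniform_limit UNIV \<phi> (\<lambda>_. 0) sequentially\<close> d(1)] .
      then show "\<forall>\<^sub>F i in sequentially. dist (regular_dist J sc f (\<phi> i)) 0 < e"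
      proof eventually_elim
        case (elim i)
        have "norm (bochner_integral lebesgue (\<lambda>t. sc (\<phi> i t) (F t))) \<le> (\<integral>t. d * norm (F t) \<partial>lebesgue)"
        proof (rule has_bochner_norm_le_integral)
          show "has_bochner lebesgue (\<lambda>t. sc (\<phi> i t) (F t)) (bochner_integral lebesgue (\<lambda>t. sc (\<phi> i t) (F t)))"
            by (rule completion.has_bochner_bochner_integral[OF test_function_integrable[OF sc sm z F]])
          have "norm (sc (\<phi> i t) (F t)) \<le> d * norm (F t)" for t
            using elim sc mult_right_mono[of "norm (\<phi> i t)" d "norm (F t)"]
            by (auto simp: banach_over_def intro: less_imp_le)
          then show "AE t in lebesgue. norm (sc (\<phi> i t) (F t)) \<le> d * norm (F t)" by simp
        qed (use nF in simp)
        also have "\<dots> < e" using d(2) by (simp add: K_def)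
        finally show ?case
          using regular_dist_eq[OF sc J \<phi> ab(2) z, of f i] by (simp add: F_def)
      qed
    qed
  qed
qed

section \<open>The mean of a regular distribution\<close>

lemma Mean_eq_Lebesgue_integral:
  fixes \<phi> :: "real \<Rightarrow> 'k::{banach,second_countable_topology}"
  assumes h: "0 < h" and \<phi>: "\<phi> \<in> borel_measurable borel"
  shows "Mean h \<phi> t = (1 / h) *\<^sub>R (\<integral>u. indicator {t..t+h} u *\<^sub>R \<phi> u \<partial>lborel)"
  unfolding Mean_eq_integral[OF h] bochner_integral_eq_library
  using \<phi> by (subst integral_completion) auto

text \<open>
  Both sides are iterated integrals of \<open>g(t) \<phi>(u)\<close> over the strip \<open>0 \<le> t - u \<le> h\<close>, divided by \<open>h\<close>.
\<close>

lemma integral_Mean_transpose_real: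
  fixes \<phi> :: "real \<Rightarrow> 'k::{banach,second_countable_topology}" and g :: "real \<Rightarrow> real"
  assumes h: "0 < h" and \<phi>: "integrable lborel \<phi>" and g: "integrable lborel g"
  shows "(\<integral>t. g t *\<^sub>R Mean (- h) \<phi> t \<partial>lborel) = (\<integral>u. Mean h g u *\<^sub>R \<phi> u \<partial>lborel)"
proof -
  have [measurable]: "\<phi> \<in> borel_measurable borel" "g \<in> borel_measurable borel" using \<phi> g by auto
  define f :: "real \<Rightarrow> real \<Rightarrow> 'k" where "f u t = (indicator {0..h} (t - u) * g t) *\<^sub>R \<phi> u" for u t
  have prod: "integrable (lborel \<Otimes>\<^sub>M lborel) (\<lambda>(u, t). g t *\<^sub>R \<phi> u)"
  proof (rule lborel_pair.Fubini_integrable)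
    show "(\<lambda>(u, t). g t *\<^sub>R \<phi> u) \<in> borel_measurable (lborel \<Otimes>\<^sub>M lborel)" by measurable
    show "integrable lborel (\<lambda>u. LINT t|lborel. norm (case (u, t) of (u, t) \<Rightarrow> g t *\<^sub>R \<phi> u))"
      using \<phi> by simp
    show "AE u in lborel. integrable lborel (\<lambda>t. case (u, t) of (u, t) \<Rightarrow> g t *\<^sub>R \<phi> u)"
      using g by simp
  qed
  have "integrable (lborel \<Otimes>\<^sub>M lborel) (\<lambda>(u, t). f u t)"
  proof (rule Bochner_Integration.integrable_bound[OF prod])
    show "(\<lambda>(u, t). f u t) \<in> borel_measurable (lborel \<Otimes>\<^sub>M lborel)"
      unfolding f_def indicator_def atLeastAtMost_iff by measurable
    show "AE x in lborel \<Otimes>\<^sub>M lborel. norm (case x of (u, t) \<Rightarrow> f u t) \<le> norm (case x of (u, t) \<Rightarrow> g t *\<^sub>R \<phi> u)"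
      by (auto simp: f_def indicator_def)
  qed
  then have F: "(\<integral>t. (\<integral>u. f u t \<partial>lborel) \<partial>lborel) = (\<integral>u. (\<integral>t. f u t \<partial>lborel) \<partial>lborel)"
    by (rule lborel_pair.Fubini_integral)
  have 1: "g t *\<^sub>R Mean (- h) \<phi> t = (1 / h) *\<^sub>R (\<integral>u. f u t \<partial>lborel)" for t
  proof -
    have "f u t = g t *\<^sub>R (indicator {t - h..t - h + h} u *\<^sub>R \<phi> u)" for u
      by (auto simp: f_def split: split_indicator)
    then have "(\<integral>u. f u t \<partial>lborel) = g t *\<^sub>R (\<integral>u. indicator {t - h..t - h + h} u *\<^sub>R \<phi> u \<partial>lborel)"
      by (simp only: integral_scaleR_right)
    then show ?thesis by (simp add: Mean_minus[OF h] Mean_eq_Lebesgue_integral[OF h])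
  qed
  have 2: "Mean h g u *\<^sub>R \<phi> u = (1 / h) *\<^sub>R (\<integral>t. f u t \<partial>lborel)" for u
  proof -
    have "f u t = (indicator {u..u + h} t *\<^sub>R g t) *\<^sub>R \<phi> u" for t
      by (auto simp: f_def split: split_indicator)
    moreover have "integrable lborel (\<lambda>t. indicator {u..u + h} t *\<^sub>R g t)"
      using g by (intro integrable_mult_indicator) auto
    ultimately show ?thesis by (simp add: Mean_eq_Lebesgue_integral[OF h])
  qed
  show ?thesis unfolding 1 2 using F by simp
qed

lemma Mean_norm_diff_le:
  fixes F G :: "real \<Rightarrow> 'x::banach"
  assumes h: "0 < h" and F: "bochner_integrable lebesgue F" and G: "bochner_integrable lebesgue G"
  shows "norm (Mean h F t - Mean h G t) \<le> (1 / h) * (\<integral>x. norm (F x - G x) \<partial>lebesgue)"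
proof -
  have "norm (bochner_integral lebesgue (\<lambda>x. indicator {t..t+h} x *\<^sub>R F x) - bochner_integral lebesgue (\<lambda>x. indicator {t..t+h} x *\<^sub>R G x))
      \<le> (\<integral>x. norm (F x - G x) \<partial>lebesgue)"
    by (intro completion.bochner_integral_dist_le bochner_integrable_indicator F G completion.integrable_norm_diff AE_I2)
      (auto split: split_indicator)
  then show ?thesis
    unfolding Mean_eq_integral[OF h] scaleR_diff_right[symmetric] norm_scaleR using h by (simp add: divide_right_mono)
qed

text \<open>
  Fubini's theorem for a vector valued \<open>F\<close>, by density.  For \<open>F = 1\<^sub>E c\<close> both sides are the vector \<open>c\<close> times
  the sides of the scalar identity; a Borel function that agrees almost everywhere with \<open>1\<^sub>E\<close> is used
  there, because the product measure is formed from Borel sets.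
\<close>

lemma integral_Mean_transpose:
  fixes sc :: "'k::{real_normed_field,euclidean_space} \<Rightarrow> 'x::banach \<Rightarrow> 'x"
  assumes sc: "banach_over sc" and h: "0 < h"
    and \<phi>: "smooth \<phi>" "\<And>t. t \<notin> {a..b} \<Longrightarrow> \<phi> t = 0" and F: "bochner_integrable lebesgue F"
  shows "bochner_integral lebesgue (\<lambda>t. sc (Mean (- h) \<phi> t) (F t)) = bochner_integral lebesgue (\<lambda>t. sc (\<phi> t) (Mean h F t))"
proof -
  interpret sc: bounded_bilinear sc by (rule bounded_bilinear_banach_over[OF sc])
  have nm: "norm (sc c x) = norm c * norm x" for c x using sc by (simp add: banach_over_def)
  have UN: "admissible_interval UNIV" by (simp add: admissible_interval_def)
  have M\<phi>: "smooth (Mean (- h) \<phi>)" "\<And>t. t \<notin> {a..b+h} \<Longrightarrow> Mean (- h) \<phi> t = 0"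
    by (rule Mean_minus_smooth_support(1)[OF h \<phi>], assumption)
      (rule Mean_minus_smooth_support(2)[OF h \<phi>], assumption+)
  note t = test_function_bounded_integrable[OF smooth_continuous[OF \<phi>(1)] \<phi>(2)]
  note tM = test_function_bounded_integrable[OF smooth_continuous[OF M\<phi>(1)] M\<phi>(2)]
  obtain C where C: "\<And>t. norm (\<phi> t) \<le> C" using t(2) by blast
  obtain D where D: "\<And>t. norm (Mean (- h) \<phi> t) \<le> D" using tM(2) by blast
  have D0: "0 \<le> D" using D norm_ge_zero order_trans by blast
  have loc: "G \<in> L1loc UNIV" if "bochner_integrable lebesgue G" for G :: "real \<Rightarrow> 'x"
    unfolding L1loc_iff[OF UN] using bochner_integrable_indicator[OF _ that] by simp
  have i1: "bochner_integrable lebesgue (\<lambda>t. sc (Mean (- h) \<phi> t) (G t))"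
    if "bochner_integrable lebesgue G" for G
    by (rule test_function_integrable[OF sc M\<phi> that])
  have i2: "bochner_integrable lebesgue (\<lambda>t. sc (\<phi> t) (Mean h G t))"
    if "bochner_integrable lebesgue G" for G
  proof -
    have "continuous_on {a..b} (\<lambda>t. sc (\<phi> t) (Mean h G t))"
      by (rule sc.continuous_on[OF smooth_continuous[OF \<phi>(1)]
            continuous_on_subset[OF Mean_continuous_on[OF UN loc[OF that] h]]]) simp
    then have "bochner_integrable lebesgue (\<lambda>t. indicator {a..b} t *\<^sub>R sc (\<phi> t) (Mean h G t))"
      by (intro bochner_integrable_continuous_compact) auto
    moreover have "(\<lambda>t. indicator {a..b} t *\<^sub>R sc (\<phi> t) (Mean h G t)) = (\<lambda>t. sc (\<phi> t) (Mean h G t))"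
      using \<phi>(2) by (intro ext) (auto split: split_indicator simp: sc.zero_left)
    ultimately show ?thesis by simp
  qed
  show ?thesis using F
  proof (induction rule: completion.bochner_integrable_induct_real)
    case (indicator E c)
    have intE: "integrable lebesgue (indicator E :: real \<Rightarrow> real)" using indicator by auto
    then obtain g where g[measurable]: "g \<in> borel_measurable borel" and gE: "AE x in lborel. (indicator E x :: real) = g x"
      using completion_ex_borel_measurable_real[of "indicator E" lborel] by auto
    have gE': "AE x in lebesgue. (indicator E x :: real) = g x" by (rule AE_completion[OF gE])
    have gl: "integrable lebesgue g"
      by (rule integrable_cong_AE_imp[OF intE measurable_completion])
        (use gE' in \<open>auto simp: eq_commute\<close>)
    then have gi: "integrable lborel g" by (simp add: integrable_completion)
    have Mg: "continuous_on UNIV (Mean h g)"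
      by (rule Mean_continuous_on[OF UN _ h])
        (use gl in \<open>auto simp: L1loc_iff[OF UN] has_bochner_eq_library has_bochner_integral_iff intro!: integrable_mult_indicator[where 'b = real, simplified]\<close>)
    have \<phi>i: "integrable lborel \<phi>" using t(1,3) by (simp add: integrable_completion)
    have "bochner_integral lebesgue (\<lambda>t. sc (Mean (- h) \<phi> t) (indicator E t *\<^sub>R c))
        = bochner_integral lebesgue (\<lambda>t. sc (g t *\<^sub>R Mean (- h) \<phi> t) c)"
      by (rule completion.bochner_integral_cong_AE) (use gE' in \<open>eventually_elim, simp add: sc.scaleR_left sc.scaleR_right\<close>)
    also have "\<dots> = sc (\<integral>t. g t *\<^sub>R Mean (- h) \<phi> t \<partial>lebesgue) c"
    proof (rule completion.bochner_integral_eq, rule has_bochner_linear_image[OF sc.bounded_linear_left])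
      show "integrable lebesgue (\<lambda>t. g t *\<^sub>R Mean (- h) \<phi> t)"
      proof (rule Bochner_Integration.integrable_bound[where f = "\<lambda>t. D * g t"])
        have "norm (g t *\<^sub>R Mean (- h) \<phi> t) \<le> norm (D * g t)" for t
          using mult_left_mono[OF D[of t], of "\<bar>g t\<bar>"] D0 by (simp add: abs_mult mult.commute)
        then show "AE t in lebesgue. norm (g t *\<^sub>R Mean (- h) \<phi> t) \<le> norm (D * g t)" by simp
        show "(\<lambda>t. g t *\<^sub>R Mean (- h) \<phi> t) \<in> borel_measurable lebesgue"
          using tM(1) by (intro measurable_completion) simp
      qed (use gl in simp)
    qed
    also have "(\<integral>t. g t *\<^sub>R Mean (- h) \<phi> t \<partial>lebesgue) = (\<integral>t. g t *\<^sub>R Mean (- h) \<phi> t \<partial>lborel)"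
      using tM(1) by (intro integral_completion) simp
    also have "\<dots> = (\<integral>u. Mean h g u *\<^sub>R \<phi> u \<partial>lborel)"
      by (rule integral_Mean_transpose_real[OF h \<phi>i gi])
    also have "\<dots> = (\<integral>u. Mean h g u *\<^sub>R \<phi> u \<partial>lebesgue)"
    proof (rule integral_completion[symmetric])
      from Mg have "Mean h g \<in> borel_measurable borel" by (rule borel_measurable_continuous_onI)
      then show "(\<lambda>u. Mean h g u *\<^sub>R \<phi> u) \<in> borel_measurable lborel" using t(1) by simp
    qed
    also have "sc \<dots> c = bochner_integral lebesgue (\<lambda>t. sc (\<phi> t) (Mean h (\<lambda>x. indicator E x *\<^sub>R c) t))"
    proof -
      have "Mean h (\<lambda>x. indicator E x *\<^sub>R c) u = Mean h g u *\<^sub>R c" for u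
      proof -
        have "bochner_integral lebesgue (\<lambda>x. indicator {u..u+h} x *\<^sub>R (indicator E x *\<^sub>R c))
          = bochner_integral lebesgue (\<lambda>x. (indicator {u..u+h} x *\<^sub>R g x) *\<^sub>R c)"
          by (rule completion.bochner_integral_cong_AE) (use gE' in \<open>eventually_elim, simp\<close>)
        also have "\<dots> = (\<integral>x. indicator {u..u+h} x *\<^sub>R g x \<partial>lebesgue) *\<^sub>R c"
          using gl by (intro completion.bochner_integral_eq has_bochner_linear_image bounded_linear_scaleR_left
              integrable_mult_indicator) auto
        finally show ?thesis by (simp add: Mean_eq_integral[OF h] bochner_integral_eq_library)
      qed
      moreover have "has_bochner lebesgue (\<lambda>u. sc (Mean h g u *\<^sub>R \<phi> u) c) (sc (\<integral>u. Mean h g u *\<^sub>R \<phi> u \<partial>lebesgue) c)"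
      proof (rule has_bochner_linear_image[OF sc.bounded_linear_left])
        have "continuous_on {a..b} (\<lambda>u. Mean h g u *\<^sub>R \<phi> u)"
          by (rule continuous_on_scaleR[OF continuous_on_subset[OF Mg] smooth_continuous[OF \<phi>(1)]]) simp
        then have "bochner_integrable lebesgue (\<lambda>u. indicator {a..b} u *\<^sub>R (Mean h g u *\<^sub>R \<phi> u))"
          by (intro bochner_integrable_continuous_compact) auto
        moreover have "(\<lambda>u. indicator {a..b} u *\<^sub>R (Mean h g u *\<^sub>R \<phi> u)) = (\<lambda>u. Mean h g u *\<^sub>R \<phi> u)"
          using \<phi>(2) by (intro ext) (auto split: split_indicator)
        ultimately show "integrable lebesgue (\<lambda>u. Mean h g u *\<^sub>R \<phi> u)"
          by (simp add: has_bochner_eq_library has_bochner_integral_iff)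
      qed
      ultimately show ?thesis
        by (simp add: sc.scaleR_left sc.scaleR_right completion.bochner_integral_eq)
    qed
    finally show ?case .
  next
    case (add f1 f2)
    have m: "Mean h (\<lambda>x. f1 x + f2 x) t = Mean h f1 t + Mean h f2 t" for t
    proof -
      have "has_bochner lebesgue (\<lambda>x. indicator {t..t+h} x *\<^sub>R f1 x + indicator {t..t+h} x *\<^sub>R f2 x)
        (bochner_integral lebesgue (\<lambda>x. indicator {t..t+h} x *\<^sub>R f1 x) + bochner_integral lebesgue (\<lambda>x. indicator {t..t+h} x *\<^sub>R f2 x))"
        by (intro completion.has_bochner_add completion.has_bochner_bochner_integral bochner_integrable_indicator add) auto
      then have "bochner_integral lebesgue (\<lambda>x. indicator {t..t+h} x *\<^sub>R (f1 x + f2 x)) =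
          bochner_integral lebesgue (\<lambda>x. indicator {t..t+h} x *\<^sub>R f1 x) + bochner_integral lebesgue (\<lambda>x. indicator {t..t+h} x *\<^sub>R f2 x)"
        by (intro completion.bochner_integral_eq) (simp only: scaleR_add_right)
      then show ?thesis by (simp only: Mean_eq_integral[OF h] scaleR_add_right)
    qed
    have "bochner_integral lebesgue (\<lambda>t. sc (Mean (- h) \<phi> t) (f1 t + f2 t))
      = bochner_integral lebesgue (\<lambda>t. sc (Mean (- h) \<phi> t) (f1 t)) + bochner_integral lebesgue (\<lambda>t. sc (Mean (- h) \<phi> t) (f2 t))"
      unfolding sc.add_right
      by (intro completion.bochner_integral_eq completion.has_bochner_add completion.has_bochner_bochner_integral i1 add)
    moreover have "bochner_integral lebesgue (\<lambda>t. sc (\<phi> t) (Mean h (\<lambda>x. f1 x + f2 x) t))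
      = bochner_integral lebesgue (\<lambda>t. sc (\<phi> t) (Mean h f1 t)) + bochner_integral lebesgue (\<lambda>t. sc (\<phi> t) (Mean h f2 t))"
      unfolding sc.add_right m
      by (intro completion.bochner_integral_eq completion.has_bochner_add completion.has_bochner_bochner_integral i2 add)
    ultimately show ?case using add by simp
  next
    case (lim f)
    define K where "K = (\<integral>t. norm (\<phi> t) \<partial>lebesgue) / h"
    have K: "0 \<le> K" unfolding K_def using h by simp
    let ?L = "\<lambda>G. bochner_integral lebesgue (\<lambda>t. sc (Mean (- h) \<phi> t) (G t))"
    let ?R = "\<lambda>G. bochner_integral lebesgue (\<lambda>t. sc (\<phi> t) (Mean h G t))"
    have "norm (?L f - ?R f) \<le> 0 + e" if e: "0 < e" for e
    proof -
      \<comment> \<open>the left side is Lipschitz in mean with constant \<open>D\<close>, the right side with constant \<open>K\<close>\<close>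
      define d where "d = e / (D + K + 1)"
      have DK: "0 < D + K + 1" using D0 K by simp
      have d: "0 < d" using e DK by (simp add: d_def)
      obtain g where g: "bochner_integrable lebesgue g" "?L g = ?R g" "(\<integral>x. norm (f x - g x) \<partial>lebesgue) \<le> d"
        using lim(2)[OF d] by blast
      have nfg: "integrable lebesgue (\<lambda>x. norm (f x - g x))" by (rule completion.integrable_norm_diff[OF lim(1) g(1)])
      have "norm (?L f - ?L g) \<le> (\<integral>t. D * norm (f t - g t) \<partial>lebesgue)"
      proof (rule completion.bochner_integral_dist_le[OF i1[OF lim(1)] i1[OF g(1)]])
        show "AE t in lebesgue. norm (sc (Mean (- h) \<phi> t) (f t) - sc (Mean (- h) \<phi> t) (g t)) \<le> D * norm (f t - g t)"
          using D by (auto simp: sc.diff_right[symmetric] nm intro!: mult_right_mono)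
      qed (use nfg in simp)
      then have L: "norm (?L f - ?L g) \<le> D * d"
        using mult_left_mono[OF g(3) D0] by simp
      have "norm (?R f - ?R g) \<le> (\<integral>t. norm (\<phi> t) * ((1 / h) * d) \<partial>lebesgue)"
      proof (rule completion.bochner_integral_dist_le[OF i2[OF lim(1)] i2[OF g(1)]])
        have "norm (sc (\<phi> t) (Mean h f t) - sc (\<phi> t) (Mean h g t)) \<le> norm (\<phi> t) * ((1 / h) * d)" for t
        proof -
          have "norm (Mean h f t - Mean h g t) \<le> (1 / h) * d"
            using Mean_norm_diff_le[OF h lim(1) g(1), of t] g(3) h
            by (meson divide_nonneg_pos le_less_trans mult_left_mono order_trans zero_le_one)
          from mult_left_mono[OF this, of "norm (\<phi> t)"] show ?thesis
            by (simp add: sc.diff_right[symmetric] nm)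
        qed
        then show "AE t in lebesgue. norm (sc (\<phi> t) (Mean h f t) - sc (\<phi> t) (Mean h g t)) \<le> norm (\<phi> t) * ((1 / h) * d)"
          by simp
      qed (use t(3) in \<open>intro integrable_mult_left integrable_norm\<close>)
      also have "\<dots> = K * d" by (simp add: K_def)
      finally have R: "norm (?R f - ?R g) \<le> K * d" .
      have "norm (?L f - ?R f) = norm ((?L f - ?L g) - (?R f - ?R g))" using g(2) by simp
      also have "\<dots> \<le> D * d + K * d" using norm_triangle_ineq4[of "?L f - ?L g" "?R f - ?R g"] L R by linarith
      also have "\<dots> \<le> (D + K + 1) * d" using d by (simp add: distrib_right)
      also have "\<dots> = e" using DK by (simp add: d_def)
      finally show ?thesis by simp
    qed
    then have "norm (?L f - ?R f) \<le> 0" by (rule field_le_epsilon)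
    then show ?case by simp
  qed
qed

lemma Mean_dist_regular_dist:
  fixes sc :: "'k::{real_normed_field,euclidean_space} \<Rightarrow> 'x::banach \<Rightarrow> 'x"
  assumes sc: "banach_over sc" and J: "admissible_interval J" and f: "f \<in> L1loc J" and h: "0 < h"
  shows "Mean_dist J h (regular_dist J sc f) = regular_dist J sc (Mean h f)"
proof (rule extensionalityI[of _ "test_functions J"])
  fix \<phi> :: "real \<Rightarrow> 'k" assume \<phi>: "\<phi> \<in> test_functions J"
  interpret sc: bounded_bilinear sc by (rule bounded_bilinear_banach_over[OF sc])
  obtain a b where ab: "a \<le> b" "{a..b} \<subseteq> J" "\<And>t. t \<notin> {a..b} \<Longrightarrow> \<phi> t = 0" "smooth \<phi>"
    using test_functionsD[OF J \<phi>] by metis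
  have abh: "{a..b+h} \<subseteq> J" using ab by (intro admissible_Icc_subset[OF J]) auto
  define F where "F t = indicator {a..b+h} t *\<^sub>R f t" for t
  have F: "bochner_integrable lebesgue F" unfolding F_def by (rule L1locD[OF J f abh])
  have MF: "Mean h F t = Mean h f t" if "t \<in> {a..b}" for t
  proof -
    have "(\<lambda>x. indicator {t..t+h} x *\<^sub>R F x) = (\<lambda>x. indicator {t..t+h} x *\<^sub>R f x)"
      using that by (intro ext) (auto simp: F_def split: split_indicator)
    then show ?thesis by (simp add: Mean_eq_integral[OF h])
  qed
  have "Mean_dist J h (regular_dist J sc f) \<phi> = regular_dist J sc f (Mean (- h) \<phi>)"
    using \<phi> by (simp add: Mean_dist_def)
  also have "\<dots> = bochner_integral lebesgue (\<lambda>t. sc (Mean (- h) \<phi> t) (F t))"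
    unfolding F_def
    by (rule regular_dist_eq[OF sc J Mean_minus_test_function[OF J h \<phi>] abh Mean_minus_smooth_support(2)[OF h ab(4,3)]])
  also have "\<dots> = bochner_integral lebesgue (\<lambda>t. sc (\<phi> t) (Mean h F t))"
    by (rule integral_Mean_transpose[OF sc h ab(4,3) F])
  also have "(\<lambda>t. sc (\<phi> t) (Mean h F t)) = (\<lambda>t. sc (\<phi> t) (indicator {a..b} t *\<^sub>R Mean h f t))"
    using MF ab(3) by (intro ext) (auto split: split_indicator simp: sc.zero_left sc.zero_right)
  also have "bochner_integral lebesgue \<dots> = regular_dist J sc (Mean h f) \<phi>"
    by (rule regular_dist_eq[OF sc J \<phi> ab(2,3), symmetric])
  finally show "Mean_dist J h (regular_dist J sc f) \<phi> = regular_dist J sc (Mean h f) \<phi>" .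
qed (auto simp: Mean_dist_def regular_dist_def)

section \<open>A locally integrable function is determined by its distribution\<close>

text \<open>
  Let \<open>s\<close> be a simple function close to \<open>f\<close> in mean, with value \<open>y\<close> on \<open>E y\<close>.  As \<open>f\<close> has integral \<open>0\<close>
  over \<open>E y\<close>, the number \<open>\<parallel>y\<parallel> |E y| = \<parallel>\<integral> 1\<^bsub>E y\<^esub> (s - f)\<parallel>\<close> is at most the integral of
  \<open>\<parallel>s - f\<parallel>\<close> over \<open>E y\<close>.  Summation over \<open>y\<close> shows that \<open>s\<close> is small in mean, and hence so is \<open>f\<close>.
\<close>

lemma (in complete_measure) bochner_AE_eq_0I:
  fixes f :: "'a \<Rightarrow> 'x::banach"
  assumes f: "bochner_integrable M f"
    and z: "\<And>E. E \<in> sets M \<Longrightarrow> bochner_integral M (\<lambda>x. indicator E x *\<^sub>R f x) = 0"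
  shows "AE x in M. f x = 0"
proof -
  have nf: "integrable M (\<lambda>x. norm (f x))" using f has_bochner_norm_finite by blast
  have "(\<integral>x. norm (f x) \<partial>M) \<le> 0 + e" if e: "0 < e" for e
  proof -
    obtain s where s: "simple_integrable M s" and fs: "(\<integral>\<^sup>+x. norm (f x - s x) \<partial>M) \<le> ennreal (e / 2)"
      using f e has_bochner_approx_simple[of M f _ "e / 2"] by (metis half_gt_zero)
    have hs: "has_bochner M s (simple_bint M s)" by (rule has_bochner_simple[OF s])
    then have ints: "bochner_integrable M s" by blast
    have nfs: "integrable M (\<lambda>x. norm (f x - s x))" by (rule integrable_norm_diff[OF f ints])
    have fs': "(\<integral>x. norm (f x - s x) \<partial>M) \<le> e / 2"
      using fs e by (simp add: nn_integral_eq_integral[OF nfs])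
    have sf: "simple_function M s" using s by (auto elim: Bochner_Integration.simple_bochner_integrable.cases)
    have fin: "finite (s ` space M)" using sf by (simp add: simple_function_def)
    define E where "E y = {x\<in>space M. s x = y}" for y
    have E: "E y \<in> sets M" for y
      using simple_functionD(2)[OF sf, of "{y}"] unfolding E_def by (simp add: vimage_def Int_def conj_commute)
    have ns: "integrable M (\<lambda>x. norm (s x))" using has_bochner_norm_finite[OF hs] .
    have sum1: "(\<Sum>y\<in>s ` space M. indicator (E y) x * r) = r" if "x \<in> space M" for x and r :: real
    proof -
      have "(\<Sum>y\<in>s ` space M. indicator (E y) x * r) = (\<Sum>y\<in>s ` space M. if y = s x then r else 0)"
        using that by (intro sum.cong) (auto simp: E_def)
      then show ?thesis using that fin by simp
    qed
    have int: "integrable M (\<lambda>x. indicator (E y) x * g x)" if "integrable M g" for y and g :: "'a \<Rightarrow> real"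
      using integrable_mult_indicator[OF E that] by simp
    have split: "(\<integral>x. g x \<partial>M) = (\<Sum>y\<in>s ` space M. \<integral>x. indicator (E y) x * g x \<partial>M)" if "integrable M g" for g :: "'a \<Rightarrow> real"
    proof -
      have "(\<integral>x. g x \<partial>M) = (\<integral>x. (\<Sum>y\<in>s ` space M. indicator (E y) x * g x) \<partial>M)"
        by (intro Bochner_Integration.integral_cong refl sum1[symmetric])
      also have "\<dots> = (\<Sum>y\<in>s ` space M. \<integral>x. indicator (E y) x * g x \<partial>M)"
        by (intro Bochner_Integration.integral_sum int that)
      finally show ?thesis .
    qed
    have le: "(\<integral>x. indicator (E y) x * norm (s x) \<partial>M) \<le> (\<integral>x. indicator (E y) x * norm (f x - s x) \<partial>M)" for y
    proof (cases "y = 0")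
      case True
      then have "(\<integral>x. indicator (E y) x * norm (s x) \<partial>M) = (\<integral>x. 0 \<partial>M)"
        by (intro Bochner_Integration.integral_cong) (auto simp: E_def split: split_indicator)
      then show ?thesis by (simp add: integral_nonneg_AE)
    next
      case False
      have iE: "integrable M (\<lambda>x. indicator (E y) x :: real)"
      proof -
        have "integrable M (\<lambda>x. (indicator (E y) x * norm (s x)) / norm y)" using int[OF ns] by simp
        moreover have "(\<lambda>x. (indicator (E y) x * norm (s x)) / norm y) = indicator (E y)"
          using False by (intro ext) (auto simp: E_def split: split_indicator)
        ultimately show ?thesis by simp
      qed
      have y: "has_bochner M (\<lambda>x. indicator (E y) x *\<^sub>R y) ((\<integral>x. indicator (E y) x \<partial>M) *\<^sub>R y)"
        by (rule has_bochner_linear_image[OF bounded_linear_scaleR_left iE])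
      have "bochner_integrable M (\<lambda>x. indicator (E y) x *\<^sub>R f x)"
        by (rule bochner_integrable_bilinear[OF bounded_bilinear_scaleR _ _ f, where C = 1])
          (use E in \<open>auto split: split_indicator\<close>)
      then have f0: "has_bochner M (\<lambda>x. indicator (E y) x *\<^sub>R f x) 0"
        using has_bochner_bochner_integral z[OF E] by fastforce
      have "(\<integral>x. indicator (E y) x * norm (s x) \<partial>M) = (\<integral>x. indicator (E y) x * norm y \<partial>M)"
        by (intro Bochner_Integration.integral_cong) (auto simp: E_def split: split_indicator)
      also have "\<dots> = norm ((\<integral>x. indicator (E y) x \<partial>M) *\<^sub>R y - 0)"
        using integral_nonneg_AE[of "indicator (E y)" M] by (simp add: abs_of_nonneg)
      also have "\<dots> \<le> (\<integral>x. indicator (E y) x * norm (f x - s x) \<partial>M)"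
      proof (rule has_bochner_norm_le_integral[OF has_bochner_diff[OF y f0] int[OF nfs]])
        show "AE x in M. norm (indicator (E y) x *\<^sub>R y - indicator (E y) x *\<^sub>R f x) \<le> indicator (E y) x * norm (f x - s x)"
          by (auto simp: E_def norm_minus_commute split: split_indicator)
      qed
      finally show ?thesis .
    qed
    have "(\<integral>x. norm (s x) \<partial>M) \<le> (\<integral>x. norm (f x - s x) \<partial>M)"
      unfolding split[OF ns] split[OF nfs] by (intro sum_mono le)
    moreover have "(\<integral>x. norm (f x) \<partial>M) \<le> (\<integral>x. norm (f x - s x) + norm (s x) \<partial>M)"
    proof (rule integral_mono[OF nf Bochner_Integration.integrable_add[OF nfs ns]])
      show "norm (f x) \<le> norm (f x - s x) + norm (s x)" for x
        using norm_triangle_ineq[of "f x - s x" "s x"] by simp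
    qed
    moreover have "(\<integral>x. norm (f x - s x) + norm (s x) \<partial>M) = (\<integral>x. norm (f x - s x) \<partial>M) + (\<integral>x. norm (s x) \<partial>M)"
      by (rule Bochner_Integration.integral_add[OF nfs ns])
    ultimately show ?thesis using fs' by linarith
  qed
  then have "(\<integral>x. norm (f x) \<partial>M) \<le> 0" by (rule field_le_epsilon)
  moreover have "0 \<le> (\<integral>x. norm (f x) \<partial>M)" by (intro integral_nonneg_AE) simp
  ultimately have "(\<integral>x. norm (f x) \<partial>M) = 0" by simp
  then show ?thesis using integral_nonneg_eq_0_iff_AE[OF nf] by simp
qed

text \<open>
  The Borel sets over which \<open>f\<close> has integral \<open>0\<close> contain the compact intervals and form a Dynkin
  system.  The hypothesis on the whole line is used for complements.
\<close>

lemma bochner_AE_eq_0I_intervals: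
  fixes f :: "real \<Rightarrow> 'x::banach"
  assumes f: "bochner_integrable lebesgue f"
    and tot: "bochner_integral lebesgue f = 0"
    and z: "\<And>a b. bochner_integral lebesgue (\<lambda>x. indicator {a..b} x *\<^sub>R f x) = 0"
  shows "AE x in lebesgue. f x = 0"
proof (rule completion.bochner_AE_eq_0I[OF f])
  note int = bochner_integrable_indicator[OF _ f]
  have borel: "bochner_integral lebesgue (\<lambda>x. indicator B x *\<^sub>R f x) = 0" if "B \<in> sets borel" for B
    using that
  proof (induction rule: borel_set_induct)
    case empty
    then show ?case using z[of 1 0] by simp
  next
    case (interval a b)
    then show ?case using z by simp
  next
    case (compl A)
    have "has_bochner lebesgue (\<lambda>x. f x - indicator A x *\<^sub>R f x)
      (bochner_integral lebesgue f - bochner_integral lebesgue (\<lambda>x. indicator A x *\<^sub>R f x))"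
      using compl by (intro completion.has_bochner_diff completion.has_bochner_bochner_integral f int) auto
    moreover have "(\<lambda>x. f x - indicator A x *\<^sub>R f x) = (\<lambda>x. indicator (- A) x *\<^sub>R f x)"
      by (intro ext) (auto split: split_indicator)
    ultimately show ?case using compl tot by (simp add: completion.bochner_integral_eq Compl_eq_Diff_UNIV)
  next
    case (union A)
    have "bochner_integral lebesgue (\<lambda>x. indicator (\<Union>i<n. A i) x *\<^sub>R f x) = 0" for n
    proof (induction n)
      case 0
      then show ?case using z[of 1 0] by simp
    next
      case (Suc n)
      have m: "(\<Union>i<n. A i) \<in> sets lebesgue" "A n \<in> sets lebesgue" using union(2) by auto
      have "has_bochner lebesgue (\<lambda>x. indicator (\<Union>i<n. A i) x *\<^sub>R f x + indicator (A n) x *\<^sub>R f x)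
        (bochner_integral lebesgue (\<lambda>x. indicator (\<Union>i<n. A i) x *\<^sub>R f x) + bochner_integral lebesgue (\<lambda>x. indicator (A n) x *\<^sub>R f x))"
        by (intro completion.has_bochner_add completion.has_bochner_bochner_integral int m)
      moreover have "(\<lambda>x. indicator (\<Union>i<n. A i) x *\<^sub>R f x + indicator (A n) x *\<^sub>R f x) = (\<lambda>x. indicator (\<Union>i<Suc n. A i) x *\<^sub>R f x)"
      proof
        fix x
        have "x \<notin> A i" if "x \<in> A n" "i < n" for i
          using that disjoint_family_onD[OF union(1), of i n] by auto
        then show "indicator (\<Union>i<n. A i) x *\<^sub>R f x + indicator (A n) x *\<^sub>R f x = indicator (\<Union>i<Suc n. A i) x *\<^sub>R f x"
          by (auto simp: lessThan_Suc split: split_indicator)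
      qed
      ultimately show ?case using Suc union(3)[of n] by (simp add: completion.bochner_integral_eq)
    qed
    moreover have "(\<lambda>n. bochner_integral lebesgue (\<lambda>x. (indicator (\<Union>i<n. A i) x :: real) *\<^sub>R f x))
        \<longlonglongrightarrow> bochner_integral lebesgue (\<lambda>x. (indicator (\<Union>i. A i) x :: real) *\<^sub>R f x)"
    proof (rule completion.bochner_bounded_convergence[OF bounded_bilinear_scaleR _ _ _ _ _ f, where C = 1])
      show "AE x in lebesgue. (\<lambda>n. indicator (\<Union>i<n. A i) x :: real) \<longlonglongrightarrow> indicator (\<Union>i. A i) x"
        by (intro AE_I2 LIMSEQ_indicator_UN)
    qed (use union(2) in \<open>auto split: split_indicator intro!: borel_measurable_indicator sets.finite_UN sets.countable_UN\<close>)
    ultimately show ?case by (simp add: LIMSEQ_const_iff)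
  qed
  fix E :: "real set" assume E: "E \<in> sets lebesgue"
  have "AE x in lebesgue. x \<notin> null_part lborel E"
    using AE_notin_null_part[OF E] by (rule AE_completion)
  then have "AE x in lebesgue. indicator (main_part lborel E) x *\<^sub>R f x = indicator E x *\<^sub>R f x"
    by eventually_elim (use main_part_null_part_Un[OF E] in \<open>auto split: split_indicator\<close>)
  then have "bochner_integral lebesgue (\<lambda>x. indicator (main_part lborel E) x *\<^sub>R f x) = bochner_integral lebesgue (\<lambda>x. indicator E x *\<^sub>R f x)"
    by (rule completion.bochner_integral_cong_AE)
  then show "bochner_integral lebesgue (\<lambda>x. indicator E x *\<^sub>R f x) = 0"
    using borel[of "main_part lborel E"] main_part_sets[OF E] by simp
qed

text \<open>
  Testing against steep bumps, which tend to the indicator function of an interval, shows that \<open>f - g\<close>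
  has integral \<open>0\<close> over all compact intervals in \<open>J\<close>.  Openness of \<open>J\<close> lets countably many of
  these intervals cover \<open>J\<close>.
\<close>

lemma regular_dist_eq_imp_AE_eq:
  fixes sc :: "'k::{real_normed_field,euclidean_space} \<Rightarrow> 'x::banach \<Rightarrow> 'x"
  assumes sc: "banach_over sc" and J: "admissible_interval J" and opn: "open J"
    and f: "f \<in> L1loc J" and g: "g \<in> L1loc J"
    and eq: "regular_dist J sc f = regular_dist J sc g"
  shows "AE t in lebesgue_on J. f t = g t"
proof -
  have re: "sc (of_real r) x = r *\<^sub>R x" for r x using sc by (simp add: banach_over_def)
  define u where "u t = f t - g t" for t
  have diff: "has_bochner lebesgue (\<lambda>t. r t *\<^sub>R (indicator {a..b} t *\<^sub>R u t))
      (bochner_integral lebesgue (\<lambda>t. r t *\<^sub>R (indicator {a..b} t *\<^sub>R f t)) - bochner_integral lebesgue (\<lambda>t. r t *\<^sub>R (indicator {a..b} t *\<^sub>R g t)))"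
    if ab: "{a..b} \<subseteq> J" and r: "r \<in> borel_measurable lebesgue" "\<And>t. norm (r t) \<le> 1" for a b and r :: "real \<Rightarrow> real"
    unfolding u_def scaleR_diff_right
    by (intro completion.has_bochner_diff completion.has_bochner_bochner_integral
        completion.bochner_integrable_bilinear[OF bounded_bilinear_scaleR r] L1locD[OF J f ab] L1locD[OF J g ab])
  have u: "bochner_integrable lebesgue (\<lambda>t. indicator {a..b} t *\<^sub>R u t)" if "{a..b} \<subseteq> J" for a b
    using diff[OF that, of "\<lambda>_. 1"] by auto
  have u0: "bochner_integral lebesgue (\<lambda>t. indicator {a..b} t *\<^sub>R u t) = 0" if ab: "{a..b} \<subseteq> J" for a b
  proof -
    have m: "bump (real n) a b \<in> borel_measurable lebesgue" for n
      by (rule measurable_completion)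
        (use borel_measurable_continuous_onI[OF smooth_continuous[OF smooth_bump]] in simp)
    have n: "norm (bump (real n) a b t) \<le> 1" for n t using bump_bounds[of "real n" a b t] by simp
    have "bochner_integral lebesgue (\<lambda>t. bump (real n) a b t *\<^sub>R (indicator {a..b} t *\<^sub>R u t)) = 0" for n
    proof -
      have \<phi>: "(\<lambda>t. of_real (bump (real n) a b t) :: 'k) \<in> test_functions J"
        by (rule bump_test_function[OF _ ab]) simp
      have z: "of_real (bump (real n) a b t) = (0 :: 'k)" if "t \<notin> {a..b}" for t
        using bump_eq_0[of "real n" t a b] that by auto
      have "regular_dist J sc f (\<lambda>t. of_real (bump (real n) a b t)) = regular_dist J sc g (\<lambda>t. of_real (bump (real n) a b t))"
        using eq by simp
      then have "bochner_integral lebesgue (\<lambda>t. bump (real n) a b t *\<^sub>R (indicator {a..b} t *\<^sub>R f t))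
          = bochner_integral lebesgue (\<lambda>t. bump (real n) a b t *\<^sub>R (indicator {a..b} t *\<^sub>R g t))"
        using regular_dist_eq[OF sc J \<phi> ab z, of f] regular_dist_eq[OF sc J \<phi> ab z, of g]
        unfolding re by (rule box_equals)
      then show ?thesis
        using completion.bochner_integral_eq[OF diff[OF ab m n]] by simp
    qed
    moreover have "(\<lambda>n. bochner_integral lebesgue (\<lambda>t. bump (real n) a b t *\<^sub>R (indicator {a..b} t *\<^sub>R u t)))
        \<longlonglongrightarrow> bochner_integral lebesgue (\<lambda>t. (indicator {a<..<b} t :: real) *\<^sub>R (indicator {a..b} t *\<^sub>R u t))"
    proof (rule completion.bochner_bounded_convergence[OF bounded_bilinear_scaleR m _ n _ _ u[OF ab]])
      show "AE t in lebesgue. (\<lambda>n. bump (real n) a b t) \<longlonglongrightarrow> indicator {a<..<b} t"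
        by (intro AE_I2 bump_tendsto_indicator)
    qed (auto split: split_indicator intro!: borel_measurable_indicator)
    ultimately have "bochner_integral lebesgue (\<lambda>t. (indicator {a<..<b} t :: real) *\<^sub>R (indicator {a..b} t *\<^sub>R u t)) = 0"
      by (simp add: LIMSEQ_const_iff)
    moreover have "AE t in lebesgue. (indicator {a<..<b} t :: real) *\<^sub>R (indicator {a..b} t *\<^sub>R u t) = indicator {a..b} t *\<^sub>R u t"
    proof -
      have "AE t in lebesgue. t \<noteq> a \<and> t \<noteq> b"
        by (intro AE_conjI AE_completion AE_lborel_singleton)
      then show ?thesis by eventually_elim (auto split: split_indicator)
    qed
    ultimately show ?thesis by (simp only: completion.bochner_integral_cong_AE)
  qed
  have loc: "AE t in lebesgue. t \<in> {c..d} \<longrightarrow> f t = g t" if cd: "{c..d} \<subseteq> J" for c d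
  proof -
    have "AE t in lebesgue. indicator {c..d} t *\<^sub>R u t = 0"
    proof (rule bochner_AE_eq_0I_intervals[OF u[OF cd] u0[OF cd]])
      fix a b
      have "(\<lambda>t. indicator {a..b} t *\<^sub>R (indicator {c..d} t *\<^sub>R u t)) = (\<lambda>t. indicator {max a c..min b d} t *\<^sub>R u t)"
        by (intro ext) (auto split: split_indicator)
      moreover have "{max a c..min b d} \<subseteq> J" using cd by (auto simp: subset_iff)
      ultimately show "bochner_integral lebesgue (\<lambda>t. indicator {a..b} t *\<^sub>R (indicator {c..d} t *\<^sub>R u t)) = 0"
        using u0 by simp
    qed
    then show ?thesis by eventually_elim (auto simp: u_def split: split_indicator_asm)
  qed
  have "AE t in lebesgue. \<forall>c\<in>\<rat>. \<forall>d\<in>\<rat>. {c..d} \<subseteq> J \<longrightarrow> t \<in> {c..d} \<longrightarrow> f t = g t"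
    by (intro AE_ball_countable' countable_rat) (use loc in \<open>auto intro!: AE_impI\<close>)
  then have "AE t in lebesgue. t \<in> J \<longrightarrow> f t = g t"
  proof eventually_elim
    case (elim t)
    show ?case
    proof
      assume t: "t \<in> J"
      obtain e where e: "0 < e" "ball t e \<subseteq> J" using opn t openE by blast
      obtain c where c: "c \<in> \<rat>" "t - e < c" "c < t" using Rats_dense_in_real[of "t - e" t] e by auto
      obtain d where d: "d \<in> \<rat>" "t < d" using Rats_dense_in_real[of t "t + 1"] by auto
      have "c \<in> J" using e(2) c by (auto simp: ball_def dist_norm subset_iff)
      then have "{c..d} \<subseteq> J" by (rule admissible_Icc_subset[OF J])
      then show "f t = g t" using elim c d by auto
    qed
  qed
  then show ?thesis by (simp add: AE_lebesgue_on_iff[OF admissible_sets[OF J]])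
qed

section \<open>Means of functions and means of distributions\<close>

lemma Mt_pow_0: "Mt_pow J sc 0 B = dist_part J sc B"
  by (simp add: Mt_pow_def)

lemma Mt_pow_Suc: "Mt_pow J sc (Suc j) B = {T \<in> distributions J sc. \<forall>h>0. Mean_dist J h T \<in> Mt_pow J sc j B}"
  by (simp add: Mt_pow_def)

text \<open>
  For a class of functions this uses both that a function is determined by its distribution and that the class
  respects equality almost everywhere.
\<close>

lemma regular_dist_in_dist_part_iff:
  fixes sc :: "'k::{real_normed_field,euclidean_space} \<Rightarrow> 'x::banach \<Rightarrow> 'x"
  assumes sc: "banach_over sc" and J: "admissible_interval J" and opn: "open J"
    and A: "is_class J sc A" and f: "f \<in> L1loc J"
  shows "regular_dist J sc f \<in> dist_part J sc A \<longleftrightarrow> f \<in> fun_part J sc A"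
proof (cases A)
  case (Funs F)
  show ?thesis
  proof
    assume "regular_dist J sc f \<in> dist_part J sc A"
    then obtain g where g: "g \<in> fun_part J sc A" "g \<in> L1loc J" "regular_dist J sc g = regular_dist J sc f"
      using Funs by auto
    have "AE t in lebesgue_on J. g t = f t"
      by (rule regular_dist_eq_imp_AE_eq[OF sc J opn g(2) f g(3)])
    then show "f \<in> fun_part J sc A" by (rule fun_part_cong_AE[OF J A g(1)])
  qed (use Funs in auto)
qed (use f in auto)

text \<open>
  On distributions of locally integrable functions, the two kinds of means agree at every step of the iteration.
\<close>

lemma M_pow_iff_Mt_pow:
  fixes sc :: "'k::{real_normed_field,euclidean_space} \<Rightarrow> 'x::banach \<Rightarrow> 'x"
  assumes sc: "banach_over sc" and J: "admissible_interval J" and opn: "open J"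
    and A: "is_class J sc A" and f: "f \<in> L1loc J"
  shows "f \<in> M_pow J sc j A \<longleftrightarrow> regular_dist J sc f \<in> Mt_pow J sc j A"
  using f
proof (induction j arbitrary: f)
  case 0
  then show ?case by (simp add: M_pow_0 Mt_pow_0 regular_dist_in_dist_part_iff[OF sc J opn A])
next
  case (Suc j)
  then show ?case
    by (simp add: M_pow_Suc Mt_pow_Suc regular_dist_in_distributions[OF sc J]
        Mean_dist_regular_dist[OF sc J] Mean_L1loc[OF J])
qed

lemma M_pow_subset_L1loc: "M_pow J sc j A \<subseteq> L1loc J"
  by (cases j) (auto simp: M_pow_0 M_pow_Suc dest: fun_part_subset_L1loc[THEN subsetD])

section \<open>Convolution with test functions\<close>

lemma test_function_reflect:
  assumes "\<phi> \<in> test_functions UNIV"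
  shows "(\<lambda>y. \<phi> (x - y)) \<in> test_functions UNIV"
proof -
  obtain a b where ab: "\<And>t. t \<notin> {a..b} \<Longrightarrow> \<phi> t = 0" "smooth \<phi>"
    using test_functionsD[OF _ assms] by (metis admissible_interval_def)
  show ?thesis
    by (rule test_functionsI[OF smooth_reflect[OF ab(2)], of "x - b" "x - a"]) (auto intro: ab(1))
qed

lemma Mean_reflect:
  fixes \<phi> :: "real \<Rightarrow> 'x::banach"
  assumes h: "0 < h"
  shows "Mean (- h) (\<lambda>y. \<phi> (x - y)) = (\<lambda>y. Mean h \<phi> (x - y))"
proof
  fix y
  have "(\<lambda>z. indicator {y - h..y - h + h} z *\<^sub>R \<phi> (x - z)) = (\<lambda>z. indicator {x - y..x - y + h} (x + (- 1) * z) *\<^sub>R \<phi> (x + (- 1) * z))"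
    by (intro ext) (auto split: split_indicator)
  then show "Mean (- h) (\<lambda>y. \<phi> (x - y)) y = Mean h \<phi> (x - y)"
    using bochner_integral_real_isometry[of "- 1" "\<lambda>z. indicator {x - y..x - y + h} z *\<^sub>R \<phi> z" x]
    by (simp add: Mean_minus[OF h] Mean_eq_integral[OF h])
qed

lemma Mean_test_function_UNIV:
  fixes \<phi> :: "real \<Rightarrow> 'k::{real_normed_field,euclidean_space}"
  assumes h: "0 < h" and \<phi>: "\<phi> \<in> test_functions UNIV"
  shows "Mean h \<phi> \<in> test_functions UNIV"
proof -
  obtain a b where ab: "\<And>t. t \<notin> {a..b} \<Longrightarrow> \<phi> t = 0" "smooth \<phi>"
    using test_functionsD[OF _ \<phi>] by (metis admissible_interval_def)
  show ?thesis
  proof (rule test_functionsI[OF smooth_Mean[OF h ab(2)], of "a - h" b])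
    show "Mean h \<phi> t = 0" if "t \<notin> {a - h..b}" for t
      by (rule Mean_eq_0[OF h], rule ab(1)) (use that h in auto)
  qed simp
qed

lemma conv_Mean_dist:
  fixes T :: "(real \<Rightarrow> 'k::{real_normed_field,euclidean_space}) \<Rightarrow> 'x::banach"
  assumes h: "0 < h" and \<phi>: "\<phi> \<in> test_functions UNIV"
  shows "conv (Mean_dist UNIV h T) \<phi> = conv T (Mean h \<phi>)"
  by (intro ext) (simp add: conv_def Mean_dist_def test_function_reflect[OF \<phi>] Mean_reflect[OF h])

lemma dist_conv_class_Mean_dist:
  fixes sc :: "'k::{real_normed_field,euclidean_space} \<Rightarrow> 'x::banach \<Rightarrow> 'x"
  assumes "T \<in> dist_conv_class sc A" and "0 < h" and "Mean_dist UNIV h T \<in> distributions UNIV sc"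
  shows "Mean_dist UNIV h T \<in> dist_conv_class sc A"
  using assms by (simp add: dist_conv_class_def conv_Mean_dist Mean_test_function_UNIV)

text \<open>
  The bump is positive on a set of positive measure, so it can be normalized.
\<close>

lemma bump_integral_pos:
  assumes ab: "a < b" and r: "0 < r"
  shows "integrable lebesgue (bump r a b)" "0 < (\<integral>t. bump r a b t \<partial>lebesgue)"
proof -
  show i: "integrable lebesgue (bump r a b)"
    using test_function_bounded_integrable(3)[OF smooth_continuous[OF smooth_bump], of a b r a b]
      bump_eq_0[of r _ a b] r by force
  have "(\<integral>t. bump r a b t \<partial>lebesgue) \<noteq> 0"
  proof
    assume "(\<integral>t. bump r a b t \<partial>lebesgue) = 0"
    then have "AE t in lebesgue. bump r a b t = 0"
      using integral_nonneg_eq_0_iff_AE[OF i] bump_bounds by simp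
    then have "AE t in lebesgue. t \<notin> {a<..<b}"
      by eventually_elim (use bump_pos[OF r] in \<open>auto simp: less_le\<close>)
    then have "{a<..<b} \<in> null_sets lebesgue"
      by (subst completion.null_sets_iff_AE) auto
    then show False using ab by (auto simp: null_sets_def)
  qed
  moreover have "0 \<le> (\<integral>t. bump r a b t \<partial>lebesgue)" using bump_bounds by (intro integral_nonneg_AE) simp
  ultimately show "0 < (\<integral>t. bump r a b t \<partial>lebesgue)" by simp
qed

definition mollifier :: "real \<Rightarrow> real \<Rightarrow> real" where
  "mollifier d t = bump 1 (- d) d t / (\<integral>t. bump 1 (- d) d t \<partial>lebesgue)"

lemma mollifier:
  assumes d: "0 < d"
  shows "smooth (mollifier d)" "\<And>t. t \<notin> {-d..d} \<Longrightarrow> mollifier d t = 0" "\<And>t. 0 \<le> mollifier d t"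
    "integrable lebesgue (mollifier d)" "(\<integral>t. mollifier d t \<partial>lebesgue) = 1"
proof -
  have ab: "- d < d" using d by simp
  note b = bump_integral_pos[OF ab zero_less_one]
  let ?c = "\<integral>t. bump 1 (- d) d t \<partial>lebesgue"
  have "smooth (\<lambda>t. (1 / ?c) *\<^sub>R bump 1 (- d) d (0 + 1 * t))"
    by (intro smooth_affine smooth_bump)
  then show "smooth (mollifier d)" by (simp add: mollifier_def[abs_def])
  show "mollifier d t = 0" if "t \<notin> {-d..d}" for t
    using bump_eq_0[of 1 t "- d" d] that by (auto simp: mollifier_def)
  show "0 \<le> mollifier d t" for t using b(2) bump_bounds by (simp add: mollifier_def)
  show "integrable lebesgue (mollifier d)" using b(1) by (simp add: mollifier_def[abs_def])
  show "(\<integral>t. mollifier d t \<partial>lebesgue) = 1" using b by (simp add: mollifier_def[abs_def])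
qed

text \<open>
  The value at \<open>x\<close> is an average of \<open>g\<close> over a small interval around \<open>x\<close>, and the modulus of continuity of
  \<open>g\<close> does not depend on \<open>x\<close>.
\<close>

lemma conv_mollifier_uniform_limit:
  fixes sc :: "'k::{real_normed_field,euclidean_space} \<Rightarrow> 'x::banach \<Rightarrow> 'x"
  assumes sc: "banach_over sc" and g: "uniformly_continuous_on UNIV g"
  shows "uniform_limit UNIV (\<lambda>i. conv (regular_dist UNIV sc g) (\<lambda>t. of_real (mollifier (1 / real (Suc i)) t))) g sequentially"
proof (rule uniform_limitI)
  fix e :: real assume e: "0 < e"
  have UN: "admissible_interval UNIV" by (simp add: admissible_interval_def)
  have re: "sc (of_real r) x = r *\<^sub>R x" for r x using sc by (simp add: banach_over_def)
  have gl: "g \<in> L1loc UNIV" by (intro continuous_on_L1loc UN uniformly_continuous_imp_continuous g)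
  obtain d where d: "0 < d" "\<And>x y. dist y x < d \<Longrightarrow> dist (g y) (g x) < e / 2"
    using g e unfolding uniformly_continuous_on_def by (meson UNIV_I half_gt_zero)
  have "\<forall>\<^sub>F i in sequentially. 1 / real (Suc i) < d"
    using order_tendstoD(2)[OF LIMSEQ_Suc[OF lim_1_over_n] d(1)] by simp
  then show "\<forall>\<^sub>F i in sequentially. \<forall>x\<in>UNIV. dist (conv (regular_dist UNIV sc g) (\<lambda>t. of_real (mollifier (1 / real (Suc i)) t)) x) (g x) < e"
  proof eventually_elim
    case (elim i)
    define h where "h = 1 / real (Suc i)"
    have h: "0 < h" "h < d" using elim by (auto simp: h_def)
    note \<rho> = mollifier[OF h(1)]
    have "dist (conv (regular_dist UNIV sc g) (\<lambda>t. of_real (mollifier h t)) x) (g x) < e" for x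
    proof -
      define r where "r y = mollifier h (x - y)" for y
      have r: "r = (\<lambda>y. mollifier h (x + (- 1) * y))" by (auto simp: r_def)
      have "has_bochner_integral lebesgue (mollifier h) 1"
        using \<rho>(4,5) by (simp add: has_bochner_integral_iff)
      then have "has_bochner_integral lebesgue r 1"
        by (subst (asm) has_bochner_integral_lebesgue_real_affine_iff[of "- 1" _ _ x]) (simp_all add: r)
      then have ri: "integrable lebesgue r" "(\<integral>y. r y \<partial>lebesgue) = 1" by (auto simp: has_bochner_integral_iff)
      have sm: "smooth (\<lambda>y. of_real (r y) :: 'k)" unfolding r_def by (intro smooth_of_real smooth_reflect \<rho>(1))
      have rz: "r y = 0" if "y \<notin> {x - h..x + h}" for y
        unfolding r_def by (rule \<rho>(2)) (use that in auto)
      have rz': "of_real (r y) = (0 :: 'k)" if "y \<notin> {x - h..x + h}" for y using rz[OF that] by simp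
      define G where "G y = indicator {x - h..x + h} y *\<^sub>R g y" for y
      have G: "bochner_integrable lebesgue G" unfolding G_def by (rule L1locD[OF UN gl]) simp
      have i1: "bochner_integrable lebesgue (\<lambda>y. r y *\<^sub>R G y)"
        using test_function_integrable[OF sc sm rz' G] by (simp add: re)
      have i2: "has_bochner lebesgue (\<lambda>y. r y *\<^sub>R g x) (1 *\<^sub>R g x)"
        using has_bochner_linear_image[OF bounded_linear_scaleR_left ri(1), of "g x"] ri(2) by simp
      then have i3: "bochner_integrable lebesgue (\<lambda>y. r y *\<^sub>R g x)" by blast
      have le: "norm (r y *\<^sub>R G y - r y *\<^sub>R g x) \<le> r y * (e / 2)" for y
      proof (cases "y \<in> {x - h..x + h}")
        case True
        then have "dist y x < d" using h by (auto simp: dist_real_def)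
        then have "norm (g y - g x) \<le> e / 2" using d(2)[of y x] by (simp add: dist_norm)
        moreover have r0: "0 \<le> r y" unfolding r_def by (rule \<rho>(3))
        ultimately have "r y * norm (g y - g x) \<le> r y * (e / 2)" by (rule mult_left_mono)
        then show ?thesis using True r0
          by (simp add: G_def scaleR_diff_right[symmetric])
      qed (simp add: rz)
      have "norm (bochner_integral lebesgue (\<lambda>y. r y *\<^sub>R G y) - bochner_integral lebesgue (\<lambda>y. r y *\<^sub>R g x)) \<le> (\<integral>y. r y * (e / 2) \<partial>lebesgue)"
        by (rule completion.bochner_integral_dist_le[OF i1 i3]) (use ri(1) le in auto)
      also have "\<dots> = e / 2" using ri(2) by simp
      also have "bochner_integral lebesgue (\<lambda>y. r y *\<^sub>R g x) = g x"
        using completion.bochner_integral_eq[OF i2] by simp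
      also have "bochner_integral lebesgue (\<lambda>y. r y *\<^sub>R G y) = conv (regular_dist UNIV sc g) (\<lambda>t. of_real (mollifier h t)) x"
      proof -
        have "(\<lambda>y. of_real (r y) :: 'k) \<in> test_functions UNIV"
          by (rule test_functionsI[OF sm rz']) simp_all
        from regular_dist_eq[OF sc UN this subset_UNIV rz', where f = g] show ?thesis
          by (simp add: conv_def r_def[symmetric] re G_def)
      qed
      finally show ?thesis using e by (simp add: dist_norm)
    qed
    then show ?case by (simp add: h_def)
  qed
qed

lemma dist_conv_class_Int_Mt_pow_Cu_subset:
  fixes sc :: "'k::{real_normed_field,euclidean_space} \<Rightarrow> 'x::banach \<Rightarrow> 'x"
  assumes sc: "banach_over sc" and A: "is_class UNIV sc A" and uc: "uniformly_closed UNIV sc A"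
  shows "dist_conv_class sc A \<inter> Mt_pow UNIV sc k (Funs (Cu UNIV)) \<subseteq> Mt_pow UNIV sc k A"
proof -
  have UN: "admissible_interval UNIV" by (simp add: admissible_interval_def)
  have sub: "Mt_pow UNIV sc k (Funs (Cu UNIV)) \<subseteq> distributions UNIV sc" for k
    by (cases k) (auto simp: Mt_pow_0 Mt_pow_Suc intro: regular_dist_in_distributions[OF sc UN])
  show ?thesis
  proof (induction k)
    case 0
    show ?case
    proof
      fix T assume T: "T \<in> dist_conv_class sc A \<inter> Mt_pow UNIV sc 0 (Funs (Cu UNIV))"
      then obtain f where f: "f \<in> Cu UNIV" "f \<in> L1loc UNIV" "T = regular_dist UNIV sc f" by (auto simp: Mt_pow_0)
      then obtain g where g: "uniformly_continuous_on UNIV g" "AE t in lebesgue_on UNIV. f t = g t"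
        by (auto simp: Cu_def)
      have Tg: "T = regular_dist UNIV sc g" using f(3) regular_dist_cong_AE[OF UN g(2)] by simp
      have "(\<lambda>t. of_real (mollifier (1 / real (Suc i)) t) :: 'k) \<in> test_functions UNIV" for i
        by (rule test_functionsI[of _ "- (1 / real (Suc i))" "1 / real (Suc i)"])
          (auto intro!: smooth_of_real mollifier)
      then have "conv T (\<lambda>t. of_real (mollifier (1 / real (Suc i)) t)) \<in> fun_part UNIV sc A" for i
        using T by (simp add: dist_conv_class_def)
      then have "g \<in> fun_part UNIV sc A"
        using uc[unfolded uniformly_closed_def, rule_format, of "\<lambda>i. conv T (\<lambda>t. of_real (mollifier (1 / real (Suc i)) t))" g]
          conv_mollifier_uniform_limit[OF sc g(1)] Tg by blast
      then show "T \<in> Mt_pow UNIV sc 0 A"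
        using regular_dist_in_dist_part_iff[OF sc UN open_UNIV A] fun_part_subset_L1loc
        unfolding Mt_pow_0 Tg by blast
    qed
  next
    case (Suc k)
    show ?case
    proof
      fix T assume T: "T \<in> dist_conv_class sc A \<inter> Mt_pow UNIV sc (Suc k) (Funs (Cu UNIV))"
      have "Mean_dist UNIV h T \<in> Mt_pow UNIV sc k A" if h: "0 < h" for h
      proof -
        have "Mean_dist UNIV h T \<in> Mt_pow UNIV sc k (Funs (Cu UNIV))" using T h by (simp add: Mt_pow_Suc)
        moreover from this have "Mean_dist UNIV h T \<in> dist_conv_class sc A"
          using T h sub by (intro dist_conv_class_Mean_dist) auto
        ultimately show ?thesis using Suc by blast
      qed
      then show "T \<in> Mt_pow UNIV sc (Suc k) A" using T by (simp add: Mt_pow_Suc)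
    qed
  qed
qed

theorem proposition5p6:
  fixes sc :: "'k::{real_normed_field,euclidean_space} \<Rightarrow> 'x::banach \<Rightarrow> 'x"
    and J :: "real set"
    and A :: "('k, 'x) gclass"
    and n k :: nat
  assumes "banach_over sc"
    and "admissible_interval J"
    and "is_class J sc A"
    and "uniformly_closed J sc A"
  shows "M_pow J sc (n + k) A \<inter> M_pow J sc k (Funs (Cu J)) \<subseteq> M_pow J sc k A
    \<and> (open J \<longrightarrow>
         M_pow J sc (n + k) A \<inter> M_pow J sc k (Funs (Cu J))
           = fun_part J sc (Dists (Mt_pow J sc (n + k) A)) \<inter> M_pow J sc k (Funs (Cu J)))
    \<and> (J = UNIV \<longrightarrow>
         dist_conv_class sc A \<inter> Mt_pow J sc k (Funs (Cu J)) \<subseteq> Mt_pow J sc k A)"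
proof (intro conjI impI)
  show "M_pow J sc (n + k) A \<inter> M_pow J sc k (Funs (Cu J)) \<subseteq> M_pow J sc k A"
    by (rule M_pow_Int_M_pow_Cu_subset[OF assms(2-4)])
next
  assume "open J"
  then have "M_pow J sc (n + k) A = fun_part J sc (Dists (Mt_pow J sc (n + k) A))"
    using M_pow_iff_Mt_pow[OF assms(1,2) _ assms(3)] M_pow_subset_L1loc by fastforce
  then show "M_pow J sc (n + k) A \<inter> M_pow J sc k (Funs (Cu J))
      = fun_part J sc (Dists (Mt_pow J sc (n + k) A)) \<inter> M_pow J sc k (Funs (Cu J))" by simp
next
  assume "J = UNIV"
  then show "dist_conv_class sc A \<inter> Mt_pow J sc k (Funs (Cu J)) \<subseteq> Mt_pow J sc k A"
    using dist_conv_class_Int_Mt_pow_Cu_subset assms by simp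
qed

end
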